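(* Let $p,q\ge 1$ be integers, $n=p+q$, $\varepsilon\in\{0,1\}$ and $r\in\mathbb{C}$. For $j,k\in\mathbb{Z}_{\ge 0}$ put $J=j+\frac{p-1}{2}$ and $K=k+\frac{q-1}{2}$. Let $\mathcal{E}^\varepsilon=\bigoplus_{j+k\equiv \varepsilon\,(\mathrm{mod}\,2)}\mathcal{V}(j,k)$ be the $(\mathfrak{g},\mathrm{SO}(p+1)\times \mathrm{SO}(q+1))$-invariant space of functions on $S^p\times S^q$ described in the context. Then the spectral function on $\mathcal{E}^\varepsilon$ of the intertwinor of order $2r$ (that is, the assignment to each $(j,k)$ with $j+k\equiv\varepsilon \pmod 2$ of the eigenvalue of the intertwinor on $\mathcal{V}(j,k)$) is unique up to normalization (multiplication by a constant) and is, up to normalization, $$ Z_\varepsilon(r;j,k)=\frac{\Gamma\left(\frac12(K+J+1+r)\right)\Gamma\left(\frac12(K-J+1+r)\right)\Gamma\left(\frac12\left(\varepsilon-\frac{p-q}{2}+1-r\right)\right)\Gamma\left(\frac12\left(\varepsilon+\frac{p+q}{2}-r\right)\right)}{\Gamma\left(\frac12(K+J+1-r)\right)\Gamma\left(\frac12(K-J+1-r)\right)\Gamma\left(\frac12\left(\varepsilon-\frac{p-q}{2}+1+r\right)\right)\Gamma\left(\frac12\left(\varepsilon+\frac{p+q}{2}+r\right)\right)} . $$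
   Context: Equip $S^p\times S^q$ with the pseudo-Riemannian product metric $g=-g_{S^p}+g_{S^q}$, where $g_{S^p},g_{S^q}$ are the standard round metrics of the unit spheres. Realize $M=S^p\times S^q$ as $\{\xi_{-p}^2+\cdots+\xi_0^2=\xi_1^2+\cdots+\xi_{q+1}^2=1\}$ inside $\mathbb{R}^{p+1,q+1}$, which is $\mathbb{R}^{p+q+2}$ with the quadratic form $-\xi_{-p}^2-\cdots-\xi_0^2+\xi_1^2+\cdots+\xi_{q+1}^2$. Let $\Xi$ be the set of nonzero null vectors of this form. The quotient $\Xi/\mathbb{R}_+^\times$ is identified with $M$ via $\Phi(\xi)=\xi/\sqrt{\xi_{-p}^2+\cdots+\xi_0^2}$, and $O(p+1,q+1)$ acts on $M$ by conformal transformations $z\mapsto\Phi(h\cdot z)$. The subgroup $\mathrm{SO}(p+1)\times\mathrm{SO}(q+1)$ acts by isometries and is a maximal compact subgroup of the identity component $\mathrm{SO}_0(p+1,q+1)$. $\mathfrak{g}$ denotes the Lie algebra of conformal vector fields on $(M,g)$ induced by this action (so $\mathfrak{g}\cong\mathfrak{so}(p+1,q+1)$); it is spanned by the vector fields on $M$ induced by $L_{\alpha\beta}=\varepsilon_\alpha\xi_\alpha\partial_\beta-\varepsilon_\beta\xi_\beta\partial_\alpha$, $-p\le\alpha,\beta\le q+1$, where $\partial_\alpha=\partial/\partial\xi_\alpha$, $\varepsilon_{-p}=\cdots=\varepsilon_0=-1$ and $\varepsilon_1=\cdots=\varepsilon_{q+1}=1$. For $X\in\mathfrak{g}$, $\omega_X\in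 C^\infty(M)$ is its conformal factor, defined by $\mathcal{L}_Xg=2\omega_Xg$, where $\mathcal{L}_X$ is the Lie derivative. On functions $\mathcal{L}_X f=Xf$, and $\omega_X$ acts by multiplication. Functions are complex-valued. With $\triangle_{S^p},\triangle_{S^q}$ the nonnegative Riemannian Laplacians, set $E(j)=\{f\in C^\infty(S^p):\triangle_{S^p}f=j(j+p-1)f\}$, $F(k)=\{f\in C^\infty(S^q):\triangle_{S^q}f=k(k+q-1)f\}$ and $\mathcal{V}(j,k)=E(j)\otimes F(k)\subset C^\infty(S^p\times S^q)$. The direct sum defining $\mathcal{E}^\varepsilon$ is algebraic (finite sums). For every $X\in\mathfrak{g}$ and $a\in\mathbb{C}$, the operator $\mathcal{L}_X+a\omega_X$ maps $\mathcal{E}^\varepsilon$ to itself. An intertwinor of order $2r$ is an operator $A$ that commutes with the action of $\mathrm{SO}(p+1)\times\mathrm{SO}(q+1)$, acts as a scalar on each $\mathcal{V}(j,k)$, and satisfies the intertwining relation $$ A\left(\mathcal{L}_X+\left(\tfrac n2-r\right)\omega_X\right)=\left(\mathcal{L}_X+\left(\tfrac n2+r\right)\omega_X\right)A\qquad\text{for all }X\in\mathfrak{g}. $$ $\Gamma$ is the Euler gamma function.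
   Formalization: Where a numerator Gamma has a pole, Z is read as its limit in r after scaling by a power independent of j,k. Uniqueness is not claimed (it fails) when r is a nonnegative integer with r-(p-q)/2-1-ε an even integer, e.g. p=q=1, ε=0, r=1; there only existence is shown. *)

theory Defs
  imports "HOL-Analysis.Analysis"
begin

section \<open>The manifold\<close>

text \<open>
  The unit sphere of \<open>real ^ 'm\<close> is turned into a type, so that a function on
  \<open>S\<^sup>p\<close> is exactly a function on \<open>'m usphere\<close> when \<open>CARD('m) = p + 1\<close>.
  In products \<open>'m usphere \<times> 'n usphere\<close> the first factor is \<open>S\<^sup>p\<close> (timelike),
  the second one is \<open>S\<^sup>q\<close> (spacelike).
\<close>

typedef (overloaded) ('m::finite) usphere = "sphere (0 :: real ^ 'm) 1"
  by (rule exI [of _ "axis undefined 1"]) (simp add: norm_axis_1)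

type_synonym ('m, 'n) ambient = "(real ^ 'm) \<times> (real ^ 'n)"
type_synonym ('m, 'n) mfd = "'m usphere \<times> 'n usphere"

definition embed :: "('m::finite, 'n::finite) mfd \<Rightarrow> ('m, 'n) ambient" where
  "embed z = (Rep_usphere (fst z), Rep_usphere (snd z))"

text \<open>
  Functions on the spheres are differentiated through their extensions that are homogeneous
  of degree 0 (\<open>sgn v = v /\<^sub>R norm v\<close>).  In tangent directions the derivative of the
  extension is the intrinsic derivative; in radial directions it is zero.
\<close>

definition sphere_ext :: "('m::finite usphere \<Rightarrow> 'b) \<Rightarrow> real ^ 'm \<Rightarrow> 'b" where
  "sphere_ext f = (\<lambda>v. f (Abs_usphere (sgn v)))"

definition mfd_ext :: "(('m::finite, 'n::finite) mfd \<Rightarrow> 'b) \<Rightarrow> ('m, 'n) ambient \<Rightarrow> 'b" where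
  "mfd_ext f = (\<lambda>w. f (Abs_usphere (sgn (fst w)), Abs_usphere (sgn (snd w))))"

text \<open>\<open>times_diff k S f\<close>, for open \<open>S\<close>: the function \<open>f\<close> is of class \<open>C\<^sup>k\<close> on \<open>S\<close>.\<close>

fun times_diff ::
  "nat \<Rightarrow> 'a::real_normed_vector set \<Rightarrow> ('a \<Rightarrow> 'b::real_normed_vector) \<Rightarrow> bool" where
  "times_diff 0 S f = continuous_on S f"
| "times_diff (Suc k) S f =
     (f differentiable_on S \<and> (\<forall>v. times_diff k S (\<lambda>x. frechet_derivative f (at x) v)))"

definition smooth_sphere :: "('m::finite usphere \<Rightarrow> 'b::real_normed_vector) \<Rightarrow> bool" where
  "smooth_sphere f \<longleftrightarrow> (\<forall>k. times_diff k {v. v \<noteq> 0} (sphere_ext f))"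

definition smooth_mfd ::
  "(('m::finite, 'n::finite) mfd \<Rightarrow> 'b::real_normed_vector) \<Rightarrow> bool" where
  "smooth_mfd f \<longleftrightarrow> (\<forall>k. times_diff k {w. fst w \<noteq> 0 \<and> snd w \<noteq> 0} (mfd_ext f))"

section \<open>Spherical Laplacian and the spaces V(j,k)\<close>

text \<open>
  The derivative of the extension vanishes in the normal direction.  Hence the sum over the
  ambient basis in \<open>sphere_grad\<close> is the tangential gradient, and the one in \<open>sphere_div\<close> is
  the trace over the tangent space of the covariant derivative of a tangent field.
\<close>

definition sphere_grad :: "('m::finite usphere \<Rightarrow> real) \<Rightarrow> 'm usphere \<Rightarrow> real ^ 'm" where
  "sphere_grad f x =
     (\<Sum>b\<in>Basis. frechet_derivative (sphere_ext f) (at (Rep_usphere x)) b *\<^sub>R b)"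

definition sphere_div :: "('m::finite usphere \<Rightarrow> real ^ 'm) \<Rightarrow> 'm usphere \<Rightarrow> real" where
  "sphere_div X x =
     (\<Sum>b\<in>Basis. frechet_derivative (sphere_ext X) (at (Rep_usphere x)) b \<bullet> b)"

definition sphere_laplacian :: "('m::finite usphere \<Rightarrow> complex) \<Rightarrow> 'm usphere \<Rightarrow> complex" where
  "sphere_laplacian f x =
     Complex (- sphere_div (sphere_grad (\<lambda>y. Re (f y))) x)
             (- sphere_div (sphere_grad (\<lambda>y. Im (f y))) x)"

definition eigenspace :: "nat \<Rightarrow> nat \<Rightarrow> ('m::finite usphere \<Rightarrow> complex) set" where
  "eigenspace p j = {f. smooth_sphere f \<and>
     (\<forall>x. sphere_laplacian f x = of_nat j * (of_nat j + of_nat p - 1) * f x)}"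

text \<open>The (algebraic) tensor product as a space of functions: finite sums of pure tensors.\<close>

definition V_space ::
  "nat \<Rightarrow> nat \<Rightarrow> nat \<Rightarrow> nat \<Rightarrow> (('m::finite, 'n::finite) mfd \<Rightarrow> complex) set" where
  "V_space p q j k = {f. \<exists>(N::nat) e g.
     (\<forall>i<N. e i \<in> eigenspace p j \<and> g i \<in> eigenspace q k) \<and>
     f = (\<lambda>(x, y). \<Sum>i<N. e i x * g i y)}"

definition E_space ::
  "nat \<Rightarrow> nat \<Rightarrow> nat \<Rightarrow> (('m::finite, 'n::finite) mfd \<Rightarrow> complex) set" where
  "E_space p q \<epsilon> = {f. \<exists>(N::nat) g.
     (\<forall>j k. g j k \<in> V_space p q j k) \<and>
     f = (\<lambda>z. \<Sum>(j, k) \<in> {(j, k). j \<le> N \<and> k \<le> N \<and> (j + k) mod 2 = \<epsilon>}. g j k z)}"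

section \<open>Conformal vector fields\<close>

definition metric ::
  "('m::finite, 'n::finite) ambient \<Rightarrow> ('m, 'n) ambient \<Rightarrow> real" where
  "metric u v = - (fst u \<bullet> fst v) + snd u \<bullet> snd v"

definition smooth_vector_field ::
  "(('m::finite, 'n::finite) mfd \<Rightarrow> ('m, 'n) ambient) \<Rightarrow> bool" where
  "smooth_vector_field X \<longleftrightarrow> smooth_mfd X \<and>
     (\<forall>z. fst (X z) \<bullet> fst (embed z) = 0 \<and> snd (X z) \<bullet> snd (embed z) = 0)"

definition lie_fun ::
  "(('m::finite, 'n::finite) mfd \<Rightarrow> ('m, 'n) ambient) \<Rightarrow>
   (('m, 'n) mfd \<Rightarrow> 'b::real_normed_vector) \<Rightarrow> ('m, 'n) mfd \<Rightarrow> 'b" where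
  "lie_fun X f z = frechet_derivative (mfd_ext f) (at (embed z)) (X z)"

definition lie_bracket ::
  "(('m::finite, 'n::finite) mfd \<Rightarrow> ('m, 'n) ambient) \<Rightarrow>
   (('m, 'n) mfd \<Rightarrow> ('m, 'n) ambient) \<Rightarrow> ('m, 'n) mfd \<Rightarrow> ('m, 'n) ambient" where
  "lie_bracket X U z = lie_fun X U z - lie_fun U X z"

definition lie_metric ::
  "(('m::finite, 'n::finite) mfd \<Rightarrow> ('m, 'n) ambient) \<Rightarrow>
   (('m, 'n) mfd \<Rightarrow> ('m, 'n) ambient) \<Rightarrow> (('m, 'n) mfd \<Rightarrow> ('m, 'n) ambient) \<Rightarrow>
   ('m, 'n) mfd \<Rightarrow> real" where
  "lie_metric X U V z = lie_fun X (\<lambda>y. metric (U y) (V y)) z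
     - metric (lie_bracket X U z) (V z) - metric (U z) (lie_bracket X V z)"

text \<open>For conformal \<open>X\<close> the factor exists, and it is unique since the metric is nondegenerate
  on nonzero tangent spaces.\<close>

definition conformal_factor ::
  "(('m::finite, 'n::finite) mfd \<Rightarrow> ('m, 'n) ambient) \<Rightarrow> ('m, 'n) mfd \<Rightarrow> real" where
  "conformal_factor X = (THE \<omega>. smooth_mfd \<omega> \<and>
     (\<forall>U V. smooth_vector_field U \<longrightarrow> smooth_vector_field V \<longrightarrow>
        (\<forall>z. lie_metric X U V z = 2 * \<omega> z * metric (U z) (V z))))"

text \<open>
  The coordinates of the ambient space are indexed by \<open>'m + 'n\<close>: \<open>Inl\<close> for the timelike and
  \<open>Inr\<close> for the spacelike ones.
\<close>

fun coord :: "('m::finite, 'n::finite) ambient \<Rightarrow> 'm + 'n \<Rightarrow> real" where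
  "coord \<xi> (Inl a) = fst \<xi> $ a"
| "coord \<xi> (Inr b) = snd \<xi> $ b"

fun unit_vec :: "'m + 'n \<Rightarrow> ('m::finite, 'n::finite) ambient" where
  "unit_vec (Inl a) = (axis a 1, 0)"
| "unit_vec (Inr b) = (0, axis b 1)"

fun eps_sign :: "'m + 'n \<Rightarrow> real" where
  "eps_sign (Inl a) = - 1"
| "eps_sign (Inr b) = 1"

definition L_field ::
  "'m + 'n \<Rightarrow> 'm + 'n \<Rightarrow> ('m::finite, 'n::finite) ambient \<Rightarrow> ('m, 'n) ambient" where
  "L_field \<alpha> \<beta> \<xi> = (eps_sign \<alpha> * coord \<xi> \<alpha>) *\<^sub>R unit_vec \<beta>
                     - (eps_sign \<beta> * coord \<xi> \<beta>) *\<^sub>R unit_vec \<alpha>"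

definition Phi :: "('m::finite, 'n::finite) ambient \<Rightarrow> ('m, 'n) ambient" where
  "Phi \<xi> = \<xi> /\<^sub>R norm (fst \<xi>)"

text \<open>\<open>L_field \<alpha> \<beta>\<close> is tangent to the null cone and commutes with dilations, so its
  push-forward along \<open>Phi\<close> may be computed at the points of the manifold itself.\<close>

definition induced_field ::
  "'m + 'n \<Rightarrow> 'm + 'n \<Rightarrow> ('m::finite, 'n::finite) mfd \<Rightarrow> ('m, 'n) ambient" where
  "induced_field \<alpha> \<beta> z = frechet_derivative Phi (at (embed z)) (L_field \<alpha> \<beta> (embed z))"

definition conf_algebra :: "(('m::finite, 'n::finite) mfd \<Rightarrow> ('m, 'n) ambient) set" where
  "conf_algebra = {X. \<exists>c :: 'm + 'n \<Rightarrow> 'm + 'n \<Rightarrow> real.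
     X = (\<lambda>z. \<Sum>\<alpha>\<in>UNIV. \<Sum>\<beta>\<in>UNIV. c \<alpha> \<beta> *\<^sub>R induced_field \<alpha> \<beta> z)}"

section \<open>Intertwinors\<close>

definition rot_act ::
  "real ^ 'm ^ 'm \<Rightarrow> real ^ 'n ^ 'n \<Rightarrow>
   (('m::finite, 'n::finite) mfd \<Rightarrow> complex) \<Rightarrow> ('m, 'n) mfd \<Rightarrow> complex" where
  "rot_act R S f z =
     f (Abs_usphere (matrix_inv R *v Rep_usphere (fst z)),
        Abs_usphere (matrix_inv S *v Rep_usphere (snd z)))"

definition conf_op ::
  "complex \<Rightarrow> (('m::finite, 'n::finite) mfd \<Rightarrow> ('m, 'n) ambient) \<Rightarrow>
   (('m, 'n) mfd \<Rightarrow> complex) \<Rightarrow> ('m, 'n) mfd \<Rightarrow> complex" where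
  "conf_op a X f z = lie_fun X f z + a * of_real (conformal_factor X z) * f z"

text \<open>Operators on \<open>E_space\<close> are given by total functions of which only the values on
  \<open>E_space\<close> are relevant.\<close>

definition linear_operator ::
  "nat \<Rightarrow> nat \<Rightarrow> nat \<Rightarrow>
   ((('m::finite, 'n::finite) mfd \<Rightarrow> complex) \<Rightarrow> (('m, 'n) mfd \<Rightarrow> complex)) \<Rightarrow> bool" where
  "linear_operator p q \<epsilon> A \<longleftrightarrow>
     (\<forall>f\<in>E_space p q \<epsilon>. A f \<in> E_space p q \<epsilon>) \<and>
     (\<forall>f\<in>E_space p q \<epsilon>. \<forall>g\<in>E_space p q \<epsilon>. A (\<lambda>z. f z + g z) = (\<lambda>z. A f z + A g z)) \<and>
     (\<forall>f\<in>E_space p q \<epsilon>. \<forall>c. A (\<lambda>z. c * f z) = (\<lambda>z. c * A f z))"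

definition spectral_function ::
  "nat \<Rightarrow> nat \<Rightarrow> nat \<Rightarrow>
   ((('m::finite, 'n::finite) mfd \<Rightarrow> complex) \<Rightarrow> (('m, 'n) mfd \<Rightarrow> complex)) \<Rightarrow>
   (nat \<Rightarrow> nat \<Rightarrow> complex) \<Rightarrow> bool" where
  "spectral_function p q \<epsilon> A \<mu> \<longleftrightarrow>
     (\<forall>j k. (j + k) mod 2 = \<epsilon> \<longrightarrow> (\<forall>f\<in>V_space p q j k. A f = (\<lambda>z. \<mu> j k * f z)))"

text \<open>Here \<open>n / 2 = (p + q) / 2\<close>, and the order of the intertwinor is \<open>2 r\<close>.\<close>

definition intertwinor ::
  "nat \<Rightarrow> nat \<Rightarrow> nat \<Rightarrow> complex \<Rightarrow>
   ((('m::finite, 'n::finite) mfd \<Rightarrow> complex) \<Rightarrow> (('m, 'n) mfd \<Rightarrow> complex)) \<Rightarrow> bool" where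
  "intertwinor p q \<epsilon> r A \<longleftrightarrow>
     linear_operator p q \<epsilon> A \<and>
     (\<forall>R S. rotation_matrix R \<longrightarrow> rotation_matrix S \<longrightarrow>
        (\<forall>f\<in>E_space p q \<epsilon>. A (rot_act R S f) = rot_act R S (A f))) \<and>
     (\<exists>\<mu>. spectral_function p q \<epsilon> A \<mu>) \<and>
     (\<forall>X\<in>conf_algebra. \<forall>f\<in>E_space p q \<epsilon>.
        A (conf_op (of_nat (p + q) / 2 - r) X f) = conf_op (of_nat (p + q) / 2 + r) X (A f))"

section \<open>The spectral function\<close>

definition J_of :: "nat \<Rightarrow> nat \<Rightarrow> complex" where
  "J_of p j = of_nat j + (of_nat p - 1) / 2"

text \<open>The library conventions \<open>Gamma z = 0\<close> at the poles \<open>z \<in> \<int>\<^sub>\<le>\<^sub>0\<close> and \<open>x / 0 = 0\<close> make a pole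
  in the denominator contribute the value 0 of the entire function 1 / Gamma, as it should.
  A pole in the numerator has to be excluded, see \<open>Z_defined\<close>.\<close>

definition Z :: "nat \<Rightarrow> nat \<Rightarrow> nat \<Rightarrow> complex \<Rightarrow> nat \<Rightarrow> nat \<Rightarrow> complex" where
  "Z p q \<epsilon> r j k = (let J = J_of p j; K = J_of q k;
       d = (of_nat p - of_nat q) / 2; h = (of_nat p + of_nat q) / 2; e = of_nat \<epsilon> in
     (Gamma ((K + J + 1 + r) / 2) * Gamma ((K - J + 1 + r) / 2) *
      Gamma ((e - d + 1 - r) / 2) * Gamma ((e + h - r) / 2)) /
     (Gamma ((K + J + 1 - r) / 2) * Gamma ((K - J + 1 - r) / 2) *
      Gamma ((e - d + 1 + r) / 2) * Gamma ((e + h + r) / 2)))"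

definition Z_defined :: "nat \<Rightarrow> nat \<Rightarrow> nat \<Rightarrow> complex \<Rightarrow> bool" where
  "Z_defined p q \<epsilon> r \<longleftrightarrow>
     (\<forall>j k. (j + k) mod 2 = \<epsilon> \<longrightarrow>
        (J_of q k + J_of p j + 1 + r) / 2 \<notin> \<int>\<^sub>\<le>\<^sub>0 \<and>
        (J_of q k - J_of p j + 1 + r) / 2 \<notin> \<int>\<^sub>\<le>\<^sub>0) \<and>
     (of_nat \<epsilon> - (of_nat p - of_nat q) / 2 + 1 - r) / 2 \<notin> \<int>\<^sub>\<le>\<^sub>0 \<and>
     (of_nat \<epsilon> + (of_nat p + of_nat q) / 2 - r) / 2 \<notin> \<int>\<^sub>\<le>\<^sub>0"

text \<open>
  The integers \<open>r \<ge> 0\<close> with \<open>J - K \<equiv> r - 1 (mod 2)\<close> whenever \<open>j + k \<equiv> \<epsilon> (mod 2)\<close>;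
  they exist only for \<open>p - q\<close> even.  For these \<open>r\<close> the relations between the eigenvalues on
  neighbouring \<open>V(j,k)\<close> with large \<open>J - K\<close> and with large \<open>K - J\<close> decouple, and the space of
  spectral functions is more than one-dimensional.  All such \<open>r\<close> violate \<open>Z_defined\<close>.
\<close>

definition decoupled :: "nat \<Rightarrow> nat \<Rightarrow> nat \<Rightarrow> complex \<Rightarrow> bool" where
  "decoupled p q \<epsilon> r \<longleftrightarrow> r \<in> \<nat> \<and>
     (r - ((of_nat p - of_nat q) / 2 + 1 + of_nat \<epsilon>)) / 2 \<in> \<int>"

text \<open>
  The value at \<open>r\<close> of the meromorphic family \<open>Z\<close>, up to normalization: the family is multiplied
  by the power of \<open>s - r\<close>, independent of \<open>(j,k)\<close>, for which the limit is finite and nonzero.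
\<close>

definition renormalized_Z ::
  "nat \<Rightarrow> nat \<Rightarrow> nat \<Rightarrow> complex \<Rightarrow> (nat \<Rightarrow> nat \<Rightarrow> complex) \<Rightarrow> bool" where
  "renormalized_Z p q \<epsilon> r W \<longleftrightarrow> (\<exists>m::nat.
     (\<forall>j k. (j + k) mod 2 = \<epsilon> \<longrightarrow> ((\<lambda>s. (s - r) ^ m * Z p q \<epsilon> s j k) \<longlongrightarrow> W j k) (at r)) \<and>
     (\<exists>j k. (j + k) mod 2 = \<epsilon> \<and> W j k \<noteq> 0))"

end

theory Submission
  imports Defs
begin

text \<open>
  A coordinate function times an eigenfunction of degree \<open>j\<close> is a sum of eigenfunctions of degrees
  \<open>j + 1\<close> and \<open>j - 1\<close>, and so are the components of the gradient of the eigenfunction.  Hence the mixed conformal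
  fields, with conformal factor \<open>x\<^sub>a y\<^sub>b\<close>, map \<open>V(j,k)\<close> into the four spaces \<open>V(j \<plusminus> 1, k \<plusminus> 1)\<close> by
  explicit scalars times fixed nonzero maps, while the other fields preserve \<open>V(j,k)\<close>.  The
  intertwining relation therefore says exactly that the eigenvalues satisfy two first-order
  recurrences, along \<open>j - k\<close> and along \<open>j + k\<close> constant.  The functional equation of \<open>\<Gamma>\<close> shows that
  \<open>Z\<close> solves them, and so does the leading coefficient of the meromorphic family \<open>Z\<close> at a pole;
  uniqueness amounts to following the zeros of the coefficients through the lattice of pairs \<open>(j,k)\<close>.
\<close>

section \<open>Calculus of smooth functions\<close>

text \<open>Harmonic polynomials never appear. For an eigenfunction \<open>e\<close> of degree
  \<open>j\<close> the functions \<open>sc a x *\<^sub>R e x\<close> and \<open>sderiv a e x\<close>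
  span a plane that the Laplacian preserves; its two-by-two matrix has the eigenvalues of degrees
  \<open>j + 1\<close> and \<open>j - 1\<close>, and the ladder components are the eigenvectors. In
  degree 0 this has to be supplemented by the vanishing gradient of harmonic functions, which a
  maximum principle supplies.

  Since the four target spaces are independent, the intertwining relation can be compared
  coefficient by coefficient, provided that suitable coordinates make each ladder component nonzero.

  One value has to determine a solution although coefficients of the recurrences may vanish. On a
  high level \<open>j + k = L\<close> only two edges can block the propagation, and their order
  decides whether a good starting point exists.

  The constant Gamma factors of \<open>Z\<close> are the reciprocals of the other ones at
  \<open>(0, \<epsilon>)\<close>. Hence the pole order there is 0 for every \<open>r\<close>, the
  maximal pole order over all \<open>(j, k)\<close> is a natural number, and the corresponding power
  of \<open>s - r\<close> produces a limit that is finite everywhere and nonzero somewhere.\<close>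

abbreviation fd :: "('a::real_normed_vector \<Rightarrow> 'b::real_normed_vector) \<Rightarrow> 'a \<Rightarrow> 'a \<Rightarrow> 'b" where
  "fd f x \<equiv> frechet_derivative f (at x)"

text \<open>No differentiability is assumed: \<open>frechet_derivative\<close> is a choice among the
  derivatives at \<open>x\<close>, and both functions have the same ones, possibly none.\<close>

lemma frechet_derivative_cong_open:
  assumes "open S" "x \<in> S" "\<And>y. y \<in> S \<Longrightarrow> f y = g y"
  shows "fd f x = fd g x"
proof -
  have "(f has_derivative F) (at x) \<longleftrightarrow> (g has_derivative F) (at x)" for F
    using has_derivative_transform_within_open[OF _ assms(1,2)] assms(3) by metis
  then show ?thesis by (simp add: frechet_derivative_def)
qed

lemma times_diff_cong:
  assumes "open S" "\<And>x. x \<in> S \<Longrightarrow> f x = g x"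
  shows "times_diff k S f \<longleftrightarrow> times_diff k S g"
proof -
  have *: "times_diff k S f \<Longrightarrow> times_diff k S g" if "\<And>x. x \<in> S \<Longrightarrow> f x = g x" for f g
    using that
  proof (induction k arbitrary: f g)
    case 0
    then show ?case by (simp cong: continuous_on_cong)
  next
    case (Suc k)
    have "g differentiable_on S"
      unfolding differentiable_on_def
    proof
      fix x assume "x \<in> S"
      then show "g differentiable at x within S"
        using Suc.prems differentiable_transform_within[of f x S 1 g]
        by (simp add: differentiable_on_def)
    qed
    moreover have "times_diff k S (\<lambda>x. fd g x v)" for v
    proof (rule Suc.IH)
      show "times_diff k S (\<lambda>x. fd f x v)" using Suc.prems by simp
      show "fd f x v = fd g x v" if "x \<in> S" for x
        using frechet_derivative_cong_open[OF assms(1) that, of f g] Suc.prems by simp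
    qed
    ultimately show ?case by simp
  qed
  show ?thesis using *[of f g] *[of g f] assms(2) by auto
qed

lemma times_diff_SucI:
  assumes "open S" "\<And>x. x \<in> S \<Longrightarrow> (f has_derivative f' x) (at x)"
    "\<And>v. times_diff k S (\<lambda>x. f' x v)"
  shows "times_diff (Suc k) S f"
proof -
  have "f differentiable_on S"
    using assms(2) by (meson differentiable_at_imp_differentiable_on differentiable_def)
  moreover have "times_diff k S (\<lambda>x. fd f x v)" for v
    using assms times_diff_cong[of S "\<lambda>x. f' x v" "\<lambda>x. fd f x v" k]
    by (metis frechet_derivative_at)
  ultimately show ?thesis by simp
qed

lemma times_diff_SucD:
  assumes "times_diff (Suc k) S f" "open S" "x \<in> S"
  shows "(f has_derivative fd f x) (at x)"
  using assms by (simp add: differentiable_on_eq_differentiable_at frechet_derivative_works)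

lemma times_diff_Suc_imp: "open S \<Longrightarrow> times_diff (Suc k) S f \<Longrightarrow> times_diff k S f"
proof (induction k arbitrary: f)
  case 0
  then show ?case using differentiable_imp_continuous_on by auto
next
  case (Suc k)
  then show ?case by (metis times_diff.simps(2))
qed

definition smooth_on :: "'a::real_normed_vector set \<Rightarrow> ('a \<Rightarrow> 'b::real_normed_vector) \<Rightarrow> bool" where
  "smooth_on S f \<longleftrightarrow> (\<forall>k. times_diff k S f)"

lemma smooth_on_cong:
  assumes "open S" "\<And>x. x \<in> S \<Longrightarrow> f x = g x"
  shows "smooth_on S f \<longleftrightarrow> smooth_on S g"
  unfolding smooth_on_def using times_diff_cong[OF assms] by auto

lemma smooth_on_has_derivative:
  assumes "smooth_on S f" "open S" "x \<in> S"
  shows "(f has_derivative fd f x) (at x)"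
  using assms times_diff_SucD unfolding smooth_on_def by blast

lemma smooth_on_continuous_on: "smooth_on S f \<Longrightarrow> continuous_on S f"
  unfolding smooth_on_def by (metis times_diff.simps(1))

lemma smooth_on_fd: "smooth_on S f \<Longrightarrow> smooth_on S (\<lambda>x. fd f x v)"
  unfolding smooth_on_def by (metis times_diff.simps(2))

lemma times_diff_const: "open S \<Longrightarrow> times_diff k S (\<lambda>x. c)"
proof (induction k arbitrary: c)
  case (Suc k)
  then show ?case by (intro times_diff_SucI[where f' = "\<lambda>x v. 0"]) auto
qed simp

lemma smooth_on_const: "open S \<Longrightarrow> smooth_on S (\<lambda>x. c)"
  by (simp add: smooth_on_def times_diff_const)

lemma smooth_on_linear:
  assumes "open S" "bounded_linear L"
  shows "smooth_on S L"
  unfolding smooth_on_def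
proof
  fix k show "times_diff k S L"
  proof (cases k)
    case 0
    then show ?thesis using assms linear_continuous_on by auto
  next
    case (Suc k)
    then show ?thesis
      using assms times_diff_SucI[where f' = "\<lambda>x. L"] times_diff_const bounded_linear.has_derivative[OF assms(2)]
      by (metis bounded_linear_imp_has_derivative)
  qed
qed

lemma times_diff_add:
  assumes "open S" "times_diff k S f" "times_diff k S g"
  shows "times_diff k S (\<lambda>x. f x + g x)"
  using assms(2,3)
proof (induction k arbitrary: f g)
  case 0
  then show ?case by (simp add: continuous_on_add)
next
  case (Suc k)
  show ?case
  proof (rule times_diff_SucI[where f' = "\<lambda>x v. fd f x v + fd g x v", OF assms(1)])
    show "((\<lambda>x. f x + g x) has_derivative (\<lambda>v. fd f x v + fd g x v)) (at x)" if "x \<in> S" for x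
      using times_diff_SucD[OF Suc.prems(1) assms(1) that] times_diff_SucD[OF Suc.prems(2) assms(1) that]
      by (rule has_derivative_add)
    show "times_diff k S (\<lambda>x. fd f x v + fd g x v)" for v
      using Suc by simp
  qed
qed

lemma smooth_on_add:
  "open S \<Longrightarrow> smooth_on S f \<Longrightarrow> smooth_on S g \<Longrightarrow> smooth_on S (\<lambda>x. f x + g x)"
  by (simp add: smooth_on_def times_diff_add)

lemma (in bounded_bilinear) times_diff_prod:
  assumes "open S" "times_diff k S f" "times_diff k S g"
  shows "times_diff k S (\<lambda>x. prod (f x) (g x))"
  using assms(2,3)
proof (induction k arbitrary: f g)
  case 0
  then show ?case by (simp add: continuous_on)
next
  case (Suc k)
  show ?case
  proof (rule times_diff_SucI[where f' = "\<lambda>x v. prod (f x) (fd g x v) + prod (fd f x v) (g x)", OF assms(1)])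
    show "((\<lambda>x. prod (f x) (g x)) has_derivative
            (\<lambda>v. prod (f x) (fd g x v) + prod (fd f x v) (g x))) (at x)" if "x \<in> S" for x
      using times_diff_SucD[OF Suc.prems(1) assms(1) that] times_diff_SucD[OF Suc.prems(2) assms(1) that]
      by (rule FDERIV)
    show "times_diff k S (\<lambda>x. prod (f x) (fd g x v) + prod (fd f x v) (g x))" for v
      using Suc.prems times_diff_Suc_imp[OF assms(1) Suc.prems(1)] times_diff_Suc_imp[OF assms(1) Suc.prems(2)]
      by (intro times_diff_add assms Suc.IH) simp_all
  qed
qed

lemma (in bounded_bilinear) smooth_on_prod:
  "open S \<Longrightarrow> smooth_on S f \<Longrightarrow> smooth_on S g \<Longrightarrow> smooth_on S (\<lambda>x. prod (f x) (g x))"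
  by (simp add: smooth_on_def times_diff_prod)

lemmas smooth_on_scaleR = bounded_bilinear.smooth_on_prod[OF bounded_bilinear_scaleR]
lemmas smooth_on_inner = bounded_bilinear.smooth_on_prod[OF bounded_bilinear_inner]

lemma smooth_on_post:
  assumes "open S" "bounded_linear L" "smooth_on S f"
  shows "smooth_on S (\<lambda>x. L (f x))"
proof -
  interpret L: bounded_linear L by fact
  \<comment> \<open>A linear map is the bilinear map \<open>u *\<^sub>R L v\<close> with
    \<open>u\<close> frozen at 1, so the product rule covers it.\<close>
  have "bounded_bilinear (\<lambda>(u::real) v. u *\<^sub>R L v)"
    using bounded_bilinear.comp[OF bounded_bilinear_scaleR bounded_linear_ident assms(2)] .
  from bounded_bilinear.smooth_on_prod[OF this assms(1) smooth_on_const[OF assms(1), of 1] assms(3)]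
  show ?thesis by simp
qed

lemma smooth_on_minus: "open S \<Longrightarrow> smooth_on S f \<Longrightarrow> smooth_on S (\<lambda>x. - f x)"
  using smooth_on_post[of S uminus f] bounded_linear_minus[OF bounded_linear_ident] by simp

lemma smooth_on_diff:
  "open S \<Longrightarrow> smooth_on S f \<Longrightarrow> smooth_on S g \<Longrightarrow> smooth_on S (\<lambda>x. f x - g x)"
  using smooth_on_add[of S f "\<lambda>x. - g x"] smooth_on_minus by auto

lemma smooth_on_sum:
  "open S \<Longrightarrow> (\<And>i. i \<in> I \<Longrightarrow> smooth_on S (f i)) \<Longrightarrow> smooth_on S (\<lambda>x. \<Sum>i\<in>I. f i x)"
  by (induction I rule: infinite_finite_induct) (auto intro: smooth_on_const smooth_on_add)

lemma times_diff_compose_linear: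
  assumes "open S" "open T" "bounded_linear L" "\<And>x. x \<in> S \<Longrightarrow> L x \<in> T" "times_diff k T f"
  shows "times_diff k S (\<lambda>x. f (L x))"
  using assms(5)
proof (induction k arbitrary: f)
  case 0
  have "continuous_on (L ` S) f" using 0 assms(4) by (auto intro: continuous_on_subset)
  then show ?case
    using continuous_on_compose2[of "L ` S" f S L] linear_continuous_on[OF assms(3)] by simp
next
  case (Suc k)
  show ?case
  proof (rule times_diff_SucI[where f' = "\<lambda>x v. fd f (L x) (L v)", OF assms(1)])
    show "((\<lambda>x. f (L x)) has_derivative (\<lambda>v. fd f (L x) (L v))) (at x)" if "x \<in> S" for x
      using has_derivative_compose[OF bounded_linear_imp_has_derivative[OF assms(3)]
          times_diff_SucD[OF Suc.prems assms(2) assms(4)[OF that]]] .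
    show "times_diff k S (\<lambda>x. fd f (L x) (L v))" for v
      using Suc.IH[of "\<lambda>x. fd f x (L v)"] Suc.prems by simp
  qed
qed

lemma smooth_on_compose_linear:
  assumes "open S" "open T" "bounded_linear L" "\<And>x. x \<in> S \<Longrightarrow> L x \<in> T" "smooth_on T f"
  shows "smooth_on S (\<lambda>x. f (L x))"
  using assms times_diff_compose_linear unfolding smooth_on_def by metis

lemma open_nonzero: "open {v::'a::real_normed_vector. v \<noteq> 0}"
proof -
  have "{v::'a. v \<noteq> 0} = - {0}" by auto
  then show ?thesis by (metis open_Compl closed_singleton)
qed

lemma has_derivative_inverse_norm:
  fixes x :: "'a::real_inner"
  assumes "x \<noteq> 0"
  shows "((\<lambda>x. inverse (norm x)) has_derivative
           (\<lambda>v. - ((x \<bullet> v) * (inverse (norm x) * (inverse (norm x) * inverse (norm x)))))) (at x)"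
  using Deriv.has_derivative_inverse[OF _ has_derivative_norm[OF assms], simplified] assms
  by (simp add: sgn_div_norm inner_commute mult_ac)

text \<open>The derivative is a polynomial in the function itself and a linear form, so each order
  of differentiability yields the next one.\<close>

lemma smooth_on_inverse_norm:
  "smooth_on {v. v \<noteq> 0} (\<lambda>x::'a::real_inner. inverse (norm x))"
  unfolding smooth_on_def
proof
  fix k
  show "times_diff k {v. v \<noteq> 0} (\<lambda>x::'a. inverse (norm x))"
  proof (induction k)
    case 0
    then show ?case by (auto intro!: continuous_intros)
  next
    case (Suc k)
    let ?g = "\<lambda>x::'a. inverse (norm x)"
    have 1: "times_diff k {v. v \<noteq> 0} (\<lambda>x::'a. x \<bullet> v)" for v
      using smooth_on_linear[OF open_nonzero bounded_linear_inner_left, of v]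
      by (simp add: smooth_on_def)
    have 2: "times_diff k {v. v \<noteq> 0} (\<lambda>x. (x \<bullet> v) * (?g x * (?g x * ?g x)))" for v
      by (intro bounded_bilinear.times_diff_prod[OF bounded_bilinear_mult] open_nonzero 1 Suc)
    have 3: "times_diff k {v. v \<noteq> 0} (\<lambda>x. -1 * ((x \<bullet> v) * (?g x * (?g x * ?g x))))" for v
      by (intro bounded_bilinear.times_diff_prod[OF bounded_bilinear_mult] open_nonzero 2 times_diff_const)
    show ?case
      by (rule times_diff_SucI[OF open_nonzero has_derivative_inverse_norm]) (use 3 in auto)
  qed
qed

lemma smooth_on_sgn: "smooth_on {v. v \<noteq> 0} (sgn :: 'a::real_inner \<Rightarrow> 'a)"
proof -
  have eq: "sgn = (\<lambda>x::'a. inverse (norm x) *\<^sub>R x)" by (auto simp: sgn_div_norm)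
  show ?thesis unfolding eq
    using smooth_on_scaleR[OF open_nonzero smooth_on_inverse_norm
        smooth_on_linear[OF open_nonzero bounded_linear_ident]] by simp
qed

lemma smooth_on_norm: "smooth_on {v. v \<noteq> 0} (norm :: 'a::real_inner \<Rightarrow> real)"
proof -
  have "smooth_on {v. v \<noteq> 0} (\<lambda>x::'a. sgn x \<bullet> x)"
    by (intro smooth_on_inner open_nonzero smooth_on_sgn smooth_on_linear bounded_linear_ident)
  moreover have "(\<lambda>x::'a. sgn x \<bullet> x) = norm"
    by (rule ext) (simp add: sgn_div_norm flip: power2_norm_eq_inner, auto simp: power2_eq_square field_simps)
  ultimately show ?thesis by simp
qed

lemma has_derivative_sgn:
  fixes x :: "'a::real_inner"
  assumes "norm x = 1"
  shows "(sgn has_derivative (\<lambda>v. v - (x \<bullet> v) *\<^sub>R x)) (at x)"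
proof -
  have "x \<noteq> 0" using assms by auto
  from has_derivative_scaleR[OF has_derivative_inverse_norm[OF this] has_derivative_ident]
  have "((\<lambda>x. inverse (norm x) *\<^sub>R x) has_derivative (\<lambda>v. v - (x \<bullet> v) *\<^sub>R x)) (at x)"
    using assms by simp
  then show ?thesis by (simp add: sgn_div_norm [abs_def])
qed

section \<open>Derivatives along lines and symmetry of second derivatives\<close>

lemma has_derivative_along:
  assumes "(f has_derivative f') (at (a + t *\<^sub>R w))"
  shows "((\<lambda>s. f (a + s *\<^sub>R w)) has_vector_derivative f' w) (at t)"
proof -
  have "((\<lambda>s. a + s *\<^sub>R w) has_derivative (\<lambda>s. s *\<^sub>R w)) (at t)"
    by (auto intro!: derivative_eq_intros)
  from has_derivative_compose[OF this assms] have "((\<lambda>s. f (a + s *\<^sub>R w)) has_derivative (\<lambda>s. f' (s *\<^sub>R w))) (at t)" .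
  moreover have "f' (s *\<^sub>R w) = s *\<^sub>R f' w" for s
    using assms has_derivative_linear linear_cmul by blast
  ultimately show ?thesis by (simp add: has_vector_derivative_def)
qed

text \<open>The mean value theorem is used twice: in direction \<open>w\<close> for the increment of
  \<open>f\<close> over a step \<open>h *\<^sub>R v\<close>, then in direction \<open>v\<close>. The
  left-hand side of the equation is symmetric in \<open>w\<close> and \<open>v\<close>, the
  right-hand side is not.\<close>

lemma second_difference_mvt:
  fixes f :: "'a::real_normed_vector \<Rightarrow> real"
  assumes sm: "smooth_on S f" and S: "open S" and b: "ball x d \<subseteq> S"
    and h: "0 < h" "h * (norm w + norm v) < d"
  obtains \<xi> \<eta> where "dist (x + \<xi> *\<^sub>R w + \<eta> *\<^sub>R v) x < d"
    "f (x + h *\<^sub>R w + h *\<^sub>R v) - f (x + h *\<^sub>R w) - f (x + h *\<^sub>R v) + f x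
       = h * h * fd (\<lambda>y. fd f y w) (x + \<xi> *\<^sub>R w + \<eta> *\<^sub>R v) v"
proof -
  have near: "dist (x + s *\<^sub>R w + t *\<^sub>R v) x < d" if "0 \<le> s" "s \<le> h" "0 \<le> t" "t \<le> h" for s t
  proof -
    have "norm (s *\<^sub>R w + t *\<^sub>R v) \<le> s * norm w + t * norm v"
      using norm_triangle_ineq[of "s *\<^sub>R w" "t *\<^sub>R v"] that by simp
    also have "\<dots> \<le> h * norm w + h * norm v"
      using that by (intro add_mono mult_right_mono) auto
    also have "\<dots> < d" using h by (simp add: algebra_simps)
    finally show ?thesis by (simp add: dist_norm add.assoc)
  qed
  have inS: "x + s *\<^sub>R w + t *\<^sub>R v \<in> S" if "0 \<le> s" "s \<le> h" "0 \<le> t" "t \<le> h" for s t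
    using near[OF that] b by (auto simp: dist_commute)
  have D: "((\<lambda>s. f (x + s *\<^sub>R w + t *\<^sub>R v)) has_real_derivative fd f (x + s *\<^sub>R w + t *\<^sub>R v) w) (at s)"
    if "0 \<le> s" "s \<le> h" "0 \<le> t" "t \<le> h" for s t
    using has_derivative_along[of f "fd f (x + s *\<^sub>R w + t *\<^sub>R v)" "x + t *\<^sub>R v" s w]
      smooth_on_has_derivative[OF sm S inS[OF that]]
    by (simp add: has_real_derivative_iff_has_vector_derivative algebra_simps)
  have D2: "((\<lambda>t. fd f (x + s *\<^sub>R w + t *\<^sub>R v) w) has_real_derivative
      fd (\<lambda>y. fd f y w) (x + s *\<^sub>R w + t *\<^sub>R v) v) (at t)"
    if "0 \<le> s" "s \<le> h" "0 \<le> t" "t \<le> h" for s t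
    using has_derivative_along[of "\<lambda>y. fd f y w" "fd (\<lambda>y. fd f y w) (x + s *\<^sub>R w + t *\<^sub>R v)" "x + s *\<^sub>R w" t v]
      smooth_on_has_derivative[OF smooth_on_fd[OF sm] S inS[OF that]]
    by (simp add: has_real_derivative_iff_has_vector_derivative)
  let ?g = "\<lambda>s. f (x + s *\<^sub>R w + h *\<^sub>R v) - f (x + s *\<^sub>R w + 0 *\<^sub>R v)"
  have "\<exists>\<xi>. \<xi> > 0 \<and> \<xi> < h \<and> ?g h - ?g 0 =
      (h - 0) * (fd f (x + \<xi> *\<^sub>R w + h *\<^sub>R v) w - fd f (x + \<xi> *\<^sub>R w + 0 *\<^sub>R v) w)"
    by (rule MVT2[OF h(1)]) (use h in \<open>intro DERIV_diff D; simp\<close>)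
  then obtain \<xi> where xi: "\<xi> > 0" "\<xi> < h" "?g h - ?g 0 =
      h * (fd f (x + \<xi> *\<^sub>R w + h *\<^sub>R v) w - fd f (x + \<xi> *\<^sub>R w + 0 *\<^sub>R v) w)" by auto
  have "\<exists>\<eta>. \<eta> > 0 \<and> \<eta> < h \<and> fd f (x + \<xi> *\<^sub>R w + h *\<^sub>R v) w - fd f (x + \<xi> *\<^sub>R w + 0 *\<^sub>R v) w =
      (h - 0) * fd (\<lambda>y. fd f y w) (x + \<xi> *\<^sub>R w + \<eta> *\<^sub>R v) v"
    by (rule MVT2[OF h(1)]) (use h xi in \<open>intro D2; simp\<close>)
  then obtain \<eta> where "\<eta> > 0" "\<eta> < h"
    "fd f (x + \<xi> *\<^sub>R w + h *\<^sub>R v) w - fd f (x + \<xi> *\<^sub>R w + 0 *\<^sub>R v) w =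
      h * fd (\<lambda>y. fd f y w) (x + \<xi> *\<^sub>R w + \<eta> *\<^sub>R v) v" by auto
  with xi near that[of \<xi> \<eta>] show ?thesis by simp
qed

text \<open>Both mixed derivatives, at points near \<open>x\<close>, equal the same second
  difference divided by \<open>h * h\<close>; continuity carries the equality to
  \<open>x\<close>.\<close>

lemma symmetric_fd_real:
  fixes f :: "'a::real_normed_vector \<Rightarrow> real"
  assumes sm: "smooth_on S f" and S: "open S" "x \<in> S"
  shows "fd (\<lambda>y. fd f y w) x v = fd (\<lambda>y. fd f y v) x w"
proof -
  let ?A = "\<lambda>y. fd (\<lambda>y. fd f y w) y v" and ?B = "\<lambda>y. fd (\<lambda>y. fd f y v) y w"
  have cont: "isCont ?A x" "isCont ?B x"
    using smooth_on_continuous_on[OF smooth_on_fd[OF smooth_on_fd[OF sm]]] S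
    by (auto simp: continuous_on_eq_continuous_at)
  have "\<bar>?A x - ?B x\<bar> < 2 * e" if "e > 0" for e
  proof -
    obtain d1 where d1: "d1 > 0" "\<And>y. dist y x < d1 \<Longrightarrow> dist (?A y) (?A x) < e"
      using cont(1) \<open>e > 0\<close> unfolding continuous_at_eps_delta by metis
    obtain d2 where d2: "d2 > 0" "\<And>y. dist y x < d2 \<Longrightarrow> dist (?B y) (?B x) < e"
      using cont(2) \<open>e > 0\<close> unfolding continuous_at_eps_delta by metis
    obtain d3 where d3: "d3 > 0" "ball x d3 \<subseteq> S" using S openE by blast
    define d where "d = min d1 (min d2 d3)"
    have d: "d > 0" "d \<le> d1" "d \<le> d2" "ball x d \<subseteq> S"
      using d1(1) d2(1) d3 unfolding d_def by auto
    \<comment> \<open>Small enough to keep the whole parallelogram in the ball; the summand 1 covers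
      \<open>w = v = 0\<close>.\<close>
    define h where "h = d / (norm w + norm v + 1) / 2"
    have np: "norm w + norm v + 1 > 0" by (smt (verit) norm_ge_zero)
    have h: "h > 0" using d(1) np by (simp add: h_def)
    have hd: "h * (norm w + norm v) < d"
    proof -
      have "h * (norm w + norm v) \<le> h * (norm w + norm v + 1)" using h by simp
      also have "\<dots> = d / 2" using np unfolding h_def by (simp add: divide_simps)
      finally show ?thesis using d(1) by simp
    qed
    then have hd': "h * (norm v + norm w) < d" by (simp add: add.commute)
    obtain \<xi> \<eta> where 1: "dist (x + \<xi> *\<^sub>R w + \<eta> *\<^sub>R v) x < d"
      "f (x + h *\<^sub>R w + h *\<^sub>R v) - f (x + h *\<^sub>R w) - f (x + h *\<^sub>R v) + f x
         = h * h * ?A (x + \<xi> *\<^sub>R w + \<eta> *\<^sub>R v)"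
      using second_difference_mvt[OF sm S(1) d(4) h hd] by metis
    obtain \<xi>' \<eta>' where 2: "dist (x + \<xi>' *\<^sub>R v + \<eta>' *\<^sub>R w) x < d"
      "f (x + h *\<^sub>R v + h *\<^sub>R w) - f (x + h *\<^sub>R v) - f (x + h *\<^sub>R w) + f x
         = h * h * ?B (x + \<xi>' *\<^sub>R v + \<eta>' *\<^sub>R w)"
      using second_difference_mvt[OF sm S(1) d(4) h hd'] by metis
    have eq: "x + h *\<^sub>R v + h *\<^sub>R w = x + h *\<^sub>R w + h *\<^sub>R v" by simp
    have "h * h * ?A (x + \<xi> *\<^sub>R w + \<eta> *\<^sub>R v) = h * h * ?B (x + \<xi>' *\<^sub>R v + \<eta>' *\<^sub>R w)"
      using 1(2) 2(2)[unfolded eq] by linarith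
    then have "?A (x + \<xi> *\<^sub>R w + \<eta> *\<^sub>R v) = ?B (x + \<xi>' *\<^sub>R v + \<eta>' *\<^sub>R w)" using h by simp
    moreover have "dist (?A (x + \<xi> *\<^sub>R w + \<eta> *\<^sub>R v)) (?A x) < e"
      using d1(2) 1(1) d(2) by force
    moreover have "dist (?B (x + \<xi>' *\<^sub>R v + \<eta>' *\<^sub>R w)) (?B x) < e"
      using d2(2) 2(1) d(3) by force
    ultimately show ?thesis by (simp add: dist_real_def)
  qed
  \<comment> \<open>For this \<open>e\<close> the bound would be a number strictly below
    itself.\<close>
  from this[of "\<bar>?A x - ?B x\<bar> / 2"] show ?thesis by (cases "?A x = ?B x") auto
qed

lemma fd_linear_post:
  assumes "smooth_on S f" "open S" "x \<in> S" "bounded_linear L"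
  shows "fd (\<lambda>y. L (f y)) x v = L (fd f x v)"
  using has_derivative_compose[OF smooth_on_has_derivative[OF assms(1-3)]
      bounded_linear_imp_has_derivative[OF assms(4)]] frechet_derivative_at by metis

text \<open>Pairing with every vector \<open>z\<close> reduces the claim to real-valued
  functions.\<close>

lemma symmetric_fd:
  fixes f :: "'a::real_normed_vector \<Rightarrow> 'b::real_inner"
  assumes sm: "smooth_on S f" and S: "open S" "x \<in> S"
  shows "fd (\<lambda>y. fd f y w) x v = fd (\<lambda>y. fd f y v) x w"
proof -
  have 1: "fd (\<lambda>y. fd (\<lambda>y. f y \<bullet> z) y w) x v = fd (\<lambda>y. fd f y w) x v \<bullet> z" for z w v
  proof -
    have "fd (\<lambda>y. fd (\<lambda>y. f y \<bullet> z) y w) x v = fd (\<lambda>y. fd f y w \<bullet> z) x v"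
      by (rule arg_cong[where f = "\<lambda>F. F v"], rule frechet_derivative_cong_open[OF S])
        (rule fd_linear_post[OF sm S(1) _ bounded_linear_inner_left])
    also have "\<dots> = fd (\<lambda>y. fd f y w) x v \<bullet> z"
      by (rule fd_linear_post[OF smooth_on_fd[OF sm] S bounded_linear_inner_left])
    finally show ?thesis .
  qed
  have "smooth_on S (\<lambda>y. f y \<bullet> z)" for z
    by (rule smooth_on_post[OF S(1) bounded_linear_inner_left sm])
  from symmetric_fd_real[OF this S, of _ w v]
  have "fd (\<lambda>y. fd f y w) x v \<bullet> z = fd (\<lambda>y. fd f y v) x w \<bullet> z" for z
    by (simp add: 1)
  then show ?thesis using vector_eq_rdot by blast
qed

section \<open>Differential calculus on the sphere\<close>

text \<open>The direction is any ambient vector. Since the extension is constant along rays, only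
  the tangential projection of \<open>v\<close> counts.\<close>

definition sderiv :: "real ^ 'm \<Rightarrow> ('m::finite usphere \<Rightarrow> 'b::real_normed_vector) \<Rightarrow> 'm usphere \<Rightarrow> 'b" where
  "sderiv v f x = fd (sphere_ext f) (Rep_usphere x) v"

text \<open>The sum of squares of the projected coordinate derivatives is div grad, with the
  nonpositive sign: the negative of \<open>sphere_laplacian\<close>.\<close>

definition slap :: "('m::finite usphere \<Rightarrow> 'b::real_normed_vector) \<Rightarrow> 'm usphere \<Rightarrow> 'b" where
  "slap f x = (\<Sum>b\<in>Basis. sderiv b (sderiv b f) x)"

definition sc :: "real ^ 'm \<Rightarrow> 'm::finite usphere \<Rightarrow> real" where
  "sc v x = Rep_usphere x \<bullet> v"

lemma norm_Rep_usphere [simp]: "norm (Rep_usphere x) = 1"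
  using Rep_usphere[of x] by simp

lemma Rep_usphere_nz [simp]: "Rep_usphere x \<noteq> 0"
  by (metis norm_Rep_usphere norm_zero zero_neq_one)

lemma Rep_inner_self [simp]: "Rep_usphere x \<bullet> Rep_usphere x = 1"
  by (simp flip: power2_norm_eq_inner)

lemma sgn_Rep_usphere [simp]: "sgn (Rep_usphere x) = Rep_usphere x"
  by (simp add: sgn_div_norm)

lemma Rep_Abs_sgn [simp]: "v \<noteq> 0 \<Longrightarrow> Rep_usphere (Abs_usphere (sgn v)) = sgn v"
  by (simp add: Abs_usphere_inverse norm_sgn)

lemma sphere_ext_Rep [simp]: "sphere_ext f (Rep_usphere x) = f x"
  by (simp add: sphere_ext_def Rep_usphere_inverse)

lemma smooth_sphere_iff: "smooth_sphere f \<longleftrightarrow> smooth_on {v. v \<noteq> 0} (sphere_ext f)"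
  by (simp add: smooth_sphere_def smooth_on_def)

lemma sphere_ext_scale: "c > 0 \<Longrightarrow> sphere_ext f (c *\<^sub>R v) = sphere_ext f v"
  by (simp add: sphere_ext_def sgn_scaleR)

lemma has_derivative_sphere_ext:
  "smooth_sphere f \<Longrightarrow> v \<noteq> 0 \<Longrightarrow> (sphere_ext f has_derivative fd (sphere_ext f) v) (at v)"
  using smooth_on_has_derivative[OF _ open_nonzero] by (simp add: smooth_sphere_iff)

lemma sderiv_works:
  "smooth_sphere f \<Longrightarrow>
    (sphere_ext f has_derivative (\<lambda>v. sderiv v f x)) (at (Rep_usphere x))"
  using has_derivative_sphere_ext[of f "Rep_usphere x"] by (simp add: sderiv_def [abs_def])

lemma sderivI:
  "(sphere_ext f has_derivative f') (at (Rep_usphere x)) \<Longrightarrow> sderiv v f x = f' v"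
  unfolding sderiv_def by (metis frechet_derivative_at)

text \<open>The derivative of a function of degree 0 is homogeneous of degree -1, and the factor
  \<open>norm v\<close> restores degree 0. This is what allows \<open>sderiv\<close> to be
  iterated.\<close>

lemma sphere_ext_sderiv:
  assumes f: "smooth_sphere f" and v: "v \<noteq> 0"
  shows "sphere_ext (sderiv w f) v = norm v *\<^sub>R fd (sphere_ext f) v w"
proof -
  let ?F = "sphere_ext f" and ?c = "inverse (norm v)"
  have c: "?c > 0" using v by simp
  have sv: "sgn v = ?c *\<^sub>R v" by (simp add: sgn_div_norm)
  have "(?F has_derivative fd ?F (sgn v)) (at (?c *\<^sub>R v))"
    using has_derivative_sphere_ext[OF f, of "sgn v"] v by (simp add: sv sgn_zero_iff)
  moreover have "((\<lambda>u. ?c *\<^sub>R u) has_derivative (\<lambda>u. ?c *\<^sub>R u)) (at v)"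
    by (auto intro!: derivative_eq_intros)
  ultimately have "((\<lambda>u. ?F (?c *\<^sub>R u)) has_derivative (\<lambda>u. fd ?F (sgn v) (?c *\<^sub>R u))) (at v)"
    by (rule has_derivative_compose[rotated])
  then have "(?F has_derivative (\<lambda>u. fd ?F (sgn v) (?c *\<^sub>R u))) (at v)"
    by (simp only: sphere_ext_scale[OF c])
  then have "fd ?F v w = fd ?F (sgn v) (?c *\<^sub>R w)"
    by (metis frechet_derivative_at)
  also have "\<dots> = ?c *\<^sub>R fd ?F (sgn v) w"
    using has_derivative_linear[OF has_derivative_sphere_ext[OF f, of "sgn v"]] v
    by (simp add: linear_cmul sgn_zero_iff)
  finally show ?thesis using v by (simp add: sphere_ext_def[of "sderiv w f"] sderiv_def)
qed

lemma smooth_sphere_sderiv [simp, intro]: "smooth_sphere f \<Longrightarrow> smooth_sphere (sderiv w f)"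
proof -
  assume f: "smooth_sphere f"
  have "smooth_on {v. v \<noteq> 0} (\<lambda>v. norm v *\<^sub>R fd (sphere_ext f) v w)"
    using f unfolding smooth_sphere_iff
    by (intro smooth_on_scaleR open_nonzero smooth_on_norm smooth_on_fd)
  then show "smooth_sphere (sderiv w f)"
    unfolding smooth_sphere_iff
    by (subst smooth_on_cong[OF open_nonzero]) (auto simp: sphere_ext_sderiv[OF f])
qed

lemma smooth_sphere_const [simp, intro]: "smooth_sphere (\<lambda>x. c)"
  unfolding smooth_sphere_iff sphere_ext_def by (rule smooth_on_const[OF open_nonzero])

lemma smooth_sphere_linear [intro]:
  "bounded_linear L \<Longrightarrow> smooth_sphere f \<Longrightarrow> smooth_sphere (\<lambda>x. L (f x))"
  unfolding smooth_sphere_iff sphere_ext_def by (rule smooth_on_post[OF open_nonzero])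

lemma smooth_sphere_add_diff [simp, intro]:
  assumes "smooth_sphere f" "smooth_sphere g"
  shows "smooth_sphere (\<lambda>x. f x + g x)" "smooth_sphere (\<lambda>x. f x - g x)"
  using assms smooth_on_add[OF open_nonzero] smooth_on_diff[OF open_nonzero]
  unfolding smooth_sphere_iff sphere_ext_def by blast+

lemma smooth_sphere_bilinear:
  "bounded_bilinear h \<Longrightarrow> smooth_sphere f \<Longrightarrow> smooth_sphere g \<Longrightarrow> smooth_sphere (\<lambda>x. h (f x) (g x))"
  unfolding smooth_sphere_iff sphere_ext_def by (rule bounded_bilinear.smooth_on_prod[OF _ open_nonzero])

lemmas smooth_sphere_prods [simp, intro] =
  smooth_sphere_bilinear[OF bounded_bilinear_scaleR] smooth_sphere_bilinear[OF bounded_bilinear_mult]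
  smooth_sphere_bilinear[OF bounded_bilinear_inner]

lemma smooth_sphere_sum [simp, intro]:
  "(\<And>i. i \<in> I \<Longrightarrow> smooth_sphere (f i)) \<Longrightarrow> smooth_sphere (\<lambda>x. \<Sum>i\<in>I. f i x)"
  unfolding smooth_sphere_iff sphere_ext_def by (rule smooth_on_sum[OF open_nonzero])

lemma sphere_ext_sc: "v \<noteq> 0 \<Longrightarrow> sphere_ext (sc a) v = sgn v \<bullet> a"
  by (simp add: sphere_ext_def sc_def)

lemma smooth_sphere_sc [simp, intro]: "smooth_sphere (sc a)"
proof -
  have "smooth_on {v. v \<noteq> 0} (\<lambda>v. sgn v \<bullet> a)"
    by (intro smooth_on_inner open_nonzero smooth_on_sgn smooth_on_const)
  then show ?thesis
    unfolding smooth_sphere_iff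
    by (subst smooth_on_cong[OF open_nonzero]) (auto simp: sphere_ext_sc)
qed

lemma smooth_sphere_slap [simp, intro]: "smooth_sphere f \<Longrightarrow> smooth_sphere (slap f)"
  unfolding slap_def [abs_def] by auto

lemma sderiv_const [simp]: "sderiv v (\<lambda>x. c) x = 0"
  by (rule sderivI) (simp add: sphere_ext_def)

lemma sderiv_add_diff [simp]:
  assumes "smooth_sphere f" "smooth_sphere g"
  shows "sderiv v (\<lambda>x. f x + g x) x = sderiv v f x + sderiv v g x"
    "sderiv v (\<lambda>x. f x - g x) x = sderiv v f x - sderiv v g x"
  using sderivI[of "\<lambda>x. f x + g x"] has_derivative_add[OF assms[THEN sderiv_works, of x]]
    sderivI[of "\<lambda>x. f x - g x"] has_derivative_diff[OF assms[THEN sderiv_works, of x]]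
  by (simp_all add: sphere_ext_def [abs_def])

lemma sderiv_bilinear:
  assumes "bounded_bilinear h" "smooth_sphere f" "smooth_sphere g"
  shows "sderiv v (\<lambda>x. h (f x) (g x)) x = h (f x) (sderiv v g x) + h (sderiv v f x) (g x)"
  using sderivI[of "\<lambda>x. h (f x) (g x)"]
    bounded_bilinear.FDERIV[OF assms(1) assms(2,3)[THEN sderiv_works, of x]]
  by (simp add: sphere_ext_def [abs_def] Rep_usphere_inverse)

lemmas sderiv_scaleR [simp] = sderiv_bilinear[OF bounded_bilinear_scaleR]
lemmas sderiv_mult [simp] = sderiv_bilinear[OF bounded_bilinear_mult]
lemmas sderiv_inner [simp] = sderiv_bilinear[OF bounded_bilinear_inner]

lemma sderiv_linear_post:
  assumes "bounded_linear L" "smooth_sphere f"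
  shows "sderiv v (\<lambda>x. L (f x)) x = L (sderiv v f x)"
  using sderivI[of "\<lambda>x. L (f x)"]
    bounded_linear.has_derivative[OF assms(1) sderiv_works[OF assms(2), of x]]
  by (simp add: sphere_ext_def [abs_def])

lemma sderiv_sum [simp]:
  "(\<And>i. i \<in> I \<Longrightarrow> smooth_sphere (f i)) \<Longrightarrow>
    sderiv v (\<lambda>x. \<Sum>i\<in>I. f i x) x = (\<Sum>i\<in>I. sderiv v (f i) x)"
  by (induction I rule: infinite_finite_induct) auto

lemma sderiv_sc [simp]: "sderiv v (sc a) x = v \<bullet> a - sc v x * sc a x"
proof -
  have "((\<lambda>v. sgn v \<bullet> a) has_derivative (\<lambda>v. (v - (Rep_usphere x \<bullet> v) *\<^sub>R Rep_usphere x) \<bullet> a)) (at (Rep_usphere x))"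
    by (intro has_derivative_inner_left has_derivative_sgn) simp
  then have "(sphere_ext (sc a) has_derivative (\<lambda>v. (v - (Rep_usphere x \<bullet> v) *\<^sub>R Rep_usphere x) \<bullet> a)) (at (Rep_usphere x))"
    by (rule has_derivative_transform_within_open[OF _ open_nonzero]) (auto simp: sphere_ext_sc)
  then show ?thesis
    by (subst sderivI) (auto simp: sc_def algebra_simps)
qed

lemma linear_sderiv: "smooth_sphere f \<Longrightarrow> linear (\<lambda>v. sderiv v f x)"
  using has_derivative_linear[OF sderiv_works] .

lemma sderiv_euclidean:
  assumes "smooth_sphere f"
  shows "sderiv v f x = (\<Sum>b\<in>Basis. (v \<bullet> b) *\<^sub>R sderiv b f x)"
proof -
  interpret linear "\<lambda>v. sderiv v f x" using linear_sderiv[OF assms] .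
  have "sderiv (\<Sum>b\<in>Basis. (v \<bullet> b) *\<^sub>R b) f x = (\<Sum>b\<in>Basis. (v \<bullet> b) *\<^sub>R sderiv b f x)"
    by (simp add: sum scale)
  then show ?thesis by (simp add: euclidean_representation)
qed

lemma sderiv_radial: 
  assumes f: "smooth_sphere f"
  shows "sderiv (Rep_usphere x) f x = 0"
proof -
  let ?x = "Rep_usphere x"
  have "((\<lambda>s. sphere_ext f (0 + s *\<^sub>R ?x)) has_vector_derivative sderiv ?x f x) (at 1)"
    using sderiv_works[OF f, of x] by (intro has_derivative_along) simp
  moreover have "((\<lambda>s. sphere_ext f (0 + s *\<^sub>R ?x)) has_vector_derivative 0) (at 1)"
    by (rule has_vector_derivative_transform_within_open[OF has_vector_derivative_const open_greaterThan[of 0]])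
      (auto simp: sphere_ext_scale)
  ultimately show ?thesis by (rule vector_derivative_unique_at)
qed

lemma sum_sc_sderiv: "smooth_sphere f \<Longrightarrow> (\<Sum>b\<in>Basis. sc b x *\<^sub>R sderiv b f x) = 0"
  using sderiv_euclidean[of f "Rep_usphere x" x] sderiv_radial[of f x] by (simp add: sc_def)

lemma sum_sc_sc: "(\<Sum>b\<in>Basis. sc b x * sc b x) = 1"
  using euclidean_inner[of "Rep_usphere x" "Rep_usphere x"] by (simp add: sc_def)

text \<open>The extension of \<open>sderiv v f\<close> is \<open>norm\<close> times the derivative of the extension of \<open>f\<close>,
  so second derivatives on the sphere commute up to the contribution of \<open>norm\<close>.\<close>

lemma sderiv_sderiv:
  assumes f: "smooth_sphere f"
  shows "sderiv w (sderiv v f) x =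
    sc w x *\<^sub>R sderiv v f x + fd (\<lambda>y. fd (sphere_ext f) y v) (Rep_usphere x) w"
proof -
  let ?F = "sphere_ext f" and ?x = "Rep_usphere x"
  have "smooth_on {v. v \<noteq> 0} (\<lambda>y. fd ?F y v)" using f smooth_on_fd by (auto simp: smooth_sphere_iff)
  from smooth_on_has_derivative[OF this open_nonzero, of ?x]
  have 1: "((\<lambda>y. fd ?F y v) has_derivative fd (\<lambda>y. fd ?F y v) ?x) (at ?x)" by simp
  have "((\<lambda>y. norm y *\<^sub>R fd ?F y v) has_derivative
      (\<lambda>w. norm ?x *\<^sub>R fd (\<lambda>y. fd ?F y v) ?x w + (w \<bullet> sgn ?x) *\<^sub>R fd ?F ?x v)) (at ?x)"
    by (rule has_derivative_scaleR[OF has_derivative_norm 1]) simp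
  then have "(sphere_ext (sderiv v f) has_derivative
      (\<lambda>w. norm ?x *\<^sub>R fd (\<lambda>y. fd ?F y v) ?x w + (w \<bullet> sgn ?x) *\<^sub>R fd ?F ?x v)) (at ?x)"
    by (rule has_derivative_transform_within_open[OF _ open_nonzero])
      (auto simp: sphere_ext_sderiv[OF f])
  from sderivI[OF this] show ?thesis
    by (simp add: sc_def sderiv_def inner_commute)
qed

lemma sderiv_commute:
  fixes f :: "'m::finite usphere \<Rightarrow> 'b::real_inner"
  assumes f: "smooth_sphere f"
  shows "sderiv w (sderiv v f) x =
    sderiv v (sderiv w f) x + sc w x *\<^sub>R sderiv v f x - sc v x *\<^sub>R sderiv w f x"
proof -
  have "fd (\<lambda>y. fd (sphere_ext f) y v) (Rep_usphere x) w = fd (\<lambda>y. fd (sphere_ext f) y w) (Rep_usphere x) v"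
    using f unfolding smooth_sphere_iff by (rule symmetric_fd[OF _ open_nonzero]) simp
  then show ?thesis
    unfolding sderiv_sderiv[OF f, of w v] sderiv_sderiv[OF f, of v w] by simp
qed

lemma sum_inner_sderiv:
  "(\<Sum>b\<in>Basis. (b \<bullet> c) *\<^sub>R sderiv b f x) = sderiv c f x" if "smooth_sphere f"
  using sderiv_euclidean[OF that, of c x] by (simp add: inner_commute)

lemma slap_sc: "slap (sc a :: 'm::finite usphere \<Rightarrow> real) x = - (real CARD('m) - 1) * sc a x"
proof -
  have eq: "sderiv b (sc a) = (\<lambda>x. b \<bullet> a - sc b x * sc a x)" for b :: "real ^ 'm" by auto
  have "slap (sc a) x = (\<Sum>b\<in>Basis. - (sc b x * (b \<bullet> a - sc b x * sc a x) + (b \<bullet> b - sc b x * sc b x) * sc a x))"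
    unfolding slap_def eq by (intro sum.cong) (auto simp: algebra_simps)
  also have "\<dots> = (\<Sum>b\<in>Basis. - (sc b x * (b \<bullet> a)) + 2 * sc a x * (sc b x * sc b x) - sc a x)"
    by (intro sum.cong) (auto simp: inner_Basis algebra_simps)
  also have "\<dots> = - (\<Sum>b\<in>Basis. sc b x * (b \<bullet> a)) + 2 * sc a x - real CARD('m) * sc a x"
    by (simp add: sum.distrib sum_subtractf sum_negf sum_sc_sc flip: sum_distrib_left)
  also have "(\<Sum>b\<in>Basis. sc b x * (b \<bullet> a)) = sc a x"
    using euclidean_inner[of "Rep_usphere x" a] by (simp add: sc_def inner_commute)
  finally show ?thesis by (simp add: algebra_simps)
qed

text \<open>In the product rule for the Laplacian the cross term is a derivative along the gradient
  of \<open>sc a\<close>, which is the tangential part of \<open>a\<close>; this yields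
  \<open>2 *\<^sub>R sderiv a f\<close>.\<close>

lemma slap_sc_scaleR:
  fixes f :: "'m::finite usphere \<Rightarrow> 'b::real_inner"
  assumes f: "smooth_sphere f"
  shows "slap (\<lambda>x. sc a x *\<^sub>R f x) x =
    sc a x *\<^sub>R slap f x - (real CARD('m) - 1) *\<^sub>R sc a x *\<^sub>R f x + 2 *\<^sub>R sderiv a f x"
proof -
  have eq: "sderiv b (\<lambda>x. sc a x *\<^sub>R f x) = (\<lambda>x. sc a x *\<^sub>R sderiv b f x + sderiv b (sc a) x *\<^sub>R f x)" for b
    using f by (intro ext sderiv_scaleR) auto
  have "slap (\<lambda>x. sc a x *\<^sub>R f x) x = (\<Sum>b\<in>Basis. sc a x *\<^sub>R sderiv b (sderiv b f) x
      + 2 *\<^sub>R (sderiv b (sc a) x *\<^sub>R sderiv b f x) + sderiv b (sderiv b (sc a)) x *\<^sub>R f x)"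
    unfolding slap_def eq using f
    by (intro sum.cong refl) (simp del: sderiv_sc scaleR_scaleR add: scaleR_2)
  also have "\<dots> = sc a x *\<^sub>R slap f x + 2 *\<^sub>R (\<Sum>b\<in>Basis. sderiv b (sc a) x *\<^sub>R sderiv b f x) + slap (sc a) x *\<^sub>R f x"
    by (simp add: slap_def sum.distrib scaleR_sum_right scaleR_sum_left del: sderiv_sc)
  also have "(\<Sum>b\<in>Basis. sderiv b (sc a) x *\<^sub>R sderiv b f x) =
      (\<Sum>b\<in>Basis. (b \<bullet> a) *\<^sub>R sderiv b f x) - sc a x *\<^sub>R (\<Sum>b\<in>Basis. sc b x *\<^sub>R sderiv b f x)"
    by (simp add: scaleR_left_diff_distrib sum_subtractf scaleR_sum_right mult.commute)
  also have "\<dots> = sderiv a f x"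
    using f by (simp add: sum_inner_sderiv sum_sc_sderiv)
  finally show ?thesis by (simp add: slap_sc algebra_simps)
qed

text \<open>Moving \<open>sderiv c\<close> through two derivatives costs the commutator of
  \<open>sderiv_commute\<close> twice. With \<open>slap_sc_scaleR\<close> this closes the Laplacian
  on the span of \<open>sc a x *\<^sub>R e x\<close> and \<open>sderiv a e x\<close> for an
  eigenfunction \<open>e\<close>, and it gives the curvature term of the Bochner formula.\<close>

lemma slap_sderiv:
  fixes f :: "'m::finite usphere \<Rightarrow> 'b::real_inner"
  assumes f: "smooth_sphere f"
  shows "slap (sderiv c f) x =
    sderiv c (slap f) x - 2 *\<^sub>R sc c x *\<^sub>R slap f x + (real CARD('m) - 3) *\<^sub>R sderiv c f x"
proof -
  have eq: "sderiv a (sderiv c f) =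
      (\<lambda>x. sderiv c (sderiv a f) x + sc a x *\<^sub>R sderiv c f x - sc c x *\<^sub>R sderiv a f x)" for a
    by (rule ext) (rule sderiv_commute[OF f])
  have step: "sderiv a (sderiv a (sderiv c f)) x = sderiv c (sderiv a (sderiv a f)) x
      + (sc a x *\<^sub>R sderiv c (sderiv a f) x + sc a x *\<^sub>R sderiv c (sderiv a f) x)
      - (sc c x *\<^sub>R sderiv a (sderiv a f) x + sc c x *\<^sub>R sderiv a (sderiv a f) x)
      + sderiv c f x - (a \<bullet> c) *\<^sub>R sderiv a f x"
    if "a \<in> Basis" for a
  proof -
    have "sderiv a (sderiv a (sderiv c f)) x = sderiv a (sderiv c (sderiv a f)) x
        + (sc a x *\<^sub>R sderiv a (sderiv c f) x + (a \<bullet> a - sc a x * sc a x) *\<^sub>R sderiv c f x)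
        - (sc c x *\<^sub>R sderiv a (sderiv a f) x + (a \<bullet> c - sc a x * sc c x) *\<^sub>R sderiv a f x)"
      using arg_cong[OF eq[of a], of "\<lambda>h. sderiv a h x"] f by simp
    also have "sderiv a (sderiv c (sderiv a f)) x = sderiv c (sderiv a (sderiv a f)) x
        + sc a x *\<^sub>R sderiv c (sderiv a f) x - sc c x *\<^sub>R sderiv a (sderiv a f) x"
      using f by (intro sderiv_commute) auto
    also have "sderiv a (sderiv c f) x = sderiv c (sderiv a f) x + sc a x *\<^sub>R sderiv c f x - sc c x *\<^sub>R sderiv a f x"
      by (rule sderiv_commute[OF f])
    finally show ?thesis
      using that by (simp add: algebra_simps)
  qed
  \<comment> \<open>Obtained by differentiating along \<open>c\<close> the identity that the radial
    derivative of \<open>f\<close> is zero.\<close>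
  have A: "(\<Sum>a\<in>Basis. sc a x *\<^sub>R sderiv c (sderiv a f) x) = - sderiv c f x"
  proof -
    have "0 = sderiv c (\<lambda>x. \<Sum>a\<in>Basis. sc a x *\<^sub>R sderiv a f x) x"
      using f by (simp add: sum_sc_sderiv)
    also have "\<dots> = (\<Sum>a\<in>Basis. sc a x *\<^sub>R sderiv c (sderiv a f) x + (c \<bullet> a - sc c x * sc a x) *\<^sub>R sderiv a f x)"
      using f by (subst sderiv_sum) auto
    also have "\<dots> = (\<Sum>a\<in>Basis. sc a x *\<^sub>R sderiv c (sderiv a f) x)
        + (\<Sum>a\<in>Basis. (c \<bullet> a) *\<^sub>R sderiv a f x) - sc c x *\<^sub>R (\<Sum>a\<in>Basis. sc a x *\<^sub>R sderiv a f x)"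
      by (simp add: algebra_simps sum.distrib sum_subtractf scaleR_sum_right)
    finally show ?thesis
      using f by (simp add: sum_sc_sderiv add_eq_0_iff flip: sderiv_euclidean)
  qed
  have B: "sderiv c (slap f) x = (\<Sum>a\<in>Basis. sderiv c (sderiv a (sderiv a f)) x)"
    unfolding slap_def [abs_def] using f by (intro sderiv_sum) auto
  have "slap (sderiv c f) x = (\<Sum>a\<in>Basis. sderiv c (sderiv a (sderiv a f)) x
      + (sc a x *\<^sub>R sderiv c (sderiv a f) x + sc a x *\<^sub>R sderiv c (sderiv a f) x)
      - (sc c x *\<^sub>R sderiv a (sderiv a f) x + sc c x *\<^sub>R sderiv a (sderiv a f) x)
      + sderiv c f x - (a \<bullet> c) *\<^sub>R sderiv a f x)"
    unfolding slap_def by (rule sum.cong[OF refl step])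
  also have "\<dots> = sderiv c (slap f) x + 2 *\<^sub>R (\<Sum>a\<in>Basis. sc a x *\<^sub>R sderiv c (sderiv a f) x)
      - 2 *\<^sub>R sc c x *\<^sub>R slap f x + real CARD('m) *\<^sub>R sderiv c f x - (\<Sum>a\<in>Basis. (a \<bullet> c) *\<^sub>R sderiv a f x)"
    unfolding B slap_def sum.distrib sum_subtractf scaleR_sum_right
    by (simp add: sum_constant_scaleR scaleR_2 scaleR_sum_right sum.distrib flip: scaleR_scaleR)
  also have "(\<Sum>a\<in>Basis. (a \<bullet> c) *\<^sub>R sderiv a f x) = sderiv c f x"
    by (rule sum_inner_sderiv[OF f])
  finally show ?thesis
    unfolding A using scaleR_left_distrib[of 1 2 "sderiv c f x"] by (simp add: algebra_simps)
qed

section \<open>Eigenspaces of the spherical Laplacian\<close>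

definition lam :: "nat \<Rightarrow> nat \<Rightarrow> real" where
  "lam p j = real j * (real j + real p - 1)"

lemma slap_linear_post:
  assumes "bounded_linear L" "smooth_sphere f"
  shows "slap (\<lambda>x. L (f x)) x = L (slap f x)"
proof -
  interpret bounded_linear L by fact
  have eq: "sderiv b (\<lambda>x. L (f x)) = (\<lambda>x. L (sderiv b f x))" for b
    using sderiv_linear_post[OF assms] by auto
  have "sderiv b (sderiv b (\<lambda>x. L (f x))) x = L (sderiv b (sderiv b f) x)" for b
    unfolding eq using assms by (intro sderiv_linear_post) auto
  then show ?thesis by (simp add: slap_def sum)
qed

lemma slap_add_diff:
  assumes "smooth_sphere f" "smooth_sphere g"
  shows "slap (\<lambda>x. f x + g x) x = slap f x + slap g x" "slap (\<lambda>x. f x - g x) x = slap f x - slap g x"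
proof -
  have eq: "sderiv b (\<lambda>x. f x + g x) = (\<lambda>x. sderiv b f x + sderiv b g x)"
    "sderiv b (\<lambda>x. f x - g x) = (\<lambda>x. sderiv b f x - sderiv b g x)" for b
    using assms by auto
  show "slap (\<lambda>x. f x + g x) x = slap f x + slap g x" "slap (\<lambda>x. f x - g x) x = slap f x - slap g x"
    unfolding slap_def eq using assms by (simp_all add: sum.distrib sum_subtractf)
qed

lemma slap_const [simp]: "slap (\<lambda>x. c) x = 0"
proof -
  have eq: "sderiv b (\<lambda>x. c) = (\<lambda>x. 0)" for b by auto
  show ?thesis unfolding slap_def eq by simp
qed

lemma slap_sum:
  "(\<And>i. i \<in> I \<Longrightarrow> smooth_sphere (f i)) \<Longrightarrow> slap (\<lambda>x. \<Sum>i\<in>I. f i x) x = (\<Sum>i\<in>I. slap (f i) x)"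
  by (induction I rule: infinite_finite_induct) (auto simp: slap_add_diff)

lemma slap_scaleR_const: "smooth_sphere f \<Longrightarrow> slap (\<lambda>x. c *\<^sub>R f x) x = c *\<^sub>R slap f x"
  by (rule slap_linear_post[OF bounded_linear_scaleR_right])

lemma slap_inner_self:
  assumes g: "smooth_sphere g"
  shows "slap (\<lambda>x. g x \<bullet> g x) x =
    2 * (g x \<bullet> slap g x) + 2 * (\<Sum>b\<in>Basis. sderiv b g x \<bullet> sderiv b g x)"
proof -
  have eq: "sderiv b (\<lambda>x. g x \<bullet> g x) = (\<lambda>x. 2 *\<^sub>R (g x \<bullet> sderiv b g x))" for b
    using g by (auto simp: inner_commute)
  have "sderiv b (sderiv b (\<lambda>x. g x \<bullet> g x)) x =
      2 * (g x \<bullet> sderiv b (sderiv b g) x) + 2 * (sderiv b g x \<bullet> sderiv b g x)" for b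
    unfolding eq using g by simp
  then show ?thesis
    by (simp add: slap_def sum.distrib inner_sum_right sum_distrib_left)
qed

lemma sphere_div_grad:
  fixes u :: "'m::finite usphere \<Rightarrow> real"
  assumes u: "smooth_sphere u"
  shows "sphere_div (sphere_grad u) x = slap u x"
proof -
  have eq: "sphere_grad u = (\<lambda>x. \<Sum>b\<in>Basis. sderiv b u x *\<^sub>R b)"
    by (simp add: sphere_grad_def [abs_def] sderiv_def)
  have "sderiv c (sphere_grad u) x \<bullet> c = sderiv c (sderiv c u) x" if "c \<in> Basis" for c
    unfolding eq using u that by (simp add: inner_sum_left inner_Basis if_distrib sum.delta cong: if_cong)
  then show ?thesis
    by (simp add: sphere_div_def slap_def flip: sderiv_def)
qed

lemma sphere_laplacian_eq:
  assumes f: "smooth_sphere f"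
  shows "sphere_laplacian f x = - slap f x"
proof -
  have "slap (\<lambda>x. Re (f x)) x = Re (slap f x)" "slap (\<lambda>x. Im (f x)) x = Im (slap f x)"
    using f by (auto intro: slap_linear_post bounded_linear_Re bounded_linear_Im)
  then show ?thesis
    unfolding sphere_laplacian_def using f
    by (simp add: sphere_div_grad smooth_sphere_linear bounded_linear_Re bounded_linear_Im complex_eq_iff)
qed

lemma eigenspace_iff:
  "f \<in> eigenspace p j \<longleftrightarrow> smooth_sphere f \<and> (\<forall>x. slap f x = - lam p j *\<^sub>R f x)"
proof -
  have "of_nat j * (of_nat j + of_nat p - 1) * z = lam p j *\<^sub>R (z :: complex)" for z
    by (simp add: lam_def scaleR_conv_of_real)
  then show ?thesis
    by (auto simp: eigenspace_def sphere_laplacian_eq neg_eq_iff_add_eq_0 eq_neg_iff_add_eq_0)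
qed

lemma eigenspace_smooth [simp, dest]: "f \<in> eigenspace p j \<Longrightarrow> smooth_sphere f"
  by (simp add: eigenspace_iff)

lemma eigenspace_slap: "f \<in> eigenspace p j \<Longrightarrow> slap f x = - lam p j *\<^sub>R f x"
  by (simp add: eigenspace_iff)

lemma eigenspace_zero [simp, intro]: "(\<lambda>x. 0) \<in> eigenspace p j"
  by (simp add: eigenspace_iff)

lemma eigenspace_add [intro]:
  "f \<in> eigenspace p j \<Longrightarrow> g \<in> eigenspace p j \<Longrightarrow> (\<lambda>x. f x + g x) \<in> eigenspace p j"
  by (auto simp: eigenspace_iff slap_add_diff algebra_simps)

lemma eigenspace_cmult [intro]: "f \<in> eigenspace p j \<Longrightarrow> (\<lambda>x. c * f x) \<in> eigenspace p j"
  using slap_linear_post[OF bounded_linear_mult_right[of c], of f]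
    smooth_sphere_linear[OF bounded_linear_mult_right[of c], of f]
  by (simp add: eigenspace_iff scaleR_conv_of_real mult.left_commute)

lemma eigenspace_scaleR [intro]: "f \<in> eigenspace p j \<Longrightarrow> (\<lambda>x. c *\<^sub>R f x) \<in> eigenspace p j"
  by (auto simp: scaleR_conv_of_real)

lemma eigenspace_sum [intro]:
  "(\<And>i. i \<in> I \<Longrightarrow> f i \<in> eigenspace p j) \<Longrightarrow> (\<lambda>x. \<Sum>i\<in>I. f i x) \<in> eigenspace p j"
  by (induction I rule: infinite_finite_induct) auto

lemma lam_inj:
  assumes "p \<ge> 1" "lam p i = lam p j"
  shows "i = j"
proof (rule ccontr)
  assume "i \<noteq> j"
  have "(real i - real j) * (real i + real j + real p - 1) = 0"
    using assms(2) by (simp add: lam_def algebra_simps)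
  then have "real i + real j + real p - 1 = 0" using \<open>i \<noteq> j\<close> by simp
  then have "real i + real j \<le> 0" using assms(1) by linarith
  then have "i = 0 \<and> j = 0" by linarith
  with \<open>i \<noteq> j\<close> show False by simp
qed

text \<open>Elimination: the Laplacian plus \<open>lam p k\<close> kills the term of degree
  \<open>k\<close> and multiplies the others by factors that are nonzero by
  \<open>lam_inj\<close>.\<close>

lemma eigenspace_independent:
  assumes "p \<ge> 1" "finite S" "\<And>i. i \<in> S \<Longrightarrow> e i \<in> eigenspace p i" "\<And>x. (\<Sum>i\<in>S. e i x) = 0" "i \<in> S"
  shows "e i x = 0"
  using assms(2-)
proof (induction S arbitrary: e i x rule: finite_induct)
  case empty
  then show ?case by simp
next
  case (insert k S)
  have sm: "smooth_sphere (e i)" if "i \<in> insert k S" for i using insert.prems(1) that by auto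
  have 1: "(lam p k - lam p i) *\<^sub>R e i x = 0" if "i \<in> S" for i x
  proof (rule insert.IH[of "\<lambda>i x. (lam p k - lam p i) *\<^sub>R e i x"])
    fix x
    have "0 = slap (\<lambda>x. \<Sum>i\<in>insert k S. e i x) x + lam p k *\<^sub>R (\<Sum>i\<in>insert k S. e i x)"
      using insert.prems(2) by simp
    also have "\<dots> = (\<Sum>i\<in>insert k S. slap (e i) x) + lam p k *\<^sub>R (\<Sum>i\<in>insert k S. e i x)"
      using sm by (subst slap_sum) auto
    also have "(\<Sum>i\<in>insert k S. slap (e i) x) = (\<Sum>i\<in>insert k S. - lam p i *\<^sub>R e i x)"
      using insert.prems(1) eigenspace_slap by (intro sum.cong) blast+
    also have "\<dots> + lam p k *\<^sub>R (\<Sum>i\<in>insert k S. e i x) = (\<Sum>i\<in>insert k S. (lam p k - lam p i) *\<^sub>R e i x)"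
      by (simp add: scaleR_sum_right algebra_simps flip: sum.distrib)
    also have "\<dots> = (\<Sum>i\<in>S. (lam p k - lam p i) *\<^sub>R e i x)"
      using insert.hyps by simp
    finally show "(\<Sum>i\<in>S. (lam p k - lam p i) *\<^sub>R e i x) = 0" by simp
  qed (use insert.prems that in auto)
  have 2: "e i x = 0" if "i \<in> S" for i x
    using 1[OF that, of x] lam_inj[OF assms(1), of k i] that insert.hyps by auto
  then have "e k x = 0" for x
    using insert.prems(2)[of x] insert.hyps by simp
  with 2 insert.prems(3) show ?case by auto
qed

section \<open>Maximum principle and harmonic functions on the sphere\<close>

lemma sphere_attains_max:
  fixes u :: "'m::finite usphere \<Rightarrow> real"
  assumes "smooth_sphere u"
  obtains x0 where "\<And>x. u x \<le> u x0"
proof -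
  have "continuous_on (sphere 0 1) (sphere_ext u)"
    using assms smooth_on_continuous_on continuous_on_subset unfolding smooth_sphere_iff
    by (metis (mono_tags, lifting) dist_0_norm mem_Collect_eq mem_sphere norm_zero subsetI zero_neq_one)
  then obtain v where v: "v \<in> sphere 0 1" "\<And>y. y \<in> sphere 0 1 \<Longrightarrow> sphere_ext u y \<le> sphere_ext u v"
    using continuous_attains_sup[OF compact_sphere, of "0 :: real ^ 'm" 1 "sphere_ext u"]
      Rep_usphere by blast
  then show ?thesis
    using that[of "Abs_usphere v"] by (metis Abs_usphere_inverse Rep_usphere sphere_ext_Rep)
qed

lemma sphere_ext_max:
  fixes u :: "'m::finite usphere \<Rightarrow> real"
  shows "(\<And>x. u x \<le> u x0) \<Longrightarrow> sphere_ext u v \<le> sphere_ext u (Rep_usphere x0)"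
  by (simp add: sphere_ext_def Rep_usphere_inverse)

lemma sderiv_max:
  fixes u :: "'m::finite usphere \<Rightarrow> real"
  assumes u: "smooth_sphere u" and max: "\<And>x. u x \<le> u x0"
  shows "sderiv v u x0 = 0"
proof -
  have "(\<lambda>v. sderiv v u x0) = (\<lambda>v. 0)"
    by (rule differential_zero_maxmin[OF _ open_UNIV sderiv_works[OF u]])
      (use sphere_ext_max[of u x0] max in auto)
  then show ?thesis by metis
qed

text \<open>The extension also attains its maximum at \<open>x0\<close>, so the one-variable
  argument can be run along straight lines instead of geodesics: a positive second derivative would
  make the first one positive just after \<open>x0\<close>, and the function would grow.\<close>

lemma sderiv2_max:
  fixes u :: "'m::finite usphere \<Rightarrow> real"
  assumes u: "smooth_sphere u" and max: "\<And>x. u x \<le> u x0"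
  shows "sderiv v (sderiv v u) x0 \<le> 0"
proof (rule ccontr)
  let ?F = "sphere_ext u" and ?x = "Rep_usphere x0"
  let ?\<psi> = "\<lambda>t. fd ?F (?x + t *\<^sub>R v) v"
  assume "\<not> ?thesis"
  then have pos: "fd (\<lambda>y. fd ?F y v) ?x v > 0"
    using sderiv_sderiv[OF u, of v v x0] sderiv_max[OF u max] by simp
  have smF: "smooth_on {v. v \<noteq> 0} ?F" using u by (simp add: smooth_sphere_iff)
  have "(?\<psi> has_real_derivative fd (\<lambda>y. fd ?F y v) ?x v) (at 0)"
    using has_derivative_along[of "\<lambda>y. fd ?F y v" "fd (\<lambda>y. fd ?F y v) ?x" ?x 0 v]
      smooth_on_has_derivative[OF smooth_on_fd[OF smF] open_nonzero, of ?x]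
    by (simp add: has_real_derivative_iff_has_vector_derivative)
  from DERIV_pos_inc_right[OF this pos] obtain d where
    d: "d > 0" "\<And>h. 0 < h \<Longrightarrow> h < d \<Longrightarrow> ?\<psi> 0 < ?\<psi> h" by auto
  have psi0: "?\<psi> 0 = 0" using sderiv_max[OF u max, of v] by (simp add: sderiv_def)
  \<comment> \<open>Short enough that the segment avoids the origin, where the extension need not be
    differentiable.\<close>
  define t where "t = min (d / 2) (1 / (2 * (norm v + 1)))"
  have np: "norm v + 1 > 0" by (simp add: add_nonneg_pos)
  have t: "0 < t" "t < d" using d(1) np by (auto simp: t_def min_def)
  have "t * norm v < 1"
  proof -
    have "t * (norm v + 1) \<le> 1 / (2 * (norm v + 1)) * (norm v + 1)"
      using np by (intro mult_right_mono) (auto simp: t_def)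
    also have "\<dots> = 1 / 2" using np by simp
    finally show ?thesis using t(1) by (simp add: algebra_simps)
  qed
  then have nz: "?x + s *\<^sub>R v \<noteq> 0" if "0 \<le> s" "s \<le> t" for s
  proof -
    have "norm (s *\<^sub>R v) < 1"
      using that \<open>t * norm v < 1\<close> mult_right_mono[of s t "norm v"] by simp
    then show ?thesis
      by (metis add_eq_0_iff2 norm_Rep_usphere norm_minus_cancel less_irrefl)
  qed
  have "\<exists>\<xi>. \<xi> > 0 \<and> \<xi> < t \<and> ?F (?x + t *\<^sub>R v) - ?F (?x + 0 *\<^sub>R v) = (t - 0) * ?\<psi> \<xi>"
  proof (rule MVT2[OF t(1)])
    fix s assume "0 \<le> s" "s \<le> t"
    then show "((\<lambda>s. ?F (?x + s *\<^sub>R v)) has_real_derivative ?\<psi> s) (at s)"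
      using has_derivative_along[of ?F "fd ?F (?x + s *\<^sub>R v)" ?x s v] nz
        smooth_on_has_derivative[OF smF open_nonzero]
      by (simp add: has_real_derivative_iff_has_vector_derivative)
  qed
  then obtain \<xi> where "\<xi> > 0" "\<xi> < t" "?F (?x + t *\<^sub>R v) - ?F (?x + 0 *\<^sub>R v) = t * ?\<psi> \<xi>" by auto
  then have "?F (?x + t *\<^sub>R v) > ?F ?x"
    using d(2)[of \<xi>] t psi0 by (smt (verit) mult_pos_pos scaleR_zero_left add_0_right)
  then show False using sphere_ext_max[of u x0 "?x + t *\<^sub>R v"] max by (smt (verit))
qed

lemma slap_max:
  fixes u :: "'m::finite usphere \<Rightarrow> real"
  assumes "smooth_sphere u" "\<And>x. u x \<le> u x0"
  shows "slap u x0 \<le> 0"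
  unfolding slap_def using sderiv2_max[OF assms] by (simp add: sum_nonpos)

text \<open>On the circle the angular derivative of a harmonic \<open>f\<close> is constant, and it vanishes where
  \<open>|f|\<^sup>2\<close> is maximal.\<close>

lemma harmonic_sderiv_zero_circle:
  fixes f :: "'m::finite usphere \<Rightarrow> complex"
  assumes f: "smooth_sphere f" and h: "\<And>x. slap f x = 0" and C: "CARD('m) = 2"
  shows "sderiv a f x = 0"
proof -
  have "card (Basis :: (real ^ 'm) set) = 2" using C by simp
  then obtain b c :: "real ^ 'm" where B: "Basis = {b, c}" "b \<noteq> c" by (metis card_2_iff)
  define g where "g = (\<lambda>x. sc b x *\<^sub>R sderiv c f x - sc c x *\<^sub>R sderiv b f x)"
  have g: "smooth_sphere g" using f unfolding g_def by auto
  have bc: "b \<bullet> b = 1" "c \<bullet> c = 1" "b \<bullet> c = 0" "c \<bullet> b = 0"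
    using B by (metis insertCI inner_same_Basis inner_not_same_Basis)+
  have one: "sc b x * sc b x + sc c x * sc c x = 1" for x
    using sum_sc_sc[of x] unfolding B(1) using B(2) by simp
  have rad: "sc b x *\<^sub>R sderiv b k x = - (sc c x *\<^sub>R sderiv c k x)" if "smooth_sphere k" for k :: "'m usphere \<Rightarrow> complex" and x
    using sum_sc_sderiv[OF that, of x] unfolding B(1) using B(2) by (simp add: eq_neg_iff_add_eq_0)
  \<comment> \<open>A pair \<open>(u, v)\<close> orthogonal to the unit vector
    \<open>(\<beta>, \<gamma>)\<close> is a multiple of \<open>(- \<gamma>, \<beta>)\<close>. It is
    used for the two partial derivatives, whose radial combination vanishes.\<close>
  have solve: "u = - \<gamma> *\<^sub>R (\<beta> *\<^sub>R v - \<gamma> *\<^sub>R u)" "v = \<beta> *\<^sub>R (\<beta> *\<^sub>R v - \<gamma> *\<^sub>R u)"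
    if "\<beta> * \<beta> + \<gamma> * \<gamma> = 1" "\<beta> *\<^sub>R u = - (\<gamma> *\<^sub>R v)" for \<beta> \<gamma> :: real and u v :: complex
  proof -
    have "u = (\<beta> * \<beta> + \<gamma> * \<gamma>) *\<^sub>R u" by (simp add: that(1))
    also have "\<dots> = \<beta> *\<^sub>R (\<beta> *\<^sub>R u) + \<gamma> *\<^sub>R \<gamma> *\<^sub>R u" by (simp add: algebra_simps)
    also have "\<dots> = - \<gamma> *\<^sub>R (\<beta> *\<^sub>R v - \<gamma> *\<^sub>R u)" unfolding that(2) by (simp add: algebra_simps)
    finally show "u = - \<gamma> *\<^sub>R (\<beta> *\<^sub>R v - \<gamma> *\<^sub>R u)" .
    have "v = (\<beta> * \<beta> + \<gamma> * \<gamma>) *\<^sub>R v" by (simp add: that(1))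
    also have "\<dots> = \<beta> *\<^sub>R \<beta> *\<^sub>R v - \<gamma> *\<^sub>R (- (\<gamma> *\<^sub>R v))" by (simp add: algebra_simps)
    also have "\<dots> = \<beta> *\<^sub>R (\<beta> *\<^sub>R v - \<gamma> *\<^sub>R u)" unfolding that(2)[symmetric] by (simp add: algebra_simps)
    finally show "v = \<beta> *\<^sub>R (\<beta> *\<^sub>R v - \<gamma> *\<^sub>R u)" .
  qed
  have Db: "sderiv b f = (\<lambda>x. - sc c x *\<^sub>R g x)" and Dc: "sderiv c f = (\<lambda>x. sc b x *\<^sub>R g x)"
    unfolding g_def by (rule ext, rule solve[OF one rad[OF f]])+
  have Dbb: "sderiv b (sderiv b f) x = (sc b x * sc c x) *\<^sub>R g x - sc c x *\<^sub>R sderiv b g x" for x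
  proof -
    have "sderiv b (\<lambda>x. 0 - sc c x *\<^sub>R g x) x = (sc b x * sc c x) *\<^sub>R g x - sc c x *\<^sub>R sderiv b g x"
      by (subst sderiv_add_diff(2)) (use g bc in \<open>auto simp: algebra_simps\<close>)
    then show ?thesis by (simp add: Db)
  qed
  have Dcc: "sderiv c (sderiv c f) x = - (sc b x * sc c x) *\<^sub>R g x + sc b x *\<^sub>R sderiv c g x" for x
    unfolding Dc using g bc by (simp add: algebra_simps)
  \<comment> \<open>Harmonicity of \<open>f\<close> says that the angular derivative of
    \<open>g\<close> vanishes; the radial one always does, so \<open>solve\<close> leaves no
    derivative at all.\<close>
  have tan: "sc b x *\<^sub>R sderiv c g x = sc c x *\<^sub>R sderiv b g x" for x
    using h[of x] unfolding slap_def B(1) using B(2) by (simp add: Dbb Dcc)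
  then have "sderiv b g x = 0" "sderiv c g x = 0" for x
    using solve[OF one rad[OF g]] by simp_all
  then have Dg: "sderiv v g x = 0" for v x
    using sderiv_euclidean[OF g, of v x] unfolding B(1) using B(2) by simp
  have const: "g x = g y" for x y
  proof -
    have "{v :: real ^ 'm. v \<noteq> 0} = - {0}" by auto
    then have con: "connected {v :: real ^ 'm. v \<noteq> 0}"
      using connected_punctured_universe[of "0 :: real ^ 'm"] C by simp
    have D0: "(sphere_ext g has_derivative (\<lambda>w. 0)) (at v)" if "v \<noteq> 0" for v
    proof -
      have "norm v *\<^sub>R fd (sphere_ext g) v w = 0" for w
        using sphere_ext_sderiv[OF g that, of w] Dg by (simp add: sphere_ext_def)
      then have "fd (sphere_ext g) v = (\<lambda>w. 0)" using that by auto
      then show ?thesis using has_derivative_sphere_ext[OF g that] by simp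
    qed
    have "sphere_ext g (Rep_usphere x) = sphere_ext g (Rep_usphere y)"
      by (rule has_derivative_zero_unique_connected[OF open_nonzero con]) (use D0 in auto)
    then show ?thesis by simp
  qed
  have ff: "smooth_sphere (\<lambda>x. f x \<bullet> f x)" using f by auto
  from sphere_attains_max[OF ff] obtain x0 where "\<And>x. f x \<bullet> f x \<le> f x0 \<bullet> f x0" by blast
  from slap_max[OF ff this] have "sderiv b f x0 \<bullet> sderiv b f x0 + sderiv c f x0 \<bullet> sderiv c f x0 \<le> 0"
    unfolding slap_inner_self[OF f] B(1) using B(2) h by simp
  then have "sderiv b f x0 = 0 \<and> sderiv c f x0 = 0"
    by (metis add_nonneg_eq_0_iff antisym inner_eq_zero_iff inner_ge_zero add_nonneg_nonneg)
  then have "g x0 = 0" by (simp add: g_def)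
  then have "g x = 0" for x using const by metis
  then show ?thesis using sderiv_euclidean[OF f, of a x] unfolding B(1) using B(2) Db Dc by simp
qed

text \<open>For a harmonic \<open>f\<close> the Bochner formula makes \<open>u = |grad f|\<^sup>2\<close> subharmonic, and at a maximum
  of \<open>u\<close> all second derivatives vanish; their commutators express the gradient.\<close>

lemma harmonic_sderiv_zero:
  fixes f :: "'m::finite usphere \<Rightarrow> complex"
  assumes f: "smooth_sphere f" and h: "\<And>x. slap f x = 0" and C: "CARD('m) \<ge> 2"
  shows "sderiv v f x = 0"
proof (cases "CARD('m) = 2")
  case True
  then show ?thesis using harmonic_sderiv_zero_circle[OF f h] by simp
next
  case False
  \<comment> \<open>This is the coefficient of the curvature term in the Bochner formula. It is -1
    on the circle, which is why that case needs its own argument.\<close>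
  then have C3: "real CARD('m) - 3 \<ge> 0" using C by linarith
  let ?g = "\<lambda>a. sderiv a f"
  define u where "u = (\<lambda>x. \<Sum>a\<in>Basis. ?g a x \<bullet> ?g a x)"
  have u: "smooth_sphere u" unfolding u_def using f by auto
  obtain x0 where max: "\<And>x. u x \<le> u x0" using sphere_attains_max[OF u] by blast
  have h': "slap f = (\<lambda>x. 0)" using h by auto
  have slg: "slap (?g a) x = (real CARD('m) - 3) *\<^sub>R ?g a x" for a x
    using slap_sderiv[OF f, of a x] by (simp add: h')
  let ?H = "(\<Sum>a\<in>Basis. 2 * (\<Sum>b\<in>Basis. sderiv b (?g a) x0 \<bullet> sderiv b (?g a) x0))"
  have "slap u x0 = (\<Sum>a\<in>Basis. 2 * ((real CARD('m) - 3) * (?g a x0 \<bullet> ?g a x0))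
      + 2 * (\<Sum>b\<in>Basis. sderiv b (?g a) x0 \<bullet> sderiv b (?g a) x0))"
    unfolding u_def using f by (subst slap_sum) (auto simp: slap_inner_self slg)
  also have "\<dots> \<ge> ?H"
    using C3 by (intro sum_mono) simp
  finally have "?H \<le> 0"
    using slap_max[OF u max] by linarith
  moreover have "?H \<ge> 0"
    by (intro sum_nonneg mult_nonneg_nonneg) auto
  ultimately have "?H = 0"
    by linarith
  then have D2: "sderiv b (?g a) x0 = 0" if "a \<in> Basis" "b \<in> Basis" for a b
    using that by (simp add: sum_nonneg_eq_0_iff sum_nonneg)
  have swap: "sc b x0 *\<^sub>R ?g a x0 = sc a x0 *\<^sub>R ?g b x0" if "a \<in> Basis" "b \<in> Basis" for a b
    using sderiv_commute[OF f, of b a x0] D2 that by simp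
  have "?g a x0 = 0" if a: "a \<in> Basis" for a
  proof -
    have "?g a x0 = (\<Sum>b\<in>Basis. sc b x0 * sc b x0) *\<^sub>R ?g a x0" by (simp add: sum_sc_sc)
    also have "\<dots> = (\<Sum>b\<in>Basis. sc b x0 *\<^sub>R (sc b x0 *\<^sub>R ?g a x0))" by (simp add: scaleR_sum_left)
    also have "\<dots> = (\<Sum>b\<in>Basis. sc b x0 *\<^sub>R (sc a x0 *\<^sub>R ?g b x0))"
      using swap[OF a] by (intro sum.cong) auto
    also have "\<dots> = sc a x0 *\<^sub>R (\<Sum>b\<in>Basis. sc b x0 *\<^sub>R ?g b x0)"
      by (simp add: scaleR_sum_right mult.commute)
    finally show ?thesis using sum_sc_sderiv[OF f] by simp
  qed
  then have "u x0 = 0" by (simp add: u_def)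
  moreover have "u x \<ge> 0" unfolding u_def by (intro sum_nonneg) auto
  ultimately have "u x = 0" using max[of x] by linarith
  then have "?g a x = 0" if "a \<in> Basis" for a
    using that by (simp add: u_def sum_nonneg_eq_0_iff)
  then show ?thesis using sderiv_euclidean[OF f, of v x] by simp
qed

section \<open>Ladder operators\<close>

text \<open>The components of \<open>sc a x *\<^sub>R e x\<close> in degree \<open>j + 1\<close> (\<open>True\<close>) and \<open>j - 1\<close> (\<open>False\<close>), for
  \<open>e\<close> of degree \<open>j\<close>.  For \<open>p = 1\<close> and \<open>j = 0\<close> the denominator of the general formula vanishes.\<close>

definition ladder ::
  "nat \<Rightarrow> nat \<Rightarrow> bool \<Rightarrow> real ^ 'm \<Rightarrow> ('m::finite usphere \<Rightarrow> complex) \<Rightarrow> 'm usphere \<Rightarrow> complex" where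
  "ladder p j s a e =
    (if j = 0 then (\<lambda>x. if s then sc a x *\<^sub>R e x else 0)
     else (\<lambda>x. (1 / (2 * real j + real p - 1)) *\<^sub>R
       (if s then (real j + real p - 1) *\<^sub>R (sc a x *\<^sub>R e x) + (-1) *\<^sub>R sderiv a e x
        else real j *\<^sub>R (sc a x *\<^sub>R e x) + 1 *\<^sub>R sderiv a e x)))"

text \<open>For \<open>j = 0\<close> the truncated \<open>j - 1\<close> is 0 instead of -1; this
  does no harm because the lower ladder component is then zero.\<close>

definition shift :: "bool \<Rightarrow> nat \<Rightarrow> nat" where
  "shift s j = (if s then j + 1 else j - 1)"

text \<open>The factor by which the derivative differs from multiplication by the coordinate on the
  component of degree \<open>shift s j\<close>, see \<open>ladder_sum\<close>.\<close>

definition kap :: "nat \<Rightarrow> nat \<Rightarrow> bool \<Rightarrow> real" where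
  "kap p j s = (if s then - real j else real j + real p - 1)"

text \<open>The Laplacian as a two-by-two matrix acting on the coefficient pair
  \<open>(c, d)\<close>. Its eigenvalues are \<open>- lam p (j + 1)\<close> and, for
  \<open>j \<ge> 1\<close>, \<open>- lam p (j - 1)\<close>; the pairs in \<open>ladder\<close> are
  its eigenvectors.\<close>

lemma slap_ladder_comb:
  fixes e :: "'m::finite usphere \<Rightarrow> complex"
  assumes e: "e \<in> eigenspace p j" and C: "CARD('m) = p + 1"
  shows "slap (\<lambda>x. c *\<^sub>R (sc a x *\<^sub>R e x) + d *\<^sub>R sderiv a e x) x =
    (c * (- lam p j - real p) + d * (2 * lam p j)) *\<^sub>R (sc a x *\<^sub>R e x)
    + (2 * c + d * (real p - 2 - lam p j)) *\<^sub>R sderiv a e x"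
proof -
  have s: "smooth_sphere e" and sl: "slap e = (\<lambda>x. - lam p j *\<^sub>R e x)"
    using e by (auto simp: eigenspace_iff)
  have "slap (\<lambda>x. c *\<^sub>R (sc a x *\<^sub>R e x) + d *\<^sub>R sderiv a e x) x
      = c *\<^sub>R slap (\<lambda>x. sc a x *\<^sub>R e x) x + d *\<^sub>R slap (sderiv a e) x"
    using s by (simp add: slap_add_diff slap_scaleR_const del: scaleR_scaleR)
  also have "slap (\<lambda>x. sc a x *\<^sub>R e x) x = (- lam p j - real p) *\<^sub>R (sc a x *\<^sub>R e x) + 2 *\<^sub>R sderiv a e x"
    using slap_sc_scaleR[OF s, of a x] C by (simp add: sl algebra_simps)
  also have "slap (sderiv a e) x = (2 * lam p j) *\<^sub>R (sc a x *\<^sub>R e x) + (real p - 2 - lam p j) *\<^sub>R sderiv a e x"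
    using slap_sderiv[OF s, of a x] C sderiv_linear_post[OF bounded_linear_scaleR_right[of "- lam p j"] s, of a x]
    unfolding sl by (simp add: algebra_simps)
  finally show ?thesis by (simp add: algebra_simps)
qed

lemma ladder_in_eigenspace:
  fixes e :: "'m::finite usphere \<Rightarrow> complex"
  assumes e: "e \<in> eigenspace p j" and C: "CARD('m) = p + 1" and p: "p \<ge> 1"
  shows "ladder p j s a e \<in> eigenspace p (shift s j)"
proof -
  have sm: "smooth_sphere e" using e by simp
  have D0: "sderiv a e x = 0" if "j = 0" for x
    using e C p that by (intro harmonic_sderiv_zero) (auto simp: eigenspace_iff lam_def)
  \<comment> \<open>The two conditions say that \<open>(c, d)\<close> is an eigenvector of the
    matrix in \<open>slap_ladder_comb\<close>.\<close>
  have main: "(\<lambda>x. c *\<^sub>R (sc a x *\<^sub>R e x) + d *\<^sub>R sderiv a e x) \<in> eigenspace p i"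
    if "c * (- lam p j - real p) + d * (2 * lam p j) = - lam p i * c"
       "2 * c + d * (real p - 2 - lam p j) = - lam p i * d" for c d i
    using sm unfolding eigenspace_iff slap_ladder_comb[OF e C] that
    by (simp add: algebra_simps)
  show ?thesis
  proof (cases "j = 0")
    case True
    have "slap (\<lambda>x. 1 *\<^sub>R (sc a x *\<^sub>R e x) + 0 *\<^sub>R sderiv a e x) x = - real p *\<^sub>R (sc a x *\<^sub>R e x)" for x
      unfolding slap_ladder_comb[OF e C] using True by (simp add: lam_def D0)
    then have "(\<lambda>x. sc a x *\<^sub>R e x) \<in> eigenspace p 1"
      using sm by (simp add: eigenspace_iff lam_def)
    then show ?thesis using True by (auto simp: ladder_def shift_def)
  next
    case False
    \<comment> \<open>Writing \<open>j = Suc i\<close> turns the truncated difference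
      \<open>j - 1\<close> into \<open>i\<close> before the eigenvalues are computed as
      reals.\<close>
    then obtain i where i: "j = Suc i" using not0_implies_Suc by blast
    show ?thesis
    proof (cases s)
      case True
      have "(\<lambda>x. (real j + real p - 1) *\<^sub>R (sc a x *\<^sub>R e x) + (-1) *\<^sub>R sderiv a e x) \<in> eigenspace p (j + 1)"
        by (rule main) (simp_all add: lam_def algebra_simps)
      from eigenspace_scaleR[OF this] show ?thesis
        using True False by (simp add: ladder_def shift_def)
    next
      case False
      have "(\<lambda>x. real j *\<^sub>R (sc a x *\<^sub>R e x) + 1 *\<^sub>R sderiv a e x) \<in> eigenspace p (j - 1)"
        unfolding i by (rule main[unfolded i]) (simp_all add: lam_def algebra_simps)
      from eigenspace_scaleR[OF this] show ?thesis
        using \<open>j \<noteq> 0\<close> False by (simp add: ladder_def shift_def)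
    qed
  qed
qed

lemma ladder_down_0: "ladder p 0 False a e x = 0"
  by (simp add: ladder_def)

lemma ladder_sum:
  fixes e :: "'m::finite usphere \<Rightarrow> complex"
  assumes e: "e \<in> eigenspace p j" and C: "CARD('m) = p + 1" and p: "p \<ge> 1"
  shows "sc a x *\<^sub>R e x = (\<Sum>s\<in>UNIV. ladder p j s a e x)"
    and "sderiv a e x = (\<Sum>s\<in>UNIV. kap p j s *\<^sub>R ladder p j s a e x)"
proof -
  have D0: "sderiv a e x = 0" if "j = 0" for x
    using e C p that by (intro harmonic_sderiv_zero) (auto simp: eigenspace_iff lam_def)
  define m where "m = 2 * real j + real p - 1"
  have m: "m \<noteq> 0" if "j \<noteq> 0" using that p by (simp add: m_def)
  define S where "S = sc a x *\<^sub>R e x"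
  define D where "D = sderiv a e x"
  have T: "ladder p j True a e x = (1 / m) *\<^sub>R ((real j + real p - 1) *\<^sub>R S + (-1) *\<^sub>R D)"
    and F: "ladder p j False a e x = (1 / m) *\<^sub>R (real j *\<^sub>R S + 1 *\<^sub>R D)" if "j \<noteq> 0"
    using that by (simp_all add: ladder_def S_def D_def m_def)
  have gen: "k1 *\<^sub>R (1 / m) *\<^sub>R (c1 *\<^sub>R S + d1 *\<^sub>R D) + k2 *\<^sub>R (1 / m) *\<^sub>R (c2 *\<^sub>R S + d2 *\<^sub>R D) =
      ((k1 * c1 + k2 * c2) / m) *\<^sub>R S + ((k1 * d1 + k2 * d2) / m) *\<^sub>R D" for k1 k2 c1 c2 d1 d2
    by (simp add: scaleR_add_right scaleR_add_left add_divide_distrib)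
  show "sc a x *\<^sub>R e x = (\<Sum>s\<in>UNIV. ladder p j s a e x)"
  proof (cases "j = 0")
    case True
    then show ?thesis by (simp add: ladder_def UNIV_bool)
  next
    case False
    have "(\<Sum>s\<in>UNIV. ladder p j s a e x) = (m / m) *\<^sub>R S"
      using gen[of 1 "real j" 1 1 "real j + real p - 1" "-1"]
      by (simp add: UNIV_bool T[OF False] F[OF False] m_def del: scaleR_add_right)
    then show ?thesis using m[OF False] by (simp add: S_def)
  qed
  show "sderiv a e x = (\<Sum>s\<in>UNIV. kap p j s *\<^sub>R ladder p j s a e x)"
  proof (cases "j = 0")
    case True
    then show ?thesis by (simp add: ladder_def UNIV_bool kap_def D0)
  next
    case False
    have "(\<Sum>s\<in>UNIV. kap p j s *\<^sub>R ladder p j s a e x) = (m / m) *\<^sub>R D"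
      using gen[of "real j + real p - 1" "real j" 1 "- real j" "real j + real p - 1" "-1"]
      by (simp add: UNIV_bool T[OF False] F[OF False] kap_def m_def algebra_simps del: scaleR_add_right)
    then show ?thesis using m[OF False] by (simp add: D_def)
  qed
qed

text \<open>The two components have different degrees, also for \<open>j = 0\<close>, where the
  lower one is zero and is filed under degree 0.\<close>

lemma ladder_independent:
  fixes e :: "'m::finite usphere \<Rightarrow> complex"
  assumes e: "e \<in> eigenspace p j" and C: "CARD('m) = p + 1" and p: "p \<ge> 1"
    and z: "\<And>x. (\<Sum>s\<in>UNIV. c s * ladder p j s a e x) = 0"
  shows "c s * ladder p j s a e x = 0"
proof -
  let ?l = "\<lambda>s x. c s * ladder p j s a e x"
  define f where "f i = (if i = j + 1 then ?l True else ?l False)" for i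
  have f: "f (shift s j) = ?l s" for s by (cases s) (auto simp: f_def shift_def)
  have inj: "inj (\<lambda>s. shift s j)" by (auto simp: inj_def shift_def)
  have "f (shift s j) x = 0"
  proof (rule eigenspace_independent[OF p, of "range (\<lambda>s. shift s j)"])
    show "(\<Sum>i\<in>range (\<lambda>s. shift s j). f i x) = 0" for x
      unfolding sum.reindex[OF inj] o_def f by (rule z)
  qed (auto simp: f intro!: eigenspace_cmult ladder_in_eigenspace[OF e C p])
  then show ?thesis by (simp add: f)
qed

text \<open>Contracting the ladder operators with the position vector gives back a multiple of \<open>e\<close>.\<close>

lemma ladder_nonzero:
  fixes e :: "'m::finite usphere \<Rightarrow> complex"
  assumes e: "e \<in> eigenspace p j" "e x0 \<noteq> 0" and p: "p \<ge> 1" and s: "s \<or> j \<ge> 1"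
  shows "\<exists>a\<in>Basis. \<exists>x. ladder p j s a e x \<noteq> 0"
proof (rule ccontr)
  assume "\<not> ?thesis"
  then have z: "ladder p j s a e x0 = 0" if "a \<in> Basis" for a using that by blast
  define c where "c = (if j = 0 then 1 else if s then real j + real p - 1 else real j)"
  define d where "d = (if j = 0 then 0 else if s then -1 else 1 :: real)"
  have c: "c \<noteq> 0" using p by (auto simp: c_def)
  have "c *\<^sub>R (sc a x0 *\<^sub>R e x0) + d *\<^sub>R sderiv a e x0 = 0" if "a \<in> Basis" for a
    using z[OF that] p s by (auto simp: ladder_def c_def d_def split: if_splits)
  then have "0 = (\<Sum>a\<in>Basis. sc a x0 *\<^sub>R (c *\<^sub>R (sc a x0 *\<^sub>R e x0) + d *\<^sub>R sderiv a e x0))" by simp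
  also have "\<dots> = c *\<^sub>R ((\<Sum>a\<in>Basis. sc a x0 * sc a x0) *\<^sub>R e x0) + d *\<^sub>R (\<Sum>a\<in>Basis. sc a x0 *\<^sub>R sderiv a e x0)"
    by (simp add: scaleR_sum_left scaleR_sum_right sum.distrib algebra_simps)
  also have "\<dots> = c *\<^sub>R e x0" using e by (simp add: sum_sc_sc sum_sc_sderiv)
  finally show False using c e by simp
qed

text \<open>No explicit eigenfunction is written down: starting from the constant 1, some upward
  ladder component is nonzero in every degree.\<close>

lemma eigenspace_nonzero:
  assumes C: "CARD('m::finite) = p + 1" and p: "p \<ge> 1"
  obtains e :: "'m::finite usphere \<Rightarrow> complex" and x where "e \<in> eigenspace p j" "e x \<noteq> 0"
proof -
  have "\<exists>e \<in> eigenspace p j. \<exists>x. e (x :: 'm usphere) \<noteq> 0"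
  proof (induction j)
    case 0
    have "(\<lambda>x :: 'm usphere. 1 :: complex) \<in> eigenspace p 0" by (simp add: eigenspace_iff lam_def)
    then show ?case by (rule bexI[rotated]) auto
  next
    case (Suc j)
    then obtain e and x0 :: "'m usphere" where e: "e \<in> eigenspace p j" "e x0 \<noteq> 0" by auto
    obtain a and x :: "'m usphere" where "ladder p j True a e x \<noteq> 0"
      using ladder_nonzero[OF e p, of True] by blast
    then show ?case using ladder_in_eigenspace[OF e(1) C p, of True a] by (auto simp: shift_def)
  qed
  then show ?thesis using that by blast
qed

text \<open>Infinitesimal rotations commute with the Laplacian. In the direct computation the second
  derivatives enter only through the commutator of \<open>sderiv c\<close> and
  \<open>sderiv a\<close>.\<close>

lemma eigenspace_rotation_field:
  fixes e :: "'m::finite usphere \<Rightarrow> complex"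
  assumes e: "e \<in> eigenspace p j" and C: "CARD('m) = p + 1"
  shows "(\<lambda>x. sc c x *\<^sub>R sderiv a e x - sc a x *\<^sub>R sderiv c e x) \<in> eigenspace p j"
proof -
  have s: "smooth_sphere e" and sl: "slap e = (\<lambda>x. - lam p j *\<^sub>R e x)"
    using e by (auto simp: eigenspace_iff)
  have 1: "slap (\<lambda>x. sc c x *\<^sub>R sderiv a e x) x =
    sc c x *\<^sub>R ((2 * lam p j) *\<^sub>R (sc a x *\<^sub>R e x) + (real p - 2 - lam p j) *\<^sub>R sderiv a e x)
     - real p *\<^sub>R sc c x *\<^sub>R sderiv a e x + 2 *\<^sub>R sderiv c (sderiv a e) x" for c a x
    using slap_ladder_comb[OF e C, of 0 a 1 x] s C by (simp add: slap_sc_scaleR)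
  have 2: "slap (\<lambda>x. sc c x *\<^sub>R sderiv a e x - sc a x *\<^sub>R sderiv c e x) x =
      slap (\<lambda>x. sc c x *\<^sub>R sderiv a e x) x - slap (\<lambda>x. sc a x *\<^sub>R sderiv c e x) x" for x
    using s by (intro slap_add_diff) auto
  have 3: "2 *\<^sub>R sderiv c (sderiv a e) x = 2 *\<^sub>R sderiv a (sderiv c e) x + 2 *\<^sub>R sc c x *\<^sub>R sderiv a e x
      - 2 *\<^sub>R sc a x *\<^sub>R sderiv c e x" for x
    by (subst sderiv_commute[OF s, of c a x]) (simp add: algebra_simps)
  show ?thesis
    unfolding eigenspace_iff 2 1 3[of x for x] using s by (simp add: algebra_simps)
qed

section \<open>Rotations preserve the eigenspaces\<close>

lemma matrix_vector_inner: "(Q *v b) \<bullet> c = b \<bullet> (transpose Q *v c)" for Q :: "real ^ 'n ^ 'n"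
  by (simp add: dot_lmul_matrix[symmetric] vector_transpose_matrix inner_commute)

definition rotated :: "real ^ 'm ^ 'm \<Rightarrow> ('m::finite usphere \<Rightarrow> 'b) \<Rightarrow> 'm usphere \<Rightarrow> 'b" where
  "rotated Q f x = f (Abs_usphere (Q *v Rep_usphere x))"

context
  fixes Q :: "real ^ ('m::finite) ^ 'm"
  assumes Q: "orthogonal_matrix Q"
begin

lemma norm_orthogonal: "norm (Q *v v) = norm v"
  using Q orthogonal_transformation_matrix[of "(*v) Q"] orthogonal_transformation_norm by auto

lemma Rep_rotate: "Rep_usphere (Abs_usphere (Q *v Rep_usphere x)) = Q *v Rep_usphere x"
  by (simp add: Abs_usphere_inverse norm_orthogonal)

lemma sphere_ext_rotated: "sphere_ext (rotated Q f) v = sphere_ext f (Q *v v)" if "v \<noteq> 0"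
proof -
  have "sgn (Q *v v) = Q *v sgn v"
    by (simp only: sgn_div_norm norm_orthogonal matrix_vector_mult_scaleR)
  then show ?thesis using that by (simp add: sphere_ext_def rotated_def)
qed

lemma rotated_nonzero: "v \<noteq> 0 \<Longrightarrow> Q *v v \<noteq> 0"
  using norm_orthogonal[of v] by auto

lemma smooth_sphere_rotated: "smooth_sphere f \<Longrightarrow> smooth_sphere (rotated Q f)"
proof -
  assume "smooth_sphere f"
  then have "smooth_on {v. v \<noteq> 0} (\<lambda>v. sphere_ext f (Q *v v))"
    unfolding smooth_sphere_iff
    by (rule smooth_on_compose_linear[OF open_nonzero open_nonzero
          matrix_vector_mul_bounded_linear, rotated]) (simp add: rotated_nonzero)
  then show ?thesis
    unfolding smooth_sphere_iff
    by (subst smooth_on_cong[OF open_nonzero]) (auto simp: sphere_ext_rotated)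
qed

lemma sderiv_rotated:
  assumes f: "smooth_sphere f"
  shows "sderiv w (rotated Q f) = rotated Q (sderiv (Q *v w) f)"
proof
  fix x
  have "(sphere_ext f has_derivative (\<lambda>v. sderiv v f (Abs_usphere (Q *v Rep_usphere x)))) (at (Q *v Rep_usphere x))"
    using sderiv_works[OF f, of "Abs_usphere (Q *v Rep_usphere x)"] by (simp add: Rep_rotate)
  then have "((\<lambda>v. sphere_ext f (Q *v v)) has_derivative
      (\<lambda>v. sderiv (Q *v v) f (Abs_usphere (Q *v Rep_usphere x)))) (at (Rep_usphere x))"
    by (rule has_derivative_compose[OF bounded_linear_imp_has_derivative[OF matrix_vector_mul_bounded_linear]])
  then have "(sphere_ext (rotated Q f) has_derivative
      (\<lambda>v. sderiv (Q *v v) f (Abs_usphere (Q *v Rep_usphere x)))) (at (Rep_usphere x))"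
    by (rule has_derivative_transform_within_open[OF _ open_nonzero]) (auto simp: sphere_ext_rotated)
  from sderivI[OF this] show "sderiv w (rotated Q f) x = rotated Q (sderiv (Q *v w) f) x"
    by (simp add: rotated_def)
qed

text \<open>The sum of squares of derivatives is the same for every orthonormal basis, and
  \<open>Q\<close> maps the standard basis to another one.\<close>

lemma slap_rotated:
  assumes f: "smooth_sphere f"
  shows "slap (rotated Q f) x = rotated Q (slap f) x"
proof -
  let ?t = "\<lambda>c. transpose Q *v c"
  let ?y = "Abs_usphere (Q *v Rep_usphere x)"
  have "sderiv (Q *v b) (sderiv (Q *v b) f) ?y =
      (\<Sum>c\<in>Basis. \<Sum>d\<in>Basis. ((b \<bullet> ?t c) * (b \<bullet> ?t d)) *\<^sub>R sderiv c (sderiv d f) ?y)" for b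
  proof -
    have eq: "sderiv (Q *v b) f = (\<lambda>x. \<Sum>d\<in>Basis. (b \<bullet> ?t d) *\<^sub>R sderiv d f x)"
      using sderiv_euclidean[OF f, of "Q *v b"] by (simp add: matrix_vector_inner fun_eq_iff)
    have "sderiv (Q *v b) (sderiv (Q *v b) f) ?y = (\<Sum>c\<in>Basis. (b \<bullet> ?t c) *\<^sub>R sderiv c (sderiv (Q *v b) f) ?y)"
      using sderiv_euclidean[OF smooth_sphere_sderiv[OF f], of "Q *v b"] by (simp add: matrix_vector_inner)
    also have "\<dots> = (\<Sum>c\<in>Basis. (b \<bullet> ?t c) *\<^sub>R (\<Sum>d\<in>Basis. (b \<bullet> ?t d) *\<^sub>R sderiv c (sderiv d f) ?y))"
      unfolding eq using f by (subst sderiv_sum) auto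
    finally show ?thesis by (simp add: scaleR_sum_right)
  qed
  then have "slap (rotated Q f) x =
      (\<Sum>b\<in>Basis. \<Sum>c\<in>Basis. \<Sum>d\<in>Basis. ((b \<bullet> ?t c) * (b \<bullet> ?t d)) *\<^sub>R sderiv c (sderiv d f) ?y)"
    using f by (simp add: slap_def sderiv_rotated rotated_def[of Q "sderiv _ _"])
  also have "\<dots> = (\<Sum>c\<in>Basis. \<Sum>d\<in>Basis. (\<Sum>b\<in>Basis. (b \<bullet> ?t c) * (b \<bullet> ?t d)) *\<^sub>R sderiv c (sderiv d f) ?y)"
    unfolding scaleR_sum_left by (rule trans[OF sum.swap], rule sum.cong[OF refl], rule sum.swap)
  also have "\<dots> = (\<Sum>c\<in>Basis. \<Sum>d\<in>Basis. (c \<bullet> d) *\<^sub>R sderiv c (sderiv d f) ?y)"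
  proof -
    have "(\<Sum>b\<in>Basis. (b \<bullet> ?t c) * (b \<bullet> ?t d)) = c \<bullet> d" for c d
    proof -
      have "(\<Sum>b\<in>Basis. (b \<bullet> ?t c) * (b \<bullet> ?t d)) = ?t c \<bullet> ?t d"
        by (subst euclidean_inner) (simp add: inner_commute)
      also have "\<dots> = c \<bullet> (Q *v ?t d)" using matrix_vector_inner[of "transpose Q" c "?t d"] by (simp only: transpose_transpose)
      also have "\<dots> = c \<bullet> d" using Q by (simp only: matrix_vector_mul_assoc orthogonal_matrix_def) simp
      finally show ?thesis .
    qed
    then show ?thesis by simp
  qed
  also have "\<dots> = (\<Sum>c\<in>Basis. sderiv c (sderiv c f) ?y)"
  proof (intro sum.cong refl)
    fix c :: "real ^ 'm" assume c: "c \<in> Basis"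
    have "(\<Sum>d\<in>Basis. (c \<bullet> d) *\<^sub>R sderiv c (sderiv d f) ?y) = (\<Sum>d\<in>Basis. if d = c then sderiv c (sderiv d f) ?y else 0)"
      using c by (intro sum.cong) (auto simp: inner_Basis)
    then show "(\<Sum>d\<in>Basis. (c \<bullet> d) *\<^sub>R sderiv c (sderiv d f) ?y) = sderiv c (sderiv c f) ?y"
      using c by simp
  qed
  finally show ?thesis by (simp add: slap_def rotated_def)
qed

lemma eigenspace_rotated: "f \<in> eigenspace p j \<Longrightarrow> rotated Q f \<in> eigenspace p j"
  by (simp add: eigenspace_iff smooth_sphere_rotated slap_rotated) (simp add: rotated_def)

end

section \<open>Conformal vector fields\<close>

abbreviation punct :: "('m::finite, 'n::finite) ambient set" where
  "punct \<equiv> {w. fst w \<noteq> 0 \<and> snd w \<noteq> 0}"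

lemma open_punct: "open (punct :: ('m::finite, 'n::finite) ambient set)"
proof -
  have "(punct :: ('m, 'n) ambient set) = {v. v \<noteq> 0} \<times> {v. v \<noteq> 0}" by auto
  then show ?thesis using open_Times[OF open_nonzero open_nonzero] by simp
qed

text \<open>The retraction onto the embedded manifold through which \<open>mfd_ext\<close> extends
  functions.\<close>

definition msgn :: "('m::finite, 'n::finite) ambient \<Rightarrow> ('m, 'n) ambient" where
  "msgn w = (sgn (fst w), sgn (snd w))"

lemma embed_in_punct [simp]: "embed z \<in> punct"
  by (simp add: embed_def)

lemma fst_embed [simp]: "fst (embed z) = Rep_usphere (fst z)"
  and snd_embed [simp]: "snd (embed z) = Rep_usphere (snd z)"
  by (simp_all add: embed_def)

lemma mfd_ext_embed [simp]: "mfd_ext f (embed z) = f z"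
  by (simp add: mfd_ext_def Rep_usphere_inverse)

lemma smooth_mfd_iff: "smooth_mfd f \<longleftrightarrow> smooth_on punct (mfd_ext f)"
  by (simp add: smooth_mfd_def smooth_on_def)

lemma mfd_ext_embed_fun:
  "w \<in> punct \<Longrightarrow> mfd_ext (\<lambda>z. F (embed z)) w = F (msgn w)"
  by (simp add: mfd_ext_def msgn_def embed_def)

lemma smooth_on_msgn: "smooth_on punct (msgn :: ('m::finite, 'n::finite) ambient \<Rightarrow> _)"
proof -
  have 1: "smooth_on (punct :: ('m, 'n) ambient set) (\<lambda>w. sgn (fst w))"
    by (rule smooth_on_compose_linear[OF open_punct open_nonzero bounded_linear_fst _ smooth_on_sgn]) auto
  have 2: "smooth_on (punct :: ('m, 'n) ambient set) (\<lambda>w. sgn (snd w))"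
    by (rule smooth_on_compose_linear[OF open_punct open_nonzero bounded_linear_snd _ smooth_on_sgn]) auto
  have b1: "bounded_linear (\<lambda>x::real ^ 'm. (x, 0 :: real ^ 'n))"
    by (intro bounded_linear_Pair bounded_linear_ident bounded_linear_zero)
  have b2: "bounded_linear (\<lambda>y::real ^ 'n. (0 :: real ^ 'm, y))"
    by (intro bounded_linear_Pair bounded_linear_ident bounded_linear_zero)
  have "msgn = (\<lambda>w :: ('m, 'n) ambient. (sgn (fst w), 0) + (0, sgn (snd w)))"
    by (auto simp: msgn_def)
  then show ?thesis
    using smooth_on_add[OF open_punct smooth_on_post[OF open_punct b1 1] smooth_on_post[OF open_punct b2 2]]
    by simp
qed

lemma has_derivative_msgn:
  "(msgn has_derivative (\<lambda>v. (fst v - (Rep_usphere (fst z) \<bullet> fst v) *\<^sub>R Rep_usphere (fst z),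
      snd v - (Rep_usphere (snd z) \<bullet> snd v) *\<^sub>R Rep_usphere (snd z)))) (at (embed z))"
  unfolding msgn_def
  by (intro has_derivative_Pair has_derivative_compose[where g = sgn, OF bounded_linear_imp_has_derivative[OF bounded_linear_fst]]
      has_derivative_compose[where g = sgn, OF bounded_linear_imp_has_derivative[OF bounded_linear_snd]])
    (simp_all add: has_derivative_sgn)

lemma bounded_bilinear_metric: "bounded_bilinear metric"
proof -
  have "bounded_linear (\<lambda>u :: ('m::finite, 'n::finite) ambient. (- fst u, snd u))"
    by (intro bounded_linear_Pair bounded_linear_minus bounded_linear_fst bounded_linear_snd)
  from bounded_bilinear.comp[OF bounded_bilinear_inner this bounded_linear_ident]
  show ?thesis by (simp add: metric_def [abs_def] inner_prod_def)
qed

interpretation metric: bounded_bilinear metric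
  by (rule bounded_bilinear_metric)

lemma metric_commute: "metric u v = metric v u"
  by (simp add: metric_def inner_commute)

definition radial :: "(('m::finite, 'n::finite) ambient \<Rightarrow> ('m, 'n) ambient) \<Rightarrow> ('m, 'n) ambient \<Rightarrow> real" where
  "radial B w = fst w \<bullet> fst (B w)"

text \<open>The field induced on the manifold by the linear field \<open>B\<close>: at its points
  the differential of \<open>Phi\<close> subtracts this multiple of the position. For skew
  \<open>B\<close> the timelike and spacelike radial parts agree, so one multiple makes both
  components tangent. Allowing arbitrary \<open>B\<close> covers the linear combinations in
  \<open>conf_algebra\<close>.\<close>

definition field_of :: "(('m::finite, 'n::finite) ambient \<Rightarrow> ('m, 'n) ambient) \<Rightarrow> ('m, 'n) mfd \<Rightarrow> ('m, 'n) ambient" where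
  "field_of B z = B (embed z) - radial B (embed z) *\<^sub>R embed z"

text \<open>The elements of the Lie algebra so(p+1,q+1), as linear maps of the ambient
  space.\<close>

definition skew :: "(('m::finite, 'n::finite) ambient \<Rightarrow> ('m, 'n) ambient) \<Rightarrow> bool" where
  "skew B \<longleftrightarrow> bounded_linear B \<and> (\<forall>u v. metric (B u) v + metric u (B v) = 0)"

lemma lie_fun_eqI:
  "(mfd_ext f has_derivative f') (at (embed z)) \<Longrightarrow> lie_fun X f z = f' (X z)"
  unfolding lie_fun_def by (metis frechet_derivative_at)

text \<open>The derivative is needed only modulo the position vector, which \<open>metric\<close>
  does not see when paired with tangent vectors; hence the unspecified \<open>c\<close>.\<close>

lemma lie_fun_field_of:
  assumes B: "bounded_linear B" and U: "fst (U z) \<bullet> fst (embed z) = 0" "snd (U z) \<bullet> snd (embed z) = 0"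
  obtains c where "lie_fun U (field_of B) z =
    B (U z) - radial B (embed z) *\<^sub>R U z - c *\<^sub>R embed z"
proof -
  let ?D = "\<lambda>v. (fst v - (Rep_usphere (fst z) \<bullet> fst v) *\<^sub>R Rep_usphere (fst z),
      snd v - (Rep_usphere (snd z) \<bullet> snd v) *\<^sub>R Rep_usphere (snd z))"
  let ?F = "\<lambda>v. B (?D v) - ((fst (msgn (embed z)) \<bullet> fst (B (msgn (embed z)))) *\<^sub>R ?D v +
        (fst (msgn (embed z)) \<bullet> fst (B (?D v)) + fst (?D v) \<bullet> fst (B (msgn (embed z)))) *\<^sub>R msgn (embed z))"
  have B': "((\<lambda>w. B (msgn w)) has_derivative (\<lambda>v. B (?D v))) (at (embed z))"
    by (rule bounded_linear.has_derivative[OF B has_derivative_msgn])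
  have F: "((\<lambda>w. fst (msgn w)) has_derivative (\<lambda>v. fst (?D v))) (at (embed z))"
    by (rule has_derivative_fst[OF has_derivative_msgn])
  have FB: "((\<lambda>w. fst (B (msgn w))) has_derivative (\<lambda>v. fst (B (?D v)))) (at (embed z))"
    by (rule has_derivative_fst[OF B'])
  have R: "((\<lambda>w. fst (msgn w) \<bullet> fst (B (msgn w))) has_derivative
      (\<lambda>v. fst (msgn (embed z)) \<bullet> fst (B (?D v)) + fst (?D v) \<bullet> fst (B (msgn (embed z))))) (at (embed z))"
    by (rule has_derivative_inner[OF F FB])
  have ms: "msgn (embed z) = embed z" by (simp add: msgn_def embed_def)
  have "((\<lambda>w. B (msgn w) - (fst (msgn w) \<bullet> fst (B (msgn w))) *\<^sub>R msgn w) has_derivative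
      ?F) (at (embed z))"
    by (intro has_derivative_diff B' has_derivative_scaleR[OF R has_derivative_msgn])
  then have "(mfd_ext (field_of B) has_derivative
      ?F) (at (embed z))"
    by (rule has_derivative_transform_within_open[OF _ open_punct])
      (simp_all only: field_of_def [abs_def] radial_def mfd_ext_embed_fun[of _ "\<lambda>w. B w - (fst w \<bullet> fst (B w)) *\<^sub>R w"] embed_in_punct)
  note L = lie_fun_eqI[OF this, of U]
  have DU: "?D (U z) = U z" using U by (simp add: inner_commute prod_eq_iff)
  show ?thesis
    by (rule that, unfold L DU, unfold ms radial_def, simp only: diff_diff_eq) 
qed

lemma smooth_mfd_has_derivative:
  "smooth_mfd f \<Longrightarrow> (mfd_ext f has_derivative (\<lambda>v. lie_fun (\<lambda>_. v) f z)) (at (embed z))"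
  using smooth_on_has_derivative[OF _ open_punct embed_in_punct] unfolding lie_fun_def smooth_mfd_iff by blast

lemma lie_fun_point: "lie_fun X f z = lie_fun (\<lambda>_. X z) f z"
  by (simp add: lie_fun_def)

lemma lie_fun_metric:
  assumes U: "smooth_mfd U" and V: "smooth_mfd V"
  shows "lie_fun X (\<lambda>y. metric (U y) (V y)) z = metric (U z) (lie_fun X V z) + metric (lie_fun X U z) (V z)"
proof -
  have "((\<lambda>w. metric (mfd_ext U w) (mfd_ext V w)) has_derivative
      (\<lambda>v. metric (mfd_ext U (embed z)) (lie_fun (\<lambda>_. v) V z) + metric (lie_fun (\<lambda>_. v) U z) (mfd_ext V (embed z)))) (at (embed z))"
    by (rule metric.FDERIV[OF smooth_mfd_has_derivative[OF U] smooth_mfd_has_derivative[OF V]])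
  moreover have "(\<lambda>w. metric (mfd_ext U w) (mfd_ext V w)) = mfd_ext (\<lambda>y. metric (U y) (V y))"
    by (simp add: mfd_ext_def [abs_def])
  ultimately show ?thesis
    using lie_fun_eqI by (simp add: lie_fun_point[of X U] lie_fun_point[of X V])
qed

text \<open>The derivatives of \<open>U\<close> and \<open>V\<close> along the field cancel against
  the brackets, skewness removes \<open>B\<close>, the multiples of the position are orthogonal to
  the tangent vectors, and the rescaling by \<open>radial B\<close> is all that survives.\<close>

lemma lie_metric_field_of:
  assumes B: "skew B" and U: "smooth_vector_field U" and V: "smooth_vector_field V"
  shows "lie_metric (field_of B) U V z = 2 * (- radial B (embed z)) * metric (U z) (V z)"
proof -
  have bl: "bounded_linear B" and sk: "metric (B (U z)) (V z) + metric (U z) (B (V z)) = 0"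
    using B unfolding skew_def by blast+
  have tU: "fst (U z) \<bullet> fst (embed z) = 0" "snd (U z) \<bullet> snd (embed z) = 0"
    and tV: "fst (V z) \<bullet> fst (embed z) = 0" "snd (V z) \<bullet> snd (embed z) = 0"
    using U V unfolding smooth_vector_field_def by blast+
  obtain c where c: "lie_fun U (field_of B) z = B (U z) - radial B (embed z) *\<^sub>R U z - c *\<^sub>R embed z"
    using lie_fun_field_of[of B U z, OF bl tU] by blast
  obtain d where d: "lie_fun V (field_of B) z = B (V z) - radial B (embed z) *\<^sub>R V z - d *\<^sub>R embed z"
    using lie_fun_field_of[of B V z, OF bl tV] by blast
  have n: "metric (embed z) (V z) = 0" "metric (U z) (embed z) = 0"
    using tU tV by (simp_all add: metric_def inner_commute)
  have "lie_metric (field_of B) U V z = metric (lie_fun U (field_of B) z) (V z) + metric (U z) (lie_fun V (field_of B) z)"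
    using U V by (simp add: lie_metric_def lie_bracket_def lie_fun_metric smooth_vector_field_def
        metric.diff_left metric.diff_right)
  also have "\<dots> = (metric (B (U z)) (V z) + metric (U z) (B (V z))) - 2 * radial B (embed z) * metric (U z) (V z)"
    unfolding c d using n by (simp add: metric.diff_left metric.diff_right metric.scaleR_left metric.scaleR_right)
  finally show ?thesis using sk by simp
qed

text \<open>The tangential projection of a constant timelike vector. Where \<open>a\<close> is a
  nonzero tangent vector, the field has nonzero square, and this pins down the conformal
  factor.\<close>

definition test_field :: "real ^ 'm \<Rightarrow> ('m::finite, 'n::finite) mfd \<Rightarrow> ('m, 'n) ambient" where
  "test_field a z = (a - (Rep_usphere (fst z) \<bullet> a) *\<^sub>R Rep_usphere (fst z), 0)"

lemma smooth_test_field: "smooth_vector_field (test_field a :: ('m::finite, 'n::finite) mfd \<Rightarrow> _)"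
proof -
  have b1: "bounded_linear (\<lambda>x::real ^ 'm. (x, 0 :: real ^ 'n))"
    by (intro bounded_linear_Pair bounded_linear_ident bounded_linear_zero)
  have "smooth_on (punct :: ('m, 'n) ambient set) (\<lambda>w. fst (msgn w))"
    by (rule smooth_on_post[OF open_punct bounded_linear_fst smooth_on_msgn])
  then have "smooth_on (punct :: ('m, 'n) ambient set) (\<lambda>w. (a - (sgn (fst w) \<bullet> a) *\<^sub>R sgn (fst w), 0 :: real ^ 'n))"
    unfolding msgn_def fst_conv
    by (intro smooth_on_post[OF open_punct b1] smooth_on_diff smooth_on_const smooth_on_scaleR smooth_on_inner open_punct)
  then have "smooth_mfd (test_field a :: ('m, 'n) mfd \<Rightarrow> _)"
    unfolding smooth_mfd_iff
    by (subst smooth_on_cong[OF open_punct]) (auto simp: mfd_ext_def test_field_def)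
  then show ?thesis
    by (auto simp: smooth_vector_field_def test_field_def inner_diff_left inner_diff_right inner_commute)
qed

lemma conformal_factor_field_of:
  assumes B: "skew B" and C: "CARD('m) \<ge> 2"
  shows "conformal_factor (field_of B :: ('m::finite, 'n::finite) mfd \<Rightarrow> _) = (\<lambda>z. - radial B (embed z))"
  unfolding conformal_factor_def
proof (rule the_equality)
  have bl: "bounded_linear B" using B by (simp add: skew_def)
  have bf: "bounded_linear (\<lambda>w :: ('m, 'n) ambient. fst (B w))"
    using bounded_linear_compose[OF bounded_linear_fst bl] .
  have sm: "smooth_on punct (\<lambda>w. - (fst (msgn w) \<bullet> fst (B (msgn w))))"
    by (intro smooth_on_minus smooth_on_inner open_punct smooth_on_post[OF open_punct bounded_linear_fst smooth_on_msgn]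
        smooth_on_post[OF open_punct bf smooth_on_msgn])
  have eq: "mfd_ext (\<lambda>z. - radial B (embed z)) w = - (fst (msgn w) \<bullet> fst (B (msgn w)))" if "w \<in> punct" for w
    using mfd_ext_embed_fun[OF that, of "\<lambda>w. - radial B w"] by (simp only: radial_def)
  have "smooth_mfd (\<lambda>z. - radial B (embed z))"
    unfolding smooth_mfd_iff by (rule iffD2[OF smooth_on_cong[OF open_punct eq] sm])
  then show "smooth_mfd (\<lambda>z. - radial B (embed z)) \<and> (\<forall>U V. smooth_vector_field U \<longrightarrow> smooth_vector_field V \<longrightarrow>
        (\<forall>z. lie_metric (field_of B) U V z = 2 * - radial B (embed z) * metric (U z) (V z)))"
    using lie_metric_field_of[OF B] by auto
next
  fix \<omega> :: "('m, 'n) mfd \<Rightarrow> real"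
  assume *: "smooth_mfd \<omega> \<and> (\<forall>U V. smooth_vector_field U \<longrightarrow> smooth_vector_field V \<longrightarrow>
        (\<forall>z. lie_metric (field_of B) U V z = 2 * \<omega> z * metric (U z) (V z)))"
  show "\<omega> = (\<lambda>z. - radial B (embed z))"
  proof
    fix z :: "('m, 'n) mfd"
    obtain a where a: "a \<noteq> 0" "orthogonal (Rep_usphere (fst z)) a"
      using orthogonal_to_vector_exists[of "Rep_usphere (fst z)"] C by auto
    let ?U = "test_field a :: ('m, 'n) mfd \<Rightarrow> _"
    have eq: "2 * \<omega> z * metric (?U z) (?U z) = 2 * (- radial B (embed z)) * metric (?U z) (?U z)"
      using * smooth_test_field lie_metric_field_of[OF B smooth_test_field smooth_test_field] by metis
    have nz: "metric (?U z) (?U z) \<noteq> 0"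
      using a by (simp add: metric_def test_field_def orthogonal_def)
    have "(\<omega> z + radial B (embed z)) * metric (?U z) (?U z) = 0"
      using eq by (simp add: algebra_simps)
    with nz show "\<omega> z = - radial B (embed z)" by simp
  qed
qed

lemma bounded_linear_coord: "bounded_linear (\<lambda>\<xi>. coord \<xi> \<alpha>)"
  by (cases \<alpha>) (auto intro: bounded_linear_intros bounded_linear_compose[OF bounded_linear_vec_nth bounded_linear_fst]
      bounded_linear_compose[OF bounded_linear_vec_nth bounded_linear_snd])

lemma metric_unit_vec: "metric (unit_vec \<alpha>) v = eps_sign \<alpha> * coord v \<alpha>"
  by (cases \<alpha>) (auto simp: metric_def inner_axis' )

lemma skew_L_field: "skew (L_field \<alpha> \<beta>)"
proof -
  have "bounded_linear (L_field \<alpha> \<beta>)"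
    unfolding L_field_def [abs_def]
    by (intro bounded_linear_sub bounded_linear_scaleR_const bounded_linear_const_mult bounded_linear_coord)
  moreover have "metric (L_field \<alpha> \<beta> u) v + metric u (L_field \<alpha> \<beta> v) = 0" for u v
    by (simp add: L_field_def metric.diff_left metric.diff_right metric.scaleR_left metric.scaleR_right
        metric_unit_vec metric_commute[of u])
  ultimately show ?thesis by (simp add: skew_def)
qed

lemma skew_sum: "(\<And>i. i \<in> I \<Longrightarrow> skew (B i)) \<Longrightarrow> skew (\<lambda>w. \<Sum>i\<in>I. c i *\<^sub>R B i w)"
  unfolding skew_def
  by (auto intro!: bounded_linear_sum bounded_linear_compose[OF bounded_linear_scaleR_right]
      simp: metric.sum_left metric.sum_right metric.scaleR_left metric.scaleR_right
      simp flip: sum.distrib distrib_left)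

lemma induced_field_eq:
  "induced_field \<alpha> \<beta> = (field_of (L_field \<alpha> \<beta>) :: ('m::finite, 'n::finite) mfd \<Rightarrow> _)"
proof
  fix z :: "('m, 'n) mfd"
  have "((\<lambda>\<xi>. inverse (norm (fst \<xi>))) has_derivative (\<lambda>v. - (Rep_usphere (fst z) \<bullet> fst v))) (at (embed z))"
  proof (rule has_derivative_compose[OF bounded_linear_imp_has_derivative[OF bounded_linear_fst]])
    show "((\<lambda>x. inverse (norm x)) has_derivative (\<lambda>v. - (Rep_usphere (fst z) \<bullet> v))) (at (fst (embed z)))"
      using has_derivative_inverse_norm[OF Rep_usphere_nz, of "fst z"]
      by (simp only: norm_Rep_usphere fst_embed inverse_1 mult_1_right)
  qed
  from has_derivative_scaleR[OF this has_derivative_ident]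
  have "(Phi has_derivative (\<lambda>v. v - (Rep_usphere (fst z) \<bullet> fst v) *\<^sub>R embed z)) (at (embed z))"
    by (simp add: Phi_def [abs_def])
  then have "fd Phi (embed z) = (\<lambda>v. v - (Rep_usphere (fst z) \<bullet> fst v) *\<^sub>R embed z)"
    by (rule frechet_derivative_at[symmetric])
  then show "induced_field \<alpha> \<beta> z = field_of (L_field \<alpha> \<beta>) z"
    unfolding induced_field_def field_of_def radial_def by (simp only: fst_embed)
qed

text \<open>What linearity of \<open>lie_fun\<close> and \<open>conf_op\<close> in the function
  requires, because \<open>frechet_derivative\<close> is an arbitrary choice where no derivative
  exists.\<close>

definition mdiff :: "(('m::finite, 'n::finite) mfd \<Rightarrow> complex) \<Rightarrow> bool" where
  "mdiff f \<longleftrightarrow> (\<forall>z. mfd_ext f differentiable (at (embed z)))"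

lemma mdiff_has_derivative:
  "mdiff f \<Longrightarrow> (mfd_ext f has_derivative (\<lambda>v. lie_fun (\<lambda>_. v) f z)) (at (embed z))"
  using frechet_derivative_works[of "mfd_ext f" "at (embed z)"] unfolding lie_fun_def mdiff_def by blast

lemma linear_lie_fun: "mdiff f \<Longrightarrow> linear (\<lambda>v. lie_fun (\<lambda>_. v) f z)"
  using mdiff_has_derivative has_derivative_linear by blast

lemma lie_fun_add:
  assumes "mdiff f" "mdiff g"
  shows "lie_fun X (\<lambda>z. f z + g z) z = lie_fun X f z + lie_fun X g z"
  using lie_fun_eqI[of "\<lambda>z. f z + g z" _ z X] has_derivative_add[OF assms[THEN mdiff_has_derivative, of z]]
  by (simp add: mfd_ext_def [abs_def] lie_fun_point[of X f] lie_fun_point[of X g])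

lemma mdiff_add: "mdiff f \<Longrightarrow> mdiff g \<Longrightarrow> mdiff (\<lambda>z. f z + g z)"
  unfolding mdiff_def mfd_ext_def by (auto intro: differentiable_add)

lemma lie_fun_cmult:
  assumes "mdiff f"
  shows "lie_fun X (\<lambda>z. c * f z) z = c * lie_fun X f z"
  using lie_fun_eqI[of "\<lambda>z. c * f z" _ z X] has_derivative_mult_right[OF mdiff_has_derivative[OF assms, of z], of c]
  by (simp add: mfd_ext_def [abs_def] lie_fun_point[of X f])

lemma mdiff_zero: "mdiff (\<lambda>z. 0)"
  by (simp add: mdiff_def mfd_ext_def)

lemma conf_op_add:
  "mdiff f \<Longrightarrow> mdiff g \<Longrightarrow> conf_op a X (\<lambda>z. f z + g z) = (\<lambda>z. conf_op a X f z + conf_op a X g z)"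
  by (auto simp: conf_op_def lie_fun_add algebra_simps)

lemma conf_op_cmult:
  "mdiff f \<Longrightarrow> conf_op a X (\<lambda>z. c * f z) = (\<lambda>z. c * conf_op a X f z)"
  by (auto simp: conf_op_def lie_fun_cmult algebra_simps)

lemma conf_op_zero: "conf_op a X (\<lambda>z. 0) = (\<lambda>z. 0)"
  using conf_op_cmult[OF mdiff_zero, of a X 0] by simp

lemma field_of_sum: "field_of (\<lambda>w. \<Sum>i\<in>I. c i *\<^sub>R B i w) z = (\<Sum>i\<in>I. c i *\<^sub>R field_of (B i) z)"
  by (simp add: field_of_def radial_def fst_sum inner_sum_right scaleR_sum_left sum_subtractf
      scaleR_right_diff_distrib)

text \<open>Linearity in the field is not immediate, as \<open>conformal_factor\<close> is a
  definite description. The combination is rewritten as \<open>field_of\<close> of a single skew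
  map, whose factor is known and linear in that map.\<close>

lemma conf_op_conf_algebra:
  fixes f :: "('m::finite, 'n::finite) mfd \<Rightarrow> complex"
  assumes f: "mdiff f" and C: "CARD('m) \<ge> 2"
  shows "conf_op a (\<lambda>z. \<Sum>\<alpha>\<in>UNIV. \<Sum>\<beta>\<in>UNIV. c \<alpha> \<beta> *\<^sub>R induced_field \<alpha> \<beta> z) f z =
    (\<Sum>\<alpha>\<in>UNIV. \<Sum>\<beta>\<in>UNIV. of_real (c \<alpha> \<beta>) * conf_op a (induced_field \<alpha> \<beta>) f z)"
proof -
  let ?I = "UNIV \<times> UNIV :: (('m + 'n) \<times> ('m + 'n)) set"
  let ?B = "\<lambda>w. \<Sum>i\<in>?I. (case i of (\<alpha>, \<beta>) \<Rightarrow> c \<alpha> \<beta>) *\<^sub>R (case i of (\<alpha>, \<beta>) \<Rightarrow> L_field \<alpha> \<beta> w)"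
  have X: "(\<lambda>z. \<Sum>\<alpha>\<in>UNIV. \<Sum>\<beta>\<in>UNIV. c \<alpha> \<beta> *\<^sub>R induced_field \<alpha> \<beta> z) = field_of ?B"
    unfolding field_of_sum [abs_def]
    by (simp add: sum.cartesian_product induced_field_eq split_beta)
  have sk: "skew ?B" by (rule skew_sum) (auto simp: skew_L_field)
  have lin: "linear (\<lambda>v. lie_fun (\<lambda>_. v) f z)" by (rule linear_lie_fun[OF f])
  have lf: "lie_fun (field_of ?B) f z = (\<Sum>i\<in>?I. (case i of (\<alpha>, \<beta>) \<Rightarrow> c \<alpha> \<beta>) *\<^sub>R lie_fun (case i of (\<alpha>, \<beta>) \<Rightarrow> induced_field \<alpha> \<beta>) f z)"
    unfolding lie_fun_point[of "field_of ?B"] field_of_sum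
    by (subst linear_sum[OF lin], rule sum.cong)
      (auto simp: linear_cmul[OF lin] induced_field_eq lie_fun_point[of "field_of _"])
  have rd: "radial ?B (embed z) = (\<Sum>i\<in>?I. (case i of (\<alpha>, \<beta>) \<Rightarrow> c \<alpha> \<beta>) * (case i of (\<alpha>, \<beta>) \<Rightarrow> radial (L_field \<alpha> \<beta>) (embed z)))"
    by (simp add: radial_def fst_sum inner_sum_right split_beta)
  show ?thesis
    unfolding X conf_op_def conformal_factor_field_of[OF sk C] lf rd unfolding induced_field_eq
      conformal_factor_field_of[OF skew_L_field C]
    by (simp add: sum.cartesian_product split_beta scaleR_conv_of_real sum_distrib_left sum_distrib_right
        sum.distrib algebra_simps sum_subtractf)
qed

section \<open>The conformal fields on pure tensors\<close>

definition tens :: "('m::finite usphere \<Rightarrow> complex) \<Rightarrow> ('n::finite usphere \<Rightarrow> complex) \<Rightarrow> ('m, 'n) mfd \<Rightarrow> complex" where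
  "tens e g = (\<lambda>(x, y). e x * g y)"

lemma has_derivative_tens:
  assumes "smooth_sphere e" "smooth_sphere g"
  shows "(mfd_ext (tens e g) has_derivative (\<lambda>v. e (fst z) * sderiv (snd v) g (snd z) +
    sderiv (fst v) e (fst z) * g (snd z))) (at (embed z))"
proof -
  have 1: "((\<lambda>w. sphere_ext e (fst w)) has_derivative (\<lambda>v. sderiv (fst v) e (fst z))) (at (embed z))"
    by (rule has_derivative_compose[OF bounded_linear_imp_has_derivative[OF bounded_linear_fst]])
      (simp add: sderiv_works[OF assms(1)])
  have 2: "((\<lambda>w. sphere_ext g (snd w)) has_derivative (\<lambda>v. sderiv (snd v) g (snd z))) (at (embed z))"
    by (rule has_derivative_compose[OF bounded_linear_imp_has_derivative[OF bounded_linear_snd]])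
      (simp add: sderiv_works[OF assms(2)])
  have "mfd_ext (tens e g) = (\<lambda>w. sphere_ext e (fst w) * sphere_ext g (snd w))"
    by (simp add: mfd_ext_def [abs_def] tens_def sphere_ext_def)
  then show ?thesis using has_derivative_mult[OF 1 2] by simp
qed

lemma mdiff_tens: "smooth_sphere e \<Longrightarrow> smooth_sphere g \<Longrightarrow> mdiff (tens e g)"
  unfolding mdiff_def using has_derivative_tens differentiable_def by blast

lemma lie_fun_tens:
  assumes "smooth_sphere e" "smooth_sphere g"
  shows "lie_fun X (tens e g) (x, y) = e x * sderiv (snd (X (x, y))) g y + sderiv (fst (X (x, y))) e x * g y"
  using lie_fun_eqI[OF has_derivative_tens[OF assms, of "(x, y)"]] by simp

lemma sc_axis [simp]: "Rep_usphere x $ a = sc (axis a 1) x"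
  by (simp add: sc_def inner_axis)

text \<open>The radial correction in the induced field is invisible to \<open>sderiv\<close>, so the
  derivatives can be taken along \<open>L_field\<close> itself; the correction shows up only in the
  conformal factor.\<close>

lemma conf_op_tens:
  fixes e :: "'m::finite usphere \<Rightarrow> complex" and g :: "'n::finite usphere \<Rightarrow> complex"
  assumes sm: "smooth_sphere e" "smooth_sphere g" and C: "CARD('m) \<ge> 2"
    and L: "L_field \<alpha> \<beta> (Rep_usphere x, Rep_usphere y) = (u, v)"
  shows "conf_op t (induced_field \<alpha> \<beta>) (tens e g) (x, y) =
    sderiv u e x * g y + e x * sderiv v g y - t * of_real (Rep_usphere x \<bullet> u) * (e x * g y)"
proof -
  have E: "embed (x, y) = (Rep_usphere x, Rep_usphere y)" by (simp add: embed_def)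
  have r: "radial (L_field \<alpha> \<beta>) (embed (x, y)) = Rep_usphere x \<bullet> u" by (simp add: radial_def E L)
  have X: "induced_field \<alpha> \<beta> (x, y) =
      (u - (Rep_usphere x \<bullet> u) *\<^sub>R Rep_usphere x, v - (Rep_usphere x \<bullet> u) *\<^sub>R Rep_usphere y)"
    unfolding induced_field_eq field_of_def r by (simp add: E L)
  have shift: "sderiv (w - c *\<^sub>R Rep_usphere x) f x = sderiv w f x"
    if "smooth_sphere f" for w c x and f :: "'k::finite usphere \<Rightarrow> complex"
    using that by (simp add: linear_diff[OF linear_sderiv] linear_cmul[OF linear_sderiv] sderiv_radial)
  show ?thesis
    unfolding conf_op_def lie_fun_tens[OF sm] X fst_conv snd_conv shift[OF sm(1)] shift[OF sm(2)]
    unfolding induced_field_eq conformal_factor_field_of[OF skew_L_field C] r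
    by (simp add: tens_def)
qed

lemma induced_field_antisym: "induced_field \<beta> \<alpha> z = - induced_field \<alpha> \<beta> z"
  by (simp add: induced_field_eq field_of_def radial_def L_field_def algebra_simps)

lemma conf_op_antisym:
  fixes f :: "('m::finite, 'n::finite) mfd \<Rightarrow> complex"
  assumes f: "mdiff f" and C: "CARD('m) \<ge> 2"
  shows "conf_op a (induced_field \<beta> \<alpha>) f z = - conf_op a (induced_field \<alpha> \<beta>) f z"
proof -
  have "radial (L_field \<beta> \<alpha>) (embed z) = - radial (L_field \<alpha> \<beta>) (embed z)"
    by (simp add: radial_def L_field_def inner_diff_right)
  moreover have "lie_fun (induced_field \<beta> \<alpha>) f z = - lie_fun (induced_field \<alpha> \<beta>) f z"
    unfolding lie_fun_point[of "induced_field _ _"] induced_field_antisym[of \<beta> \<alpha>]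
    using linear_neg[OF linear_lie_fun[OF f]] by blast
  ultimately show ?thesis
    by (simp add: conf_op_def induced_field_eq conformal_factor_field_of[OF skew_L_field C] algebra_simps)
qed

lemma conf_op_mixed:
  fixes e :: "'m::finite usphere \<Rightarrow> complex" and g :: "'n::finite usphere \<Rightarrow> complex"
  assumes e: "e \<in> eigenspace p j" and g: "g \<in> eigenspace q k"
    and C: "CARD('m) = p + 1" "CARD('n) = q + 1" "p \<ge> 1" "q \<ge> 1"
  shows "conf_op t (induced_field (Inl a) (Inr b)) (tens e g) =
    (\<lambda>z. \<Sum>i\<in>UNIV. (t - of_real (kap p j (fst i)) - of_real (kap q k (snd i))) *
       tens (ladder p j (fst i) (axis a 1) e) (ladder q k (snd i) (axis b 1) g) z)"
proof
  fix z :: "('m, 'n) mfd"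
  obtain x y where z: "z = (x, y)" by (cases z)
  let ?a = "axis a 1 :: real ^ 'm" and ?b = "axis b 1 :: real ^ 'n"
  have sm: "smooth_sphere e" "smooth_sphere g" and C2: "CARD('m) \<ge> 2" using e g C by auto
  have L: "L_field (Inl a) (Inr b) (Rep_usphere x, Rep_usphere y) = ((- sc ?b y) *\<^sub>R ?a, (- sc ?a x) *\<^sub>R ?b)"
    by (simp add: L_field_def prod_eq_iff)
  have "Rep_usphere x \<bullet> ((- sc ?b y) *\<^sub>R ?a) = - sc ?b y * sc ?a x" by (simp add: sc_def)
  then have "conf_op t (induced_field (Inl a) (Inr b)) (tens e g) z =
      (- sc ?b y *\<^sub>R sderiv ?a e x) * g y + e x * (- sc ?a x *\<^sub>R sderiv ?b g y)
      + t * of_real (sc ?b y * sc ?a x) * (e x * g y)"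
    unfolding z conf_op_tens[OF sm C2 L] linear_cmul[OF linear_sderiv[OF sm(1)]] linear_cmul[OF linear_sderiv[OF sm(2)]]
    by simp
  \<comment> \<open>Each term is now a product of one function on each sphere, a coordinate multiple
    or a derivative, so \<open>ladder_sum\<close> splits both factors.\<close>
  also have "\<dots> = t * (sc ?a x *\<^sub>R e x) * (sc ?b y *\<^sub>R g y) - sderiv ?a e x * (sc ?b y *\<^sub>R g y) - (sc ?a x *\<^sub>R e x) * sderiv ?b g y"
    by (simp add: scaleR_conv_of_real algebra_simps)
  also have "\<dots> = (\<Sum>s\<in>UNIV. \<Sum>s'\<in>UNIV. (t - of_real (kap p j s) - of_real (kap q k s')) *
       tens (ladder p j s ?a e) (ladder q k s' ?b g) z)"
    unfolding ladder_sum[OF e C(1,3)] ladder_sum[OF g C(2,4)] UNIV_bool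
    by (simp add: z tens_def scaleR_conv_of_real algebra_simps)
  finally show "conf_op t (induced_field (Inl a) (Inr b)) (tens e g) z =
      (\<Sum>i\<in>UNIV. (t - of_real (kap p j (fst i)) - of_real (kap q k (snd i))) *
       tens (ladder p j (fst i) ?a e) (ladder q k (snd i) ?b g) z)"
    by (simp only: sum.cartesian_product UNIV_Times_UNIV case_prod_unfold)
qed

lemma conf_op_left:
  fixes e :: "'m::finite usphere \<Rightarrow> complex" and g :: "'n::finite usphere \<Rightarrow> complex"
  assumes sm: "smooth_sphere e" "smooth_sphere g" and C: "CARD('m) \<ge> 2"
  shows "conf_op t (induced_field (Inl a) (Inl c)) (tens e g) =
    tens (\<lambda>x. sc (axis c 1) x *\<^sub>R sderiv (axis a 1) e x - sc (axis a 1) x *\<^sub>R sderiv (axis c 1) e x) g"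
proof
  fix z :: "('m, 'n) mfd"
  obtain x y where z: "z = (x, y)" by (cases z)
  let ?a = "axis a 1 :: real ^ 'm" and ?c = "axis c 1 :: real ^ 'm"
  have L: "L_field (Inl a) (Inl c) (Rep_usphere x, Rep_usphere y) = (sc ?c x *\<^sub>R ?a - sc ?a x *\<^sub>R ?c, 0)"
    by (simp add: L_field_def prod_eq_iff)
  have "Rep_usphere x \<bullet> (sc ?c x *\<^sub>R ?a - sc ?a x *\<^sub>R ?c) = 0" by (simp add: sc_def inner_diff_right)
  then show "conf_op t (induced_field (Inl a) (Inl c)) (tens e g) z =
      tens (\<lambda>x. sc ?c x *\<^sub>R sderiv ?a e x - sc ?a x *\<^sub>R sderiv ?c e x) g z"
    unfolding z conf_op_tens[OF sm C L] linear_diff[OF linear_sderiv[OF sm(1)]] linear_cmul[OF linear_sderiv[OF sm(1)]]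
      linear_0[OF linear_sderiv[OF sm(2)]] by (simp add: tens_def)
qed

lemma conf_op_right:
  fixes e :: "'m::finite usphere \<Rightarrow> complex" and g :: "'n::finite usphere \<Rightarrow> complex"
  assumes sm: "smooth_sphere e" "smooth_sphere g" and C: "CARD('m) \<ge> 2"
  shows "conf_op t (induced_field (Inr a) (Inr c)) (tens e g) =
    tens e (\<lambda>y. sc (axis a 1) y *\<^sub>R sderiv (axis c 1) g y - sc (axis c 1) y *\<^sub>R sderiv (axis a 1) g y)"
proof
  fix z :: "('m, 'n) mfd"
  obtain x y where z: "z = (x, y)" by (cases z)
  let ?a = "axis a 1 :: real ^ 'n" and ?c = "axis c 1 :: real ^ 'n"
  have L: "L_field (Inr a) (Inr c) (Rep_usphere x, Rep_usphere y) = (0, sc ?a y *\<^sub>R ?c - sc ?c y *\<^sub>R ?a)"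
    by (simp add: L_field_def prod_eq_iff)
  show "conf_op t (induced_field (Inr a) (Inr c)) (tens e g) z =
      tens e (\<lambda>y. sc ?a y *\<^sub>R sderiv ?c g y - sc ?c y *\<^sub>R sderiv ?a g y) z"
    unfolding z conf_op_tens[OF sm C L] linear_diff[OF linear_sderiv[OF sm(2)]] linear_cmul[OF linear_sderiv[OF sm(2)]]
      linear_0[OF linear_sderiv[OF sm(1)]] by (simp add: tens_def)
qed

section \<open>Intertwinors and recurrences\<close>

text \<open>Cross-multiplied, because either coefficient may vanish for special \<open>r\<close>. In
  the second family both pairs lie on the level \<open>j + k + 1\<close>, whence the parity
  condition on \<open>Suc (j + k)\<close>.\<close>

definition recur :: "nat \<Rightarrow> nat \<Rightarrow> nat \<Rightarrow> complex \<Rightarrow> (nat \<Rightarrow> nat \<Rightarrow> complex) \<Rightarrow> bool" where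
  "recur p q \<epsilon> r \<mu> \<longleftrightarrow>
    (\<forall>j k. (j + k) mod 2 = \<epsilon> \<longrightarrow>
      \<mu> (Suc j) (Suc k) * (of_nat j + of_nat k + of_nat (p + q) / 2 - r) =
      \<mu> j k * (of_nat j + of_nat k + of_nat (p + q) / 2 + r)) \<and>
    (\<forall>j k. Suc (j + k) mod 2 = \<epsilon> \<longrightarrow>
      \<mu> (Suc j) k * (of_nat k - of_nat j - (of_nat p - of_nat q) / 2 + r) =
      \<mu> j (Suc k) * (of_nat k - of_nat j - (of_nat p - of_nat q) / 2 - r))"

definition step_rel :: "nat \<Rightarrow> nat \<Rightarrow> complex \<Rightarrow> (nat \<Rightarrow> nat \<Rightarrow> complex) \<Rightarrow> bool \<Rightarrow> bool \<Rightarrow> nat \<Rightarrow> nat \<Rightarrow> bool" where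
  "step_rel p q r \<mu> s s' j k \<longleftrightarrow>
     \<mu> (shift s j) (shift s' k) * (of_nat (p + q) / 2 - r - of_real (kap p j s) - of_real (kap q k s')) =
     \<mu> j k * (of_nat (p + q) / 2 + r - of_real (kap p j s) - of_real (kap q k s'))"

lemma mult_neg_swap: "a * - b = c * - d \<longleftrightarrow> a * b = c * (d :: complex)"
  by auto

text \<open>Reversing a ladder step exchanges the two coefficients up to a common sign, so the four
  directions yield two different relations. The guards exclude steps that leave the
  quadrant.\<close>

lemma recur_iff_step_rel:
  "recur p q \<epsilon> r \<mu> \<longleftrightarrow> (\<forall>s s' j k. (j + k) mod 2 = \<epsilon> \<longrightarrow> (s \<or> j \<ge> 1) \<longrightarrow> (s' \<or> k \<ge> 1) \<longrightarrow> step_rel p q r \<mu> s s' j k)"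
  (is "_ \<longleftrightarrow> ?S")
proof -
  let ?h = "of_nat (p + q) / 2 :: complex" and ?d = "(of_nat p - of_nat q) / 2 :: complex"
  let ?R1 = "\<lambda>j k. \<mu> (Suc j) (Suc k) * (of_nat j + of_nat k + ?h - r) = \<mu> j k * (of_nat j + of_nat k + ?h + r)"
  let ?R2 = "\<lambda>j k. \<mu> (Suc j) k * (of_nat k - of_nat j - ?d + r) = \<mu> j (Suc k) * (of_nat k - of_nat j - ?d - r)"
  have TT: "step_rel p q r \<mu> True True j k \<longleftrightarrow> ?R1 j k" for j k
    by (simp add: step_rel_def kap_def shift_def algebra_simps)
  have FF: "step_rel p q r \<mu> False False (Suc j) (Suc k) \<longleftrightarrow> ?R1 j k" for j k
  proof -
    have "?h - r - of_real (kap p (Suc j) False) - of_real (kap q (Suc k) False) = - (of_nat j + of_nat k + ?h + r)"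
      "?h + r - of_real (kap p (Suc j) False) - of_real (kap q (Suc k) False) = - (of_nat j + of_nat k + ?h - r)"
      by (simp_all add: kap_def field_simps)
    then show ?thesis unfolding step_rel_def by (simp only: mult_neg_swap) (auto simp: shift_def)
  qed
  have TF: "step_rel p q r \<mu> True False j (Suc k) \<longleftrightarrow> ?R2 j k" for j k
  proof -
    have "?h - r - of_real (kap p j True) - of_real (kap q (Suc k) False) = - (of_nat k - of_nat j - ?d + r)"
      "?h + r - of_real (kap p j True) - of_real (kap q (Suc k) False) = - (of_nat k - of_nat j - ?d - r)"
      by (simp_all add: kap_def field_simps)
    then show ?thesis unfolding step_rel_def by (simp only: mult_neg_swap) (auto simp: shift_def)
  qed
  have FT: "step_rel p q r \<mu> False True (Suc j) k \<longleftrightarrow> ?R2 j k" for j k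
  proof -
    have E: "?h - r - of_real (kap p (Suc j) False) - of_real (kap q k True) = of_nat k - of_nat j - ?d - r"
      "?h + r - of_real (kap p (Suc j) False) - of_real (kap q k True) = of_nat k - of_nat j - ?d + r"
      by (simp_all add: kap_def field_simps)
    show ?thesis unfolding step_rel_def E by (auto simp: shift_def)
  qed
  have par: "Suc (Suc n) mod 2 = n mod 2" for n :: nat by presburger
  show ?thesis
  proof
    assume R: "recur p q \<epsilon> r \<mu>"
    show ?S
    proof (intro allI impI)
      fix s s' j k assume *: "(j + k) mod 2 = \<epsilon>" "s \<or> j \<ge> 1" "s' \<or> k \<ge> (1::nat)"
      consider "s" "s'" | j' k' where "\<not> s" "\<not> s'" "j = Suc j'" "k = Suc k'"
        | k' where "s" "\<not> s'" "k = Suc k'" | j' where "\<not> s" "s'" "j = Suc j'"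
        using * by (metis Suc_le_D One_nat_def)
      then show "step_rel p q r \<mu> s s' j k"
        by cases (use R *(1) in \<open>auto simp: recur_def TT FF TF FT par\<close>)
    qed
  next
    assume S: ?S
    show "recur p q \<epsilon> r \<mu>"
      unfolding recur_def TT[symmetric] TF[symmetric] using S by auto
  qed
qed

section \<open>Finite decompositions into the spaces V(j,k)\<close>

lemma V_space_iff: "f \<in> V_space p q j k \<longleftrightarrow> (\<exists>(N::nat) e g.
     (\<forall>i<N. e i \<in> eigenspace p j \<and> g i \<in> eigenspace q k) \<and> f = (\<lambda>z. \<Sum>i<N. tens (e i) (g i) z))"
proof -
  have eq: "(\<lambda>(x, y). \<Sum>i<N. e i x * g i y) = (\<lambda>z. \<Sum>i<N. tens (e i) (g i) z)"
    for N :: nat and e :: "nat \<Rightarrow> 'a usphere \<Rightarrow> complex" and g :: "nat \<Rightarrow> 'b usphere \<Rightarrow> complex"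
    by (auto simp: tens_def)
  show ?thesis unfolding V_space_def mem_Collect_eq eq ..
qed

lemma V_space_zero [simp, intro]: "(\<lambda>z. 0) \<in> V_space p q j k"
  unfolding V_space_iff by (rule exI[of _ 0]) auto

lemma V_space_tens [intro]:
  "e \<in> eigenspace p j \<Longrightarrow> g \<in> eigenspace q k \<Longrightarrow> tens e g \<in> V_space p q j k"
  unfolding V_space_iff by (rule exI[of _ 1], rule exI[of _ "\<lambda>_. e"], rule exI[of _ "\<lambda>_. g"]) auto

lemma sum_lessThan_add: "(\<Sum>i<N + N'. h i) = (\<Sum>i<N. h i) + (\<Sum>i<N'. h (N + i :: nat) :: 'a::comm_monoid_add)"
  by (induction N') (auto simp: add.assoc)

lemma V_space_add [intro]:
  assumes "f \<in> V_space p q j k" "f' \<in> V_space p q j k"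
  shows "(\<lambda>z. f z + f' z) \<in> V_space p q j k"
proof -
  obtain N :: nat and e g where 1: "\<And>i. i < N \<Longrightarrow> e i \<in> eigenspace p j \<and> g i \<in> eigenspace q k"
    "f = (\<lambda>z. \<Sum>i<N. tens (e i) (g i) z)" using assms(1) unfolding V_space_iff by blast
  obtain N' :: nat and e' g' where 2: "\<And>i. i < N' \<Longrightarrow> e' i \<in> eigenspace p j \<and> g' i \<in> eigenspace q k"
    "f' = (\<lambda>z. \<Sum>i<N'. tens (e' i) (g' i) z)" using assms(2) unfolding V_space_iff by blast
  show ?thesis
    unfolding V_space_iff
    by (rule exI[of _ "N + N'"], rule exI[of _ "\<lambda>i. if i < N then e i else e' (i - N)"],
        rule exI[of _ "\<lambda>i. if i < N then g i else g' (i - N)"])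
      (use 1 2 in \<open>auto simp: sum_lessThan_add\<close>)
qed

lemma V_space_induct [consumes 1, case_names zero tens add]:
  assumes f: "f \<in> V_space p q j k" and 0: "P (\<lambda>z. 0)"
    and t: "\<And>e g. e \<in> eigenspace p j \<Longrightarrow> g \<in> eigenspace q k \<Longrightarrow> P (tens e g)"
    and a: "\<And>f f'. f \<in> V_space p q j k \<Longrightarrow> f' \<in> V_space p q j k \<Longrightarrow> P f \<Longrightarrow> P f' \<Longrightarrow> P (\<lambda>z. f z + f' z)"
  shows "P f"
proof -
  obtain N :: nat and e g where 1: "\<And>i. i < N \<Longrightarrow> e i \<in> eigenspace p j \<and> g i \<in> eigenspace q k"
    and f: "f = (\<lambda>z. \<Sum>i<N. tens (e i) (g i) z)" using f unfolding V_space_iff by blast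
  have "(\<lambda>z. \<Sum>i<M. tens (e i) (g i) z) \<in> V_space p q j k \<and> P (\<lambda>z. \<Sum>i<M. tens (e i) (g i) z)" if "M \<le> N" for M
    using that
  proof (induction M)
    case 0
    then show ?case using \<open>P (\<lambda>z. 0)\<close> by simp
  next
    case (Suc M)
    then show ?case using 1[of M] a[of "\<lambda>z. \<Sum>i<M. tens (e i) (g i) z" "tens (e M) (g M)"] t by auto
  qed
  then show ?thesis using f by blast
qed

lemma tens_cmult: "(\<lambda>z. c * tens e g z) = tens (\<lambda>x. c * e x) g"
  by (auto simp: tens_def)

lemma V_space_cmult [intro]:
  assumes "f \<in> V_space p q j k" shows "(\<lambda>z. c * f z) \<in> V_space p q j k"
  using assms by (induction rule: V_space_induct) (auto simp: tens_cmult distrib_left)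

lemma V_space_slice:
  assumes "f \<in> V_space p q j k"
  shows "(\<lambda>x. f (x, y)) \<in> eigenspace p j" "(\<lambda>y. f (x, y)) \<in> eigenspace q k"
proof -
  show "(\<lambda>x. f (x, y)) \<in> eigenspace p j"
    using assms
  proof (induction rule: V_space_induct)
    case (tens e g)
    then show ?case using eigenspace_cmult[of e p j "g y"] by (simp add: tens_def mult.commute)
  qed auto
  show "(\<lambda>y. f (x, y)) \<in> eigenspace q k"
    using assms by (induction rule: V_space_induct) (auto simp: tens_def)
qed

text \<open>Freezing one variable reduces the claim to the independence of eigenspaces, first on one
  sphere and then on the other.\<close>

lemma V_space_independent:
  assumes p: "p \<ge> 1" "q \<ge> 1" and g: "\<And>j k. g j k \<in> V_space p q j k"
    and z: "\<And>z. (\<Sum>j\<le>N. \<Sum>k\<le>N. g j k z) = 0" and "j \<le> N" "k \<le> N"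
  shows "g j k w = 0"
proof -
  obtain x y where w: "w = (x, y)" by (cases w)
  have "(\<Sum>k\<le>N. g j k (x, y)) = 0" if "j \<le> N" for j x y
    by (rule eigenspace_independent[OF p(1), of "{..N}" "\<lambda>j x. \<Sum>k\<le>N. g j k (x, y)"])
      (use z that in \<open>auto intro: V_space_slice(1)[OF g]\<close>)
  then show ?thesis
    unfolding w using assms(5-)
    by (intro eigenspace_independent[OF p(2), of "{..N}" "\<lambda>k y. g j k (x, y)"])
      (auto intro: V_space_slice(2)[OF g])
qed

text \<open>Components outside the square or of the wrong parity are forced to be zero. Thus
  \<open>N\<close> can be enlarged without changing \<open>g\<close>, and \<open>g\<close> is
  determined by \<open>f\<close>.\<close>

definition dec :: "nat \<Rightarrow> nat \<Rightarrow> nat \<Rightarrow> nat \<Rightarrow> (nat \<Rightarrow> nat \<Rightarrow> ('m::finite, 'n::finite) mfd \<Rightarrow> complex) \<Rightarrow>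
    (('m, 'n) mfd \<Rightarrow> complex) \<Rightarrow> bool" where
  "dec p q \<epsilon> N g f \<longleftrightarrow> (\<forall>j k. g j k \<in> V_space p q j k) \<and>
    (\<forall>j k. \<not> (j \<le> N \<and> k \<le> N \<and> (j + k) mod 2 = \<epsilon>) \<longrightarrow> g j k = (\<lambda>z. 0)) \<and>
    f = (\<lambda>z. \<Sum>j\<le>N. \<Sum>k\<le>N. g j k z)"

lemma dec_zero:
  assumes "dec p q \<epsilon> N g f" "\<not> (j \<le> N \<and> k \<le> N \<and> (j + k) mod 2 = \<epsilon>)"
  shows "g j k = (\<lambda>z. 0)"
  using assms unfolding dec_def by blast

lemma E_space_iff: "f \<in> E_space p q \<epsilon> \<longleftrightarrow> (\<exists>N g. dec p q \<epsilon> N g f)"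
proof
  assume "f \<in> E_space p q \<epsilon>"
  then obtain N :: nat and g where g: "\<And>j k. g j k \<in> V_space p q j k"
    and f: "f = (\<lambda>z. \<Sum>(j, k) \<in> {(j, k). j \<le> N \<and> k \<le> N \<and> (j + k) mod 2 = \<epsilon>}. g j k z)"
    unfolding E_space_def by blast
  let ?g = "\<lambda>j k. if j \<le> N \<and> k \<le> N \<and> (j + k) mod 2 = \<epsilon> then g j k else (\<lambda>z. 0)"
  have "f z = (\<Sum>j\<le>N. \<Sum>k\<le>N. ?g j k z)" for z
    unfolding f sum.cartesian_product by (rule sum.mono_neutral_cong_left) (auto split: if_splits)
  then have "dec p q \<epsilon> N ?g f" using g unfolding dec_def by auto
  then show "\<exists>N g. dec p q \<epsilon> N g f" by blast
next
  assume "\<exists>N g. dec p q \<epsilon> N g f"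
  then obtain N g where g: "dec p q \<epsilon> N g f" by blast
  have "f z = (\<Sum>(j, k) \<in> {(j, k). j \<le> N \<and> k \<le> N \<and> (j + k) mod 2 = \<epsilon>}. g j k z)" for z
  proof -
    have "f z = (\<Sum>j\<le>N. \<Sum>k\<le>N. g j k z)" using g unfolding dec_def by blast
    also have "\<dots> = (\<Sum>(j, k) \<in> {(j, k). j \<le> N \<and> k \<le> N \<and> (j + k) mod 2 = \<epsilon>}. g j k z)"
      unfolding sum.cartesian_product
    proof (rule sum.mono_neutral_right)
      show "\<forall>i\<in>{..N} \<times> {..N} - {(j, k). j \<le> N \<and> k \<le> N \<and> (j + k) mod 2 = \<epsilon>}. (case i of (j, k) \<Rightarrow> g j k z) = 0"
      proof
        fix i assume "i \<in> {..N} \<times> {..N} - {(j, k). j \<le> N \<and> k \<le> N \<and> (j + k) mod 2 = \<epsilon>}"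
        then have "g (fst i) (snd i) = (\<lambda>z. 0)" by (intro dec_zero[OF g]) (cases i, simp)
        then show "(case i of (j, k) \<Rightarrow> g j k z) = 0" by (simp add: split_beta)
      qed
    qed auto
    finally show ?thesis .
  qed
  then show "f \<in> E_space p q \<epsilon>" using g unfolding E_space_def dec_def by blast
qed

lemma sum_delta2:
  assumes "finite A" "finite B" "a \<in> A" "b \<in> B"
  shows "(\<Sum>i\<in>A. \<Sum>k\<in>B. if i = a \<and> k = b then h i k else 0) = (h a b :: 'a::comm_monoid_add)"
proof -
  have "(\<Sum>k\<in>B. if i = a \<and> k = b then h i k else 0) = (if i = a then h a b else 0)" for i
    using assms by (cases "i = a") auto
  then show ?thesis using assms by simp
qed

lemma sum_zero_extend:
  fixes N M :: nat
  assumes "N \<le> M" "\<And>j k. \<not> (j \<le> N \<and> k \<le> N) \<Longrightarrow> h j k = (0::complex)"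
  shows "(\<Sum>j\<le>M. \<Sum>k\<le>M. h j k) = (\<Sum>j\<le>N. \<Sum>k\<le>N. h j k)"
  unfolding sum.cartesian_product
proof (rule sum.mono_neutral_right)
  show "\<forall>i\<in>{..M} \<times> {..M} - {..N} \<times> {..N}. (case i of (j, k) \<Rightarrow> h j k) = 0"
    using assms(2) by force
qed (use assms(1) in auto)

lemma dec_mono:
  assumes "dec p q \<epsilon> N g f" "N \<le> M" shows "dec p q \<epsilon> M g f"
proof -
  have "(\<Sum>j\<le>M. \<Sum>k\<le>M. g j k z) = (\<Sum>j\<le>N. \<Sum>k\<le>N. g j k z)" for z
    by (rule sum_zero_extend[OF assms(2)]) (auto simp: dec_zero[OF assms(1)])
  then show ?thesis using assms unfolding dec_def by auto
qed

lemma dec_add: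
  assumes "dec p q \<epsilon> N g f" "dec p q \<epsilon> N g' f'"
  shows "dec p q \<epsilon> N (\<lambda>j k z. g j k z + g' j k z) (\<lambda>z. f z + f' z)"
  using assms unfolding dec_def by (auto simp: sum.distrib)

lemma dec_cmult:
  assumes "dec p q \<epsilon> N g f"
  shows "dec p q \<epsilon> N (\<lambda>j k z. c * g j k z) (\<lambda>z. c * f z)"
  using assms unfolding dec_def by (auto simp: sum_distrib_left)

lemma dec_weight:
  assumes "dec p q \<epsilon> N g f"
  shows "dec p q \<epsilon> N (\<lambda>j k z. \<mu> j k * g j k z) (\<lambda>z. \<Sum>j\<le>N. \<Sum>k\<le>N. \<mu> j k * g j k z)"
  using assms unfolding dec_def by auto

lemma dec_unique:
  assumes p: "p \<ge> 1" "q \<ge> 1" and 1: "dec p q \<epsilon> N g f" and 2: "dec p q \<epsilon> M g' f"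
  shows "g = g'"
proof (intro ext)
  fix j k z
  let ?L = "max (max N M) (max j k)"
  have d: "dec p q \<epsilon> ?L g f" "dec p q \<epsilon> ?L g' f"
    by (rule dec_mono[OF 1], simp) (rule dec_mono[OF 2], simp)
  have D: "dec p q \<epsilon> ?L (\<lambda>j k z. g j k z + (-1) * g' j k z) (\<lambda>z. f z + (-1) * f z)"
    by (rule dec_add[OF d(1) dec_cmult[OF d(2)]])
  have "(\<lambda>j k z. g j k z + (-1) * g' j k z) j k z = 0"
  proof (rule V_space_independent[OF p])
    show "(\<lambda>z. g j k z + (-1) * g' j k z) \<in> V_space p q j k" for j k
      using D unfolding dec_def by blast
    have "(\<lambda>z. f z + (-1) * f z) = (\<lambda>z. \<Sum>j\<le>?L. \<Sum>k\<le>?L. g j k z + (-1) * g' j k z)"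
      using D unfolding dec_def by blast
    note eq = fun_cong[OF this]
    show "(\<Sum>j\<le>?L. \<Sum>k\<le>?L. g j k z + (-1) * g' j k z) = 0" for z
      by (rule trans[OF eq[symmetric]]) simp
  qed auto
  then show "g j k z = g' j k z" by simp
qed

lemma E_space_add:
  assumes "f \<in> E_space p q \<epsilon>" "f' \<in> E_space p q \<epsilon>"
  shows "(\<lambda>z. f z + f' z) \<in> E_space p q \<epsilon>"
proof -
  obtain N g N' g' where d: "dec p q \<epsilon> N g f" "dec p q \<epsilon> N' g' f'"
    using assms unfolding E_space_iff by blast
  show ?thesis
    unfolding E_space_iff
    using dec_add[OF dec_mono[OF d(1) max.cobounded1[of N N']] dec_mono[OF d(2) max.cobounded2[of N' N]]] by blast
qed

lemma E_space_cmult: "f \<in> E_space p q \<epsilon> \<Longrightarrow> (\<lambda>z. c * f z) \<in> E_space p q \<epsilon>"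
  unfolding E_space_iff using dec_cmult by blast

lemma E_space_zero: "(\<lambda>z. 0) \<in> E_space p q \<epsilon>"
  unfolding E_space_iff dec_def by (rule exI[of _ 0], rule exI[of _ "\<lambda>j k z. 0"]) auto

lemma dec_single:
  assumes "f \<in> V_space p q j k" "(j + k) mod 2 = \<epsilon>"
  shows "dec p q \<epsilon> (max j k) (\<lambda>j' k'. if j' = j \<and> k' = k then f else (\<lambda>z. 0)) f"
proof -
  have "(if j' = j \<and> k' = k then f else (\<lambda>z. 0)) z = (if j' = j \<and> k' = k then f z else 0)" for j' k' z
    by simp
  then have "(\<Sum>j'\<le>max j k. \<Sum>k'\<le>max j k. (if j' = j \<and> k' = k then f else (\<lambda>z. 0)) z) = f z" for z
    by (simp only: sum_delta2 finite_atMost atMost_iff max.cobounded1 max.cobounded2)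
  then show ?thesis using assms unfolding dec_def by auto
qed

lemma V_space_subset: "f \<in> V_space p q j k \<Longrightarrow> (j + k) mod 2 = \<epsilon> \<Longrightarrow> f \<in> E_space p q \<epsilon>"
  unfolding E_space_iff using dec_single by blast

lemma E_space_sum: "(\<And>i. i \<in> I \<Longrightarrow> f i \<in> E_space p q \<epsilon>) \<Longrightarrow> (\<lambda>z. \<Sum>i\<in>I. f i z) \<in> E_space p q \<epsilon>"
  by (induction I rule: infinite_finite_induct) (auto intro: E_space_zero E_space_add)

lemma E_space_induct [consumes 1, case_names zero tens add]:
  assumes f: "f \<in> E_space p q \<epsilon>" and 0: "P (\<lambda>z. 0)"
    and t: "\<And>e g j k. e \<in> eigenspace p j \<Longrightarrow> g \<in> eigenspace q k \<Longrightarrow> (j + k) mod 2 = \<epsilon> \<Longrightarrow> P (tens e g)"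
    and a: "\<And>f f'. f \<in> E_space p q \<epsilon> \<Longrightarrow> f' \<in> E_space p q \<epsilon> \<Longrightarrow> P f \<Longrightarrow> P f' \<Longrightarrow> P (\<lambda>z. f z + f' z)"
  shows "P f"
proof -
  obtain N g where g: "dec p q \<epsilon> N g f" using f unfolding E_space_iff by blast
  have V: "h \<in> E_space p q \<epsilon> \<and> P h" if "h \<in> V_space p q j k" "(j + k) mod 2 = \<epsilon>" for h j k
    using that(1) by (induction rule: V_space_induct)
      (use that(2) in \<open>auto intro: 0 t a E_space_zero E_space_add V_space_subset\<close>)
  have one: "g j k \<in> E_space p q \<epsilon> \<and> P (g j k)" for j k
  proof (cases "(j + k) mod 2 = \<epsilon>")
    case True
    then show ?thesis using V g unfolding dec_def by blast
  next
    case False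
    then have "g j k = (\<lambda>z. 0)" using g unfolding dec_def by blast
    then show ?thesis using 0 E_space_zero by simp
  qed
  have sums: "(\<lambda>z. \<Sum>i\<in>I. h i z) \<in> E_space p q \<epsilon> \<and> P (\<lambda>z. \<Sum>i\<in>I. h i z)"
    if "finite I" "\<And>i. i \<in> I \<Longrightarrow> h i \<in> E_space p q \<epsilon> \<and> P (h i)" for I :: "nat set" and h
    using that by (induction I rule: finite_induct) (auto intro: 0 a E_space_zero E_space_add)
  have "P (\<lambda>z. \<Sum>j\<le>N. \<Sum>k\<le>N. g j k z)"
    using sums[of "{..N}" "\<lambda>j z. \<Sum>k\<le>N. g j k z"] sums[of "{..N}" "g _"] one by auto
  then show ?thesis using g unfolding dec_def by blast
qed

section \<open>Operators acting by a prescribed scalar on each V(j,k)\<close>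

definition mult_op :: "nat \<Rightarrow> nat \<Rightarrow> nat \<Rightarrow> (nat \<Rightarrow> nat \<Rightarrow> complex) \<Rightarrow>
    (('m::finite, 'n::finite) mfd \<Rightarrow> complex) \<Rightarrow> ('m, 'n) mfd \<Rightarrow> complex" where
  "mult_op p q \<epsilon> \<mu> f = (SOME h. \<exists>N g. dec p q \<epsilon> N g f \<and> h = (\<lambda>z. \<Sum>j\<le>N. \<Sum>k\<le>N. \<mu> j k * g j k z))"

context
  fixes p q :: nat
  assumes p: "p \<ge> 1" and q: "q \<ge> 1"
begin

text \<open>The choice in \<open>mult_op\<close> is immaterial: the components are unique by
  \<open>dec_unique\<close>, and two bounds are compared at their maximum.\<close>

lemma mult_op_dec:
  assumes d: "dec p q \<epsilon> N g f"
  shows "mult_op p q \<epsilon> \<mu> f = (\<lambda>z. \<Sum>j\<le>N. \<Sum>k\<le>N. \<mu> j k * g j k z)"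
proof -
  let ?P = "\<lambda>h. \<exists>N g. dec p q \<epsilon> N g f \<and> h = (\<lambda>z. \<Sum>j\<le>N. \<Sum>k\<le>N. \<mu> j k * g j k z)"
  have "?P (\<lambda>z. \<Sum>j\<le>N. \<Sum>k\<le>N. \<mu> j k * g j k z)" using d by blast
  then have "?P (mult_op p q \<epsilon> \<mu> f)" unfolding mult_op_def by (rule someI[of ?P])
  then obtain M g' where g': "dec p q \<epsilon> M g' f" "mult_op p q \<epsilon> \<mu> f = (\<lambda>z. \<Sum>j\<le>M. \<Sum>k\<le>M. \<mu> j k * g' j k z)" by blast
  have "g' = g" using dec_unique[OF p q g'(1) d] .
  with dec_mono[OF dec_weight[OF g'(1), of \<mu>] max.cobounded1[of M N]]
    dec_mono[OF dec_weight[OF d, of \<mu>] max.cobounded2[of N M]]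
  show ?thesis unfolding dec_def g'(2) by simp
qed

lemma mult_op_in: "f \<in> E_space p q \<epsilon> \<Longrightarrow> mult_op p q \<epsilon> \<mu> f \<in> E_space p q \<epsilon>"
proof -
  assume "f \<in> E_space p q \<epsilon>"
  then obtain N g where d: "dec p q \<epsilon> N g f" unfolding E_space_iff by blast
  show ?thesis unfolding E_space_iff mult_op_dec[OF d] using dec_weight[OF d] by blast
qed

lemma mult_op_add:
  assumes "f \<in> E_space p q \<epsilon>" "f' \<in> E_space p q \<epsilon>"
  shows "mult_op p q \<epsilon> \<mu> (\<lambda>z. f z + f' z) = (\<lambda>z. mult_op p q \<epsilon> \<mu> f z + mult_op p q \<epsilon> \<mu> f' z)"
proof -
  obtain N g N' g' where "dec p q \<epsilon> N g f" "dec p q \<epsilon> N' g' f'" using assms unfolding E_space_iff by blast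
  then have d: "dec p q \<epsilon> (max N N') g f" "dec p q \<epsilon> (max N N') g' f'"
    using dec_mono max.cobounded1 max.cobounded2 by blast+
  show ?thesis
    unfolding mult_op_dec[OF d(1)] mult_op_dec[OF d(2)] mult_op_dec[OF dec_add[OF d]]
    by (simp add: sum.distrib algebra_simps)
qed

lemma mult_op_cmult:
  assumes "f \<in> E_space p q \<epsilon>"
  shows "mult_op p q \<epsilon> \<mu> (\<lambda>z. c * f z) = (\<lambda>z. c * mult_op p q \<epsilon> \<mu> f z)"
proof -
  obtain N g where d: "dec p q \<epsilon> N g f" using assms unfolding E_space_iff by blast
  show ?thesis
    unfolding mult_op_dec[OF d] mult_op_dec[OF dec_cmult[OF d]]
    by (simp add: sum_distrib_left algebra_simps)
qed

lemma mult_op_V: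
  assumes "f \<in> V_space p q j k" "(j + k) mod 2 = \<epsilon>"
  shows "mult_op p q \<epsilon> \<mu> f = (\<lambda>z. \<mu> j k * f z)"
proof -
  have "\<mu> j' k' * (if j' = j \<and> k' = k then f else (\<lambda>z. 0)) z = (if j' = j \<and> k' = k then \<mu> j k * f z else 0)" for j' k' z
    by simp
  then have "(\<Sum>j'\<le>max j k. \<Sum>k'\<le>max j k. \<mu> j' k' * (if j' = j \<and> k' = k then f else (\<lambda>z. 0)) z) = \<mu> j k * f z" for z
    by (simp only: sum_delta2 finite_atMost atMost_iff max.cobounded1 max.cobounded2)
  then show ?thesis using mult_op_dec[OF dec_single[OF assms], of \<mu>] by (simp only:)
qed

lemma mult_op_zero: "mult_op p q \<epsilon> \<mu> (\<lambda>z. 0) = (\<lambda>z. 0)"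
  using mult_op_cmult[OF E_space_zero, of \<epsilon> \<mu> 0] by simp

lemma mult_op_sum:
  "finite I \<Longrightarrow> (\<And>i. i \<in> I \<Longrightarrow> f i \<in> E_space p q \<epsilon>) \<Longrightarrow>
    mult_op p q \<epsilon> \<mu> (\<lambda>z. \<Sum>i\<in>I. f i z) = (\<lambda>z. \<Sum>i\<in>I. mult_op p q \<epsilon> \<mu> (f i) z)"
proof (induction I rule: finite_induct)
  case empty
  then show ?case by (simp add: mult_op_zero)
next
  case (insert i I)
  then show ?case using mult_op_add[of "f i" \<epsilon> "\<lambda>z. \<Sum>i\<in>I. f i z" \<mu>] by (simp add: E_space_sum)
qed

end

section \<open>Intertwining relations of these operators and the recurrences\<close>

lemma E_space_mdiff:
  assumes "f \<in> E_space p q \<epsilon>" shows "mdiff f"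
  using assms by (induction rule: E_space_induct) (auto intro: mdiff_zero mdiff_tens mdiff_add)

lemma rot_act_tens:
  "rot_act R S (tens e g) = tens (rotated (matrix_inv R) e) (rotated (matrix_inv S) g)"
  by (auto simp: rot_act_def tens_def rotated_def)

lemma rot_act_V:
  assumes "f \<in> V_space p q j k" "orthogonal_matrix (matrix_inv R)" "orthogonal_matrix (matrix_inv S)"
  shows "rot_act R S f \<in> V_space p q j k"
  using assms(1)
proof (induction rule: V_space_induct)
  case zero
  then show ?case by (simp add: rot_act_def [abs_def])
next
  case (tens e g)
  then show ?case using assms by (auto simp: rot_act_tens eigenspace_rotated)
next
  case (add f f')
  then show ?case using V_space_add by (auto simp: rot_act_def [abs_def])
qed

lemma dec_rot_act:
  assumes "dec p q \<epsilon> N g f" "orthogonal_matrix (matrix_inv R)" "orthogonal_matrix (matrix_inv S)"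
  shows "dec p q \<epsilon> N (\<lambda>j k. rot_act R S (g j k)) (rot_act R S f)"
  unfolding dec_def
proof (intro conjI allI impI)
  show "rot_act R S (g j k) \<in> V_space p q j k" for j k
    using assms rot_act_V unfolding dec_def by blast
  show "rot_act R S (g j k) = (\<lambda>z. 0)" if "\<not> (j \<le> N \<and> k \<le> N \<and> (j + k) mod 2 = \<epsilon>)" for j k
  proof -
    have "g j k = (\<lambda>z. 0)" using assms(1) that unfolding dec_def by blast
    then show ?thesis by (simp add: rot_act_def [abs_def])
  qed
  have "f = (\<lambda>z. \<Sum>j\<le>N. \<Sum>k\<le>N. g j k z)" using assms(1) unfolding dec_def by blast
  then show "rot_act R S f = (\<lambda>z. \<Sum>j\<le>N. \<Sum>k\<le>N. rot_act R S (g j k) z)"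
    by (simp add: rot_act_def [abs_def])
qed

lemma orthogonal_matrix_inv:
  fixes R :: "real ^ 'm ^ ('m::finite)"
  assumes "rotation_matrix R" shows "orthogonal_matrix (matrix_inv R)"
proof -
  have o: "orthogonal_matrix R" using assms by (simp add: rotation_matrix_def)
  then have "\<exists>A'. R ** A' = mat 1 \<and> A' ** R = mat 1" unfolding orthogonal_matrix_def by blast
  then have "matrix_inv R ** R = mat 1" unfolding matrix_inv_def by (rule someI2_ex) simp
  then have "matrix_inv R ** (R ** transpose R) = transpose R"
    by (metis matrix_mul_assoc matrix_mul_lid)
  then have "matrix_inv R = transpose R"
    using o by (simp add: orthogonal_matrix_def)
  then show ?thesis using o by simp
qed

context
  fixes p q \<epsilon> :: nat
  assumes C: "CARD('m::finite) = p + 1" "CARD('n::finite) = q + 1" and pq: "p \<ge> 1" "q \<ge> 1"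
begin

text \<open>A step out of the quadrant is detected by the zero function rather than by the degree,
  so the truncated value of \<open>shift\<close> never matters.\<close>

lemma tens_ladder:
  fixes e :: "'m usphere \<Rightarrow> complex" and g :: "'n usphere \<Rightarrow> complex"
  assumes e: "e \<in> eigenspace p j" and g: "g \<in> eigenspace q k" and par: "(j + k) mod 2 = \<epsilon>"
  shows "tens (ladder p j s a e) (ladder q k s' b g) = (\<lambda>z. 0) \<or>
    (s \<or> j \<ge> 1) \<and> (s' \<or> k \<ge> 1) \<and> (shift s j + shift s' k) mod 2 = \<epsilon> \<and>
    tens (ladder p j s a e) (ladder q k s' b g) \<in> V_space p q (shift s j) (shift s' k)"
proof (cases "(s \<or> j \<ge> 1) \<and> (s' \<or> k \<ge> 1)")
  case True
  have "(shift s j + shift s' k) mod 2 = (j + k) mod 2"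
    using True by (cases s; cases s'; cases j; cases k; simp add: shift_def; presburger)
  then show ?thesis
    using True par ladder_in_eigenspace[OF e C(1) pq(1)] ladder_in_eigenspace[OF g C(2) pq(2)] by auto
next
  case False
  then have "tens (ladder p j s a e) (ladder q k s' b g) = (\<lambda>z. 0)"
    by (auto simp: tens_def ladder_down_0 fun_eq_iff not_le)
  then show ?thesis ..
qed

lemma tens_ladder_in:
  fixes e :: "'m usphere \<Rightarrow> complex" and g :: "'n usphere \<Rightarrow> complex"
  assumes "e \<in> eigenspace p j" "g \<in> eigenspace q k" "(j + k) mod 2 = \<epsilon>"
  shows "tens (ladder p j s a e) (ladder q k s' b g) \<in> E_space p q \<epsilon>"
  using tens_ladder[OF assms, of s a s' b] V_space_subset E_space_zero by metis

lemma mult_op_mixed: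
  fixes e :: "'m usphere \<Rightarrow> complex" and g :: "'n usphere \<Rightarrow> complex"
  assumes e: "e \<in> eigenspace p j" and g: "g \<in> eigenspace q k" and par: "(j + k) mod 2 = \<epsilon>"
  shows "conf_op t (induced_field (Inl a) (Inr b)) (tens e g) \<in> E_space p q \<epsilon>" (is ?in)
    and "mult_op p q \<epsilon> \<mu> (conf_op t (induced_field (Inl a) (Inr b)) (tens e g)) =
      (\<lambda>z. \<Sum>i\<in>UNIV. \<mu> (shift (fst i) j) (shift (snd i) k) *
         (t - of_real (kap p j (fst i)) - of_real (kap q k (snd i))) *
         tens (ladder p j (fst i) (axis a 1) e) (ladder q k (snd i) (axis b 1) g) z)" (is ?eq)
proof -
  let ?T = "\<lambda>s s'. tens (ladder p j s (axis a 1) e) (ladder q k s' (axis b 1) g)"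
  let ?c = "\<lambda>s s'. t - of_real (kap p j s) - of_real (kap q k s') :: complex"
  have T: "(\<lambda>z. ?c s s' * ?T s s' z) \<in> E_space p q \<epsilon>" for s s'
    by (intro E_space_cmult tens_ladder_in e g par)
  have opT: "mult_op p q \<epsilon> \<mu> (\<lambda>z. ?c s s' * ?T s s' z) = (\<lambda>z. \<mu> (shift s j) (shift s' k) * ?c s s' * ?T s s' z)" for s s'
  proof (cases "?T s s' = (\<lambda>z. 0)")
    case True
    then show ?thesis by (simp add: mult_op_zero[OF pq])
  next
    case False
    with tens_ladder[OF e g par, of s "axis a 1" s' "axis b 1"]
    have "(shift s j + shift s' k) mod 2 = \<epsilon>" "?T s s' \<in> V_space p q (shift s j) (shift s' k)" by auto
    then show ?thesis using mult_op_V[OF pq V_space_cmult] by (simp add: mult.assoc)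
  qed
  show ?in unfolding conf_op_mixed[OF e g C pq] by (rule E_space_sum[OF T])
  show ?eq unfolding conf_op_mixed[OF e g C pq]
    by (simp only: mult_op_sum[OF pq finite T] opT)
qed

text \<open>Membership in \<open>E_space\<close> is proved along with the equation because
  \<open>mult_op\<close> is known to be linear only there. Fields within one factor have zero
  conformal factor and preserve V(j,k), so they satisfy the relation for every
  \<open>\<mu>\<close>.\<close>

lemma mult_op_conf_op_induced:
  fixes e :: "'m usphere \<Rightarrow> complex" and g :: "'n usphere \<Rightarrow> complex"
  assumes R: "recur p q \<epsilon> r \<mu>" and e: "e \<in> eigenspace p j" and g: "g \<in> eigenspace q k" and par: "(j + k) mod 2 = \<epsilon>"
  shows "conf_op (of_nat (p + q) / 2 - r) (induced_field \<alpha> \<beta>) (tens e g) \<in> E_space p q \<epsilon> \<and>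
    mult_op p q \<epsilon> \<mu> (conf_op (of_nat (p + q) / 2 - r) (induced_field \<alpha> \<beta>) (tens e g)) =
    (\<lambda>z. \<mu> j k * conf_op (of_nat (p + q) / 2 + r) (induced_field \<alpha> \<beta>) (tens e g) z)"
    (is "?P \<alpha> \<beta>")
proof -
  let ?t = "of_nat (p + q) / 2 - r" and ?t' = "of_nat (p + q) / 2 + r"
  have sm: "smooth_sphere e" "smooth_sphere g" and C2: "CARD('m) \<ge> 2"
    using e g C pq by auto
  note md = mdiff_tens[OF sm]
  have mixed: "?P (Inl a) (Inr b)" for a b
  proof -
    let ?T = "\<lambda>s s'. tens (ladder p j s (axis a 1) e) (ladder q k s' (axis b 1) g)"
    let ?c = "\<lambda>t s s'. t - of_real (kap p j s) - of_real (kap q k s') :: complex"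
    have st: "\<mu> (shift s j) (shift s' k) * ?c ?t s s' * ?T s s' z = \<mu> j k * (?c ?t' s s' * ?T s s' z)" for s s' z
    proof (cases "?T s s' = (\<lambda>z. 0)")
      case False
      with tens_ladder[OF e g par, of s "axis a 1" s' "axis b 1"]
      have "s \<or> j \<ge> 1" "s' \<or> k \<ge> 1" by auto
      then have "step_rel p q r \<mu> s s' j k"
        using R par unfolding recur_iff_step_rel by blast
      then show ?thesis unfolding step_rel_def by simp
    qed simp
    show ?thesis
      by (rule conjI[OF mult_op_mixed(1)[OF e g par]], unfold mult_op_mixed(2)[OF e g par],
          unfold conf_op_mixed[OF e g C pq])
        (simp only: st sum_distrib_left)
  qed
  have anti: "?P \<alpha> \<beta>" if "?P \<beta> \<alpha>" for \<alpha> \<beta>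
  proof -
    have eq: "conf_op t (induced_field \<alpha> \<beta>) (tens e g) = (\<lambda>z. (-1) * conf_op t (induced_field \<beta> \<alpha>) (tens e g) z)" for t
      using conf_op_antisym[OF md C2, of t \<alpha> \<beta>] by auto
    show ?thesis
      unfolding eq mult_op_cmult[OF pq conjunct1[OF that]]
      by (rule conjI, rule E_space_cmult[OF conjunct1[OF that]]) (use that in auto)
  qed
  have inV: "?P \<alpha> \<beta>" if "conf_op ?t (induced_field \<alpha> \<beta>) (tens e g) \<in> V_space p q j k"
    "conf_op ?t (induced_field \<alpha> \<beta>) (tens e g) = conf_op ?t' (induced_field \<alpha> \<beta>) (tens e g)" for \<alpha> \<beta>
    using mult_op_V[OF pq that(1) par] V_space_subset[OF that(1) par] that(2) by simp
  have left: "?P (Inl a) (Inl c)" for a c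
    by (rule inV) (auto simp: conf_op_left[OF sm C2] intro!: V_space_tens eigenspace_rotation_field[OF e C(1)] g)
  have right: "?P (Inr a) (Inr c)" for a c
    by (rule inV) (auto simp: conf_op_right[OF sm C2] intro!: V_space_tens eigenspace_rotation_field[OF g C(2)] e)
  show ?thesis
    by (cases \<alpha>; cases \<beta>) (use mixed anti left right in blast)+
qed

lemma mult_op_conf_op:
  fixes f :: "('m, 'n) mfd \<Rightarrow> complex"
  assumes R: "recur p q \<epsilon> r \<mu>" and X: "X \<in> conf_algebra" and f: "f \<in> E_space p q \<epsilon>"
  shows "conf_op (of_nat (p + q) / 2 - r) X f \<in> E_space p q \<epsilon> \<and>
    mult_op p q \<epsilon> \<mu> (conf_op (of_nat (p + q) / 2 - r) X f) =
    conf_op (of_nat (p + q) / 2 + r) X (mult_op p q \<epsilon> \<mu> f)"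
  using f
proof (induction rule: E_space_induct)
  case zero
  then show ?case by (simp add: conf_op_zero E_space_zero mult_op_zero[OF pq])
next
  case (add f f')
  note md = add(1,2)[THEN E_space_mdiff]
  note mdm = add(1,2)[THEN mult_op_in[OF pq], THEN E_space_mdiff]
  note E = add(3)[THEN conjunct1] add(4)[THEN conjunct1]
  show ?case
    unfolding conf_op_add[OF md] mult_op_add[OF pq add(1,2)] conf_op_add[OF mdm] mult_op_add[OF pq E]
    using add(3,4) E_space_add[OF E] by simp
next
  case (tens e g j k)
  let ?t = "of_nat (p + q) / 2 - r" and ?t' = "of_nat (p + q) / 2 + r"
  obtain c :: "'m + 'n \<Rightarrow> 'm + 'n \<Rightarrow> real" where c: "X = (\<lambda>z. \<Sum>\<alpha>\<in>UNIV. \<Sum>\<beta>\<in>UNIV. c \<alpha> \<beta> *\<^sub>R induced_field \<alpha> \<beta> z)"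
    using X unfolding conf_algebra_def by blast
  have md: "mdiff (tens e g)" using tens by (auto intro: mdiff_tens)
  have C2: "CARD('m) \<ge> 2" using C pq by simp
  have eq: "conf_op t X (tens e g) =
    (\<lambda>z. \<Sum>i\<in>UNIV. of_real (c (fst i) (snd i)) * conf_op t (induced_field (fst i) (snd i)) (tens e g) z)" for t
    unfolding c using conf_op_conf_algebra[OF md C2, of t c] by (auto simp: sum.cartesian_product split_beta)
  note ind = mult_op_conf_op_induced[OF R tens]
  have V: "tens e g \<in> V_space p q j k" using tens by auto
  have "mult_op p q \<epsilon> \<mu> (conf_op ?t X (tens e g)) = (\<lambda>z. \<mu> j k * conf_op ?t' X (tens e g) z)"
    unfolding eq
    by (subst mult_op_sum[OF pq]) (use ind in \<open>auto intro!: E_space_cmult sum.cong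
        simp: mult_op_cmult[OF pq] sum_distrib_left mult_ac\<close>)
  also have "\<dots> = conf_op ?t' X (mult_op p q \<epsilon> \<mu> (tens e g))"
    unfolding mult_op_V[OF pq V tens(3)] conf_op_cmult[OF md] ..
  finally show ?case
    unfolding eq[of ?t] using ind by (auto intro!: E_space_sum E_space_cmult)
qed

lemma intertwinor_mult_op:
  assumes "recur p q \<epsilon> r \<mu>"
  shows "intertwinor p q \<epsilon> r (mult_op p q \<epsilon> \<mu> :: (('m, 'n) mfd \<Rightarrow> complex) \<Rightarrow> _) \<and>
    spectral_function p q \<epsilon> (mult_op p q \<epsilon> \<mu> :: (('m, 'n) mfd \<Rightarrow> complex) \<Rightarrow> _) \<mu>"
proof -
  let ?A = "mult_op p q \<epsilon> \<mu> :: (('m, 'n) mfd \<Rightarrow> complex) \<Rightarrow> _"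
  have lin: "linear_operator p q \<epsilon> ?A"
    by (simp add: linear_operator_def mult_op_in[OF pq] mult_op_add[OF pq] mult_op_cmult[OF pq])
  have sp: "spectral_function p q \<epsilon> ?A \<mu>"
    by (simp add: spectral_function_def mult_op_V[OF pq])
  have rot: "?A (rot_act R S f) = rot_act R S (?A f)"
    if "rotation_matrix R" "rotation_matrix S" "f \<in> E_space p q \<epsilon>" for R S f
  proof -
    obtain N g where d: "dec p q \<epsilon> N g f" using \<open>f \<in> _\<close> unfolding E_space_iff by blast
    note d' = dec_rot_act[OF d orthogonal_matrix_inv[OF that(1)] orthogonal_matrix_inv[OF that(2)]]
    show ?thesis unfolding mult_op_dec[OF pq d] mult_op_dec[OF pq d'] by (simp add: rot_act_def [abs_def])
  qed
  show ?thesis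
    unfolding intertwinor_def using lin sp rot mult_op_conf_op[OF assms] by blast
qed

text \<open>One mixed field, applied to one tensor with a nonzero component in the chosen direction,
  suffices: the four components are independent, so the coefficient of that one can be
  isolated.\<close>

lemma step_rel_of_intertwinor:
  fixes A :: "(('m, 'n) mfd \<Rightarrow> complex) \<Rightarrow> ('m, 'n) mfd \<Rightarrow> complex"
  assumes A: "intertwinor p q \<epsilon> r A" and S: "spectral_function p q \<epsilon> A \<mu>"
    and par: "(j + k) mod 2 = \<epsilon>" and G: "s0 \<or> j \<ge> 1" "s0' \<or> k \<ge> 1"
  shows "step_rel p q r \<mu> s0 s0' j k"
proof -
  let ?t = "of_nat (p + q) / 2 - r" and ?t' = "of_nat (p + q) / 2 + r"
  obtain e :: "'m usphere \<Rightarrow> complex" and x0 where e: "e \<in> eigenspace p j" "e x0 \<noteq> 0"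
    using eigenspace_nonzero[OF C(1) pq(1)] .
  obtain g :: "'n usphere \<Rightarrow> complex" and y0 where g: "g \<in> eigenspace q k" "g y0 \<noteq> 0"
    using eigenspace_nonzero[OF C(2) pq(2)] .
  obtain a x1 where a: "ladder p j s0 (axis a 1) e x1 \<noteq> 0"
    using ladder_nonzero[OF e pq(1) G(1)] by (auto simp: Basis_vec_def)
  obtain b y1 where b: "ladder q k s0' (axis b 1) g y1 \<noteq> 0"
    using ladder_nonzero[OF g pq(2) G(2)] by (auto simp: Basis_vec_def)
  let ?T = "\<lambda>s s'. tens (ladder p j s (axis a 1) e) (ladder q k s' (axis b 1) g)"
  let ?c = "\<lambda>t s s'. t - of_real (kap p j s) - of_real (kap q k s') :: complex"
  let ?X = "induced_field (Inl a) (Inr b) :: ('m, 'n) mfd \<Rightarrow> _"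
  let ?D = "\<lambda>s s'. \<mu> (shift s j) (shift s' k) * ?c ?t s s' - \<mu> j k * ?c ?t' s s'"
  have V: "tens e g \<in> V_space p q j k" and VE: "tens e g \<in> E_space p q \<epsilon>"
    using e g par V_space_subset by blast+
  have md: "mdiff (tens e g)" using E_space_mdiff[OF VE] .
  have "(if c then 1 else 0) *\<^sub>R v = (if c then v else 0)" for c and v :: "('m, 'n) ambient" by simp
  then have "?X = (\<lambda>z. \<Sum>\<alpha>\<in>UNIV. \<Sum>\<beta>\<in>UNIV. (if \<alpha> = Inl a \<and> \<beta> = Inr b then 1 else 0) *\<^sub>R induced_field \<alpha> \<beta> z)"
    by (simp only: sum_delta2 finite UNIV_I)
  then have X: "?X \<in> conf_algebra"
    unfolding conf_algebra_def mem_Collect_eq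
    by (rule exI[of _ "\<lambda>\<alpha> \<beta>. if \<alpha> = Inl a \<and> \<beta> = Inr b then 1 else 0"])
  have lin: "linear_operator p q \<epsilon> A" using A by (simp add: intertwinor_def)
  \<comment> \<open>The relation for \<open>A\<close> involves its value on a sum of four
    components; linearity and the spectral function identify that value with the one of
    \<open>mult_op\<close>.\<close>
  have AE: "A f = mult_op p q \<epsilon> \<mu> f" if "f \<in> E_space p q \<epsilon>" for f
    using that
  proof (induction rule: E_space_induct)
    case zero
    have "A (\<lambda>z. c * f z) = (\<lambda>z. c * A f z)" if "f \<in> E_space p q \<epsilon>" for f c
      using lin that unfolding linear_operator_def by blast
    from this[OF E_space_zero, of 0] show ?case by (simp add: mult_op_zero[OF pq])
  next
    case (tens e g j k)
    then have "A (tens e g) = (\<lambda>z. \<mu> j k * tens e g z)"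
      using S V_space_tens unfolding spectral_function_def by blast
    then show ?case unfolding mult_op_V[OF pq V_space_tens[OF tens(1,2)] tens(3)] .
  next
    case (add f f')
    have "A (\<lambda>z. f z + f' z) = (\<lambda>z. A f z + A f' z)"
      using lin add(1,2) unfolding linear_operator_def by blast
    then show ?case unfolding mult_op_add[OF pq add(1,2)] add(3,4) .
  qed
  have "mult_op p q \<epsilon> \<mu> (conf_op ?t ?X (tens e g)) = conf_op ?t' ?X (A (tens e g))"
    using A X VE AE[OF mult_op_mixed(1)[OF e(1) g(1) par]] unfolding intertwinor_def by metis
  also have "A (tens e g) = (\<lambda>z. \<mu> j k * tens e g z)"
    using S V par unfolding spectral_function_def by blast
  also have "conf_op ?t' ?X \<dots> = (\<lambda>z. \<mu> j k * conf_op ?t' ?X (tens e g) z)"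
    by (rule conf_op_cmult[OF md])
  finally have eq: "(\<Sum>i\<in>UNIV. \<mu> (shift (fst i) j) (shift (snd i) k) * ?c ?t (fst i) (snd i) * ?T (fst i) (snd i) z) =
      \<mu> j k * (\<Sum>i\<in>UNIV. ?c ?t' (fst i) (snd i) * ?T (fst i) (snd i) z)" for z
    unfolding mult_op_mixed(2)[OF e(1) g(1) par] unfolding conf_op_mixed[OF e(1) g(1) C pq] by (rule fun_cong)
  let ?l = "\<lambda>s x. ladder p j s (axis a 1) e x" and ?m = "\<lambda>s y. ladder q k s (axis b 1) g y"
  \<comment> \<open>Grouped by the degree in \<open>x\<close>, so that
    \<open>ladder_independent\<close> applies first on one sphere and then on the other;
    \<open>x1\<close> and \<open>y1\<close> are points where the chosen components do not
    vanish.\<close>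
  have 1: "(\<Sum>s\<in>UNIV. (\<Sum>s'\<in>UNIV. ?D s s' * ?m s' y) * ?l s x) = 0" for x y
  proof -
    have lin_sum: "(\<Sum>i\<in>UNIV. (F i - c * G i) * H i) = (\<Sum>i\<in>UNIV. F i * H i) - c * (\<Sum>i\<in>UNIV. G i * H i)"
      for c and F G H :: "bool \<times> bool \<Rightarrow> complex"
      by (simp add: left_diff_distrib sum_subtractf sum_distrib_left mult.assoc)
    have "(\<Sum>i\<in>UNIV. ?D (fst i) (snd i) * ?T (fst i) (snd i) (x, y)) = 0"
      by (simp only: lin_sum eq diff_self)
    then show ?thesis
      unfolding UNIV_Times_UNIV[symmetric] sum.cartesian_product' fst_conv snd_conv tens_def prod.case
      by (simp only: sum_distrib_right mult.assoc mult.commute[of "?m _ _"])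
  qed
  have "(\<Sum>s'\<in>UNIV. ?D s0 s' * ?m s' y) * ?l s0 x1 = 0" for y
    by (rule ladder_independent[OF e(1) C(1) pq(1) 1])
  then have "(\<Sum>s'\<in>UNIV. ?D s0 s' * ?m s' y) = 0" for y
    using a by (simp only: mult_eq_0_iff simp_thms)
  from ladder_independent[OF g(1) C(2) pq(2) this] have "?D s0 s0' * ?m s0' y1 = 0" .
  then have "?D s0 s0' = 0" using b by (simp only: mult_eq_0_iff simp_thms)
  then show ?thesis by (simp add: step_rel_def)
qed

theorem spectrum_iff_recur:
  "(\<exists>A :: (('m, 'n) mfd \<Rightarrow> complex) \<Rightarrow> (('m, 'n) mfd \<Rightarrow> complex).
       intertwinor p q \<epsilon> r A \<and> spectral_function p q \<epsilon> A \<mu>) \<longleftrightarrow> recur p q \<epsilon> r \<mu>"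
  (is "?L \<longleftrightarrow> _")
proof
  assume ?L
  then obtain A :: "(('m, 'n) mfd \<Rightarrow> complex) \<Rightarrow> (('m, 'n) mfd \<Rightarrow> complex)"
    where A: "intertwinor p q \<epsilon> r A" "spectral_function p q \<epsilon> A \<mu>" by blast
  show "recur p q \<epsilon> r \<mu>"
    unfolding recur_iff_step_rel using step_rel_of_intertwinor[OF A] by simp
next
  assume "recur p q \<epsilon> r \<mu>"
  from intertwinor_mult_op[OF this] show ?L by (rule exI[of _ "mult_op p q \<epsilon> \<mu>"])
qed

end

section \<open>Uniqueness of solutions of the recurrences\<close>

lemma recur_diff:
  assumes "recur p q \<epsilon> r \<mu>" "recur p q \<epsilon> r \<nu>"
  shows "recur p q \<epsilon> r (\<lambda>j k. \<mu> j k - c * \<nu> j k)"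
  using assms unfolding recur_def by (auto simp: left_diff_distrib mult.assoc)

lemma recur_multiple:
  assumes "recur p q \<epsilon> r \<nu>" "\<And>j k. (j + k) mod 2 = \<epsilon> \<Longrightarrow> \<mu> j k = c * \<nu> j k"
  shows "recur p q \<epsilon> r \<mu>"
proof -
  have par: "(Suc j + Suc k) mod 2 = (j + k) mod 2" "(Suc j + k) mod 2 = Suc (j + k) mod 2"
    "(j + Suc k) mod 2 = Suc (j + k) mod 2" for j k by simp_all
  show ?thesis
    using assms(1) unfolding recur_def by (auto simp: assms(2) par mult.assoc)
qed

context
  fixes p q \<epsilon> :: nat and r :: complex and \<mu> :: "nat \<Rightarrow> nat \<Rightarrow> complex" and h d :: complex
  defines "h \<equiv> of_nat (p + q) / 2" and "d \<equiv> (of_nat p - of_nat q) / 2"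
  assumes R: "recur p q \<epsilon> r \<mu>"
begin

lemma recur1: "(j + k) mod 2 = \<epsilon> \<Longrightarrow>
    \<mu> (Suc j) (Suc k) * (of_nat j + of_nat k + h - r) = \<mu> j k * (of_nat j + of_nat k + h + r)"
  using R unfolding recur_def h_def by blast

lemma recur2: "Suc (j + k) mod 2 = \<epsilon> \<Longrightarrow>
    \<mu> (Suc j) k * (of_nat k - of_nat j - d + r) = \<mu> j (Suc k) * (of_nat k - of_nat j - d - r)"
  using R unfolding recur_def d_def by blast

text \<open>A zero spreads along the level \<open>j + k = L\<close>. Towards larger \<open>j\<close>
  the coefficient of the new value vanishes only on an edge with \<open>k - i - d = - r\<close>,
  towards smaller \<open>j\<close> only on one with \<open>k - i - d = r\<close>.\<close>

lemma row_zero: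
  assumes L: "L mod 2 = \<epsilon>" and j0: "j0 \<le> L" "\<mu> j0 (L - j0) = 0"
    and below: "\<And>i k. i < j0 \<Longrightarrow> Suc (i + k) = L \<Longrightarrow> of_nat k - of_nat i - d \<noteq> r"
    and above: "\<And>i k. j0 \<le> i \<Longrightarrow> Suc (i + k) = L \<Longrightarrow> of_nat k - of_nat i - d \<noteq> - r"
    and jk: "j + k = L"
  shows "\<mu> j k = 0"
proof -
  have up: "j0 + n \<le> L \<Longrightarrow> \<mu> (j0 + n) (L - (j0 + n)) = 0" for n
  proof (induction n)
    case 0
    then show ?case using j0 by simp
  next
    case (Suc n)
    let ?i = "j0 + n" and ?k = "L - Suc (j0 + n)"
    have s: "Suc (?i + ?k) = L" "Suc ?k = L - (j0 + n)" using Suc.prems by auto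
    have "\<mu> (Suc ?i) ?k * (of_nat ?k - of_nat ?i - d + r) = 0"
      using recur2[of ?i ?k] s L Suc by simp
    moreover have "of_nat ?k - of_nat ?i - d + r \<noteq> 0"
      using above[of ?i ?k] s(1) by (simp add: add_eq_0_iff2)
    ultimately show ?case by simp
  qed
  have down: "n \<le> j0 \<Longrightarrow> \<mu> (j0 - n) (L - (j0 - n)) = 0" for n
  proof (induction n)
    case 0
    then show ?case using j0 by simp
  next
    case (Suc n)
    let ?i = "j0 - Suc n" and ?k = "L - (j0 - n)"
    have s: "Suc (?i + ?k) = L" "Suc ?i = j0 - n" "Suc ?k = L - ?i" using Suc.prems j0 by auto
    have "\<mu> ?i (Suc ?k) * (of_nat ?k - of_nat ?i - d - r) = 0"
      using recur2[of ?i ?k] s L Suc by simp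
    moreover have "of_nat ?k - of_nat ?i - d - r \<noteq> 0"
      using below[of ?i ?k] s(1) Suc.prems by simp
    ultimately show ?case using s by simp
  qed
  show ?thesis
  proof (cases "j \<ge> j0")
    case True
    then show ?thesis using up[of "j - j0"] jk by auto
  next
    case False
    then show ?thesis using down[of "j0 - j"] jk by auto
  qed
qed

text \<open>Every point has an upper diagonal neighbour, so the first recurrence alone leads down
  from level to level.\<close>

lemma below_zero:
  assumes row: "\<And>j k. j + k = L \<Longrightarrow> \<mu> j k = 0" and L: "L mod 2 = \<epsilon>"
    and ne: "\<And>l. l < L \<Longrightarrow> l mod 2 = \<epsilon> \<Longrightarrow> of_nat l + h + r \<noteq> 0"
  shows "j + k + 2 * n = L \<Longrightarrow> \<mu> j k = 0"
proof (induction n arbitrary: j k)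
  case 0
  then show ?case using row by simp
next
  case (Suc n)
  have "\<mu> (Suc j) (Suc k) = 0" using Suc by simp
  moreover have par: "(j + k) mod 2 = \<epsilon>" using L Suc.prems by auto
  ultimately have "\<mu> j k * (of_nat (j + k) + h + r) = 0"
    using recur1[of j k] by simp
  then show ?case using ne[of "j + k"] par Suc.prems by auto
qed

text \<open>Going up, the points with \<open>j = 0\<close> or \<open>k = 0\<close> have no lower
  diagonal neighbour. They are reached along their level from the adjacent interior point, which
  explains the conditions containing \<open>d\<close>.\<close>

lemma above_zero:
  assumes row: "\<And>j k. j + k = L \<Longrightarrow> \<mu> j k = 0" and L: "L mod 2 = \<epsilon>"
    and ne: "\<And>l. l \<ge> L \<Longrightarrow> of_nat l + h \<noteq> r" "\<And>l. l \<ge> L \<Longrightarrow> of_nat (Suc l) - d \<noteq> r"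
      "\<And>l. l \<ge> L \<Longrightarrow> of_nat (Suc l) + d \<noteq> r"
  shows "j + k = L + 2 * n \<Longrightarrow> \<mu> j k = 0"
proof (induction n arbitrary: j k)
  case 0
  then show ?case using row by simp
next
  case (Suc n)
  let ?l = "L + 2 * n"
  have int: "\<mu> (Suc i) (Suc k) = 0" if "i + k = ?l" for i k
  proof -
    have par: "(i + k) mod 2 = \<epsilon>" and ge: "i + k \<ge> L" using that L by auto
    have "\<mu> (Suc i) (Suc k) * (of_nat i + of_nat k + h - r) = 0"
      using recur1[OF par] Suc.IH[OF that] by simp
    moreover have "of_nat i + of_nat k + h \<noteq> r" using ne(1)[OF ge] by simp
    ultimately show ?thesis by simp
  qed
  have par: "Suc (Suc ?l) mod 2 = \<epsilon>" using L by simp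
  consider "j = 0" | "k = 0" | i l where "j = Suc i" "k = Suc l" by (metis not0_implies_Suc)
  then show ?case
  proof cases
    case 1
    have "\<mu> 0 (Suc (Suc ?l)) * (of_nat (Suc ?l) - d - r) = 0"
      using recur2[of 0 "Suc ?l"] int[of 0 ?l] par by simp
    then show ?thesis using ne(2)[of ?l] 1 Suc.prems by auto
  next
    case 2
    have "\<mu> (Suc (Suc ?l)) 0 * (0 - of_nat (Suc ?l) - d + r) = 0"
      using recur2[of "Suc ?l" 0] int[of ?l 0] par by simp
    moreover have "0 - of_nat (Suc ?l) - d + r \<noteq> 0" using ne(3)[of ?l] by (auto simp: algebra_simps)
    ultimately show ?thesis using 2 Suc.prems by simp
  next
    case 3
    then show ?thesis using int Suc.prems by simp
  qed
qed

lemma all_zero: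
  assumes L: "L mod 2 = \<epsilon>" and j0: "j0 \<le> L" "\<mu> j0 (L - j0) = 0"
    and "\<And>i k. i < j0 \<Longrightarrow> Suc (i + k) = L \<Longrightarrow> of_nat k - of_nat i - d \<noteq> r"
    and "\<And>i k. j0 \<le> i \<Longrightarrow> Suc (i + k) = L \<Longrightarrow> of_nat k - of_nat i - d \<noteq> - r"
    and "\<And>l. l < L \<Longrightarrow> l mod 2 = \<epsilon> \<Longrightarrow> of_nat l + h + r \<noteq> 0"
    and "\<And>l. l \<ge> L \<Longrightarrow> of_nat l + h \<noteq> r" "\<And>l. l \<ge> L \<Longrightarrow> of_nat (Suc l) - d \<noteq> r"
      "\<And>l. l \<ge> L \<Longrightarrow> of_nat (Suc l) + d \<noteq> r"
    and jk: "(j + k) mod 2 = \<epsilon>"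
  shows "\<mu> j k = 0"
proof -
  have row: "\<And>j k. j + k = L \<Longrightarrow> \<mu> j k = 0" using row_zero[OF L j0 assms(4,5)] by blast
  show ?thesis
  proof (cases "j + k \<le> L")
    case True
    have "even (L - (j + k))" using jk L True by (metis dvd_minus_mod mod_eq_dvd_iff_nat)
    then obtain n where "j + k + 2 * n = L" using True by (metis evenE le_add_diff_inverse)
    then show ?thesis using below_zero[OF row L assms(6)] by blast
  next
    case False
    have "even (j + k - L)" using jk L False by (metis mod_eq_dvd_iff_nat nat_le_linear)
    then obtain n where "j + k = L + 2 * n" using False by (metis evenE le_add_diff_inverse nat_le_linear)
    then show ?thesis using above_zero[OF row L assms(7-9)] by blast
  qed
qed

end

text \<open>If \<open>r = - (l + h)\<close> for a level \<open>l\<close>, solutions vanish above \<open>l\<close> and are determined by any value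
  on that level.  Otherwise a high level \<open>L\<close> is used; the only obstruction to moving along it are
  the edges with \<open>w = r\<close> or \<open>w = - r\<close>, and these are in the wrong order exactly when \<open>r\<close> is decoupled.\<close>

lemma determining_point:
  assumes \<epsilon>: "\<epsilon> \<in> {0, 1}" and p: "p \<ge> 1" "q \<ge> 1" and nd: "\<not> decoupled p q \<epsilon> r"
  obtains j0 k0 where "(j0 + k0) mod 2 = \<epsilon>"
    "\<And>\<mu> j k. recur p q \<epsilon> r \<mu> \<Longrightarrow> \<mu> j0 k0 = 0 \<Longrightarrow> (j + k) mod 2 = \<epsilon> \<Longrightarrow> \<mu> j k = 0"
proof -
  define h :: complex where "h = of_nat (p + q) / 2"
  define d :: complex where "d = (of_nat p - of_nat q) / 2"
  have Reh: "Re h = (real p + real q) / 2" "Im h = 0" and Red: "Re d = (real p - real q) / 2" "Im d = 0"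
    by (simp_all add: h_def d_def)
  show ?thesis
  proof (cases "\<exists>l. l mod 2 = \<epsilon> \<and> of_nat l + h + r = 0")
    case True
    then obtain L where L: "L mod 2 = \<epsilon>" "of_nat L + h + r = 0" by blast
    have r: "r = - (of_nat L + h)" unfolding eq_neg_iff_add_eq_0 using L(2) by (simp add: add.commute)
    then have Rer: "Re r = - (real L + (real p + real q) / 2)" by (simp add: Reh)
    have c2: "of_nat k - of_nat i - d \<noteq> - r" if "Suc (i + k) = L" for i k
    proof
      assume "of_nat k - of_nat i - d = - r"
      from arg_cong[OF this, of Re] have "real k - real i - Re d = - Re r" by simp
      moreover have "real L = real i + real k + 1" using that by linarith
      ultimately show False using p unfolding Rer Red by (simp add: field_simps)
    qed
    have c3: "of_nat l + h + r \<noteq> 0" if "l < L" for l using that by (simp add: r)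
    have ne: "x \<noteq> r" if "Re x > Re r" for x using that by auto
    have "Re r < 0" using p by (simp add: Rer add_nonneg_pos)
    have c4: "of_nat l + h \<noteq> r" for l
      by (rule ne, rule less_le_trans[OF \<open>Re r < 0\<close>]) (simp add: Reh)
    have c56: "of_nat (Suc l) - d \<noteq> r" "of_nat (Suc l) + d \<noteq> r" for l
      by (rule ne, simp add: Rer Red field_simps)+
    show ?thesis
      by (rule that[of 0 L])
        (use L all_zero[of p q \<epsilon> r _ L 0, folded h_def d_def] c2 c3 c4 c56 in auto)
  next
    case False
    \<comment> \<open>From level \<open>L\<close> on, \<open>l + h\<close> and
      \<open>l + 1 \<plusminus> d\<close> exceed \<open>norm r\<close>, so no coefficient needed on
      the way up vanishes. On the way down none vanishes by the case assumption.\<close>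
    obtain n :: nat where n: "real n > norm r + real p + real q" using reals_Archimedean2 by blast
    define L where "L = 2 * n + \<epsilon>"
    have L: "L mod 2 = \<epsilon>" using \<epsilon> by (auto simp: L_def)
    have Ln: "real L > norm r + real p + real q" using n by (simp add: L_def)
    have ne: "x \<noteq> r" if "Re x > norm r" for x
      using that abs_Re_le_cmod[of r] by auto
    have c4: "of_nat l + h \<noteq> r" if "l \<ge> L" for l
      by (rule ne) (use Ln that in \<open>simp add: Reh field_simps\<close>)
    have c56: "of_nat (Suc l) - d \<noteq> r" "of_nat (Suc l) + d \<noteq> r" if "l \<ge> L" for l
      by (rule ne, use Ln that in \<open>simp add: Red field_simps\<close>)+
    \<comment> \<open>The value of \<open>k - i - d\<close> on the edge of level \<open>L\<close>
      between \<open>(i, L - i)\<close> and \<open>(i + 1, L - i - 1)\<close>.\<close>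
    define w :: "nat \<Rightarrow> complex" where "w i = of_nat L - 1 - 2 * of_nat i - d" for i
    have wk: "of_nat k - of_nat i - d = w i" if "Suc (i + k) = L" for i k
      by (simp add: w_def flip: that)
    have w_inj: "i = i'" if "w i = w i'" for i i' using that by (simp add: w_def)
    \<comment> \<open>Edges before \<open>j0\<close> are crossed leftwards and blocked by
      \<open>w = r\<close>, the others rightwards and blocked by \<open>w = - r\<close>. If both
      kinds occur, at \<open>i1\<close> and \<open>i2\<close>, a start exists as soon as
      \<open>i2 < j0\<close> and \<open>j0 \<le> i1\<close> can be satisfied.\<close>
    have "\<exists>j0\<le>L. (\<forall>i<j0. w i \<noteq> r) \<and> (\<forall>i\<ge>j0. i < L \<longrightarrow> w i \<noteq> - r)"
    proof (cases "\<exists>i2<L. w i2 = - r")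
      case False
      then show ?thesis by (intro exI[of _ 0]) auto
    next
      case True
      then obtain i2 where i2: "i2 < L" "w i2 = - r" by blast
      show ?thesis
      proof (cases "\<exists>i1<L. w i1 = r")
        case False
        then show ?thesis by (intro exI[of _ L]) auto
      next
        case True
        then obtain i1 where i1: "i1 < L" "w i1 = r" by blast
        have "2 * r = w i1 - w i2" using i1 i2 by simp
        also have "\<dots> = 2 * (of_nat i2 - of_nat i1)" by (simp add: w_def)
        finally have r: "r = of_nat i2 - of_nat i1"
          by (simp only: mult_cancel_left numeral_neq_zero simp_thms)
        have "i2 < i1"
        proof (rule ccontr)
          assume "\<not> i2 < i1"
          then have "r = of_nat (i2 - i1)" using r by simp
          then have "r \<in> \<nat>" by (simp only: of_nat_in_Nats)
          moreover have "(r - (d + 1 + of_nat \<epsilon>)) / 2 = of_int (int i2 - int n - int \<epsilon>)"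
          proof -
            have "r = - w i2" using i2 by simp
            then have "r - (d + 1 + of_nat \<epsilon>) = 2 * of_nat i2 - of_nat L - of_nat \<epsilon>" by (simp add: w_def)
            also have "\<dots> = 2 * of_int (int i2 - int n - int \<epsilon>)" by (simp add: L_def)
            finally show ?thesis by simp
          qed
          ultimately have "decoupled p q \<epsilon> r"
            unfolding decoupled_def d_def[symmetric] by (simp only: Ints_of_int)
          with nd show False ..
        qed
        then show ?thesis
          using w_inj i1 i2 by (intro exI[of _ i1]) (metis less_imp_le linorder_not_less)
      qed
    qed
    then obtain j0 where j0: "j0 \<le> L" "\<forall>i<j0. w i \<noteq> r" "\<forall>i\<ge>j0. i < L \<longrightarrow> w i \<noteq> - r" by blast
    show ?thesis
    proof (rule that[of j0 "L - j0"])
      show "(j0 + (L - j0)) mod 2 = \<epsilon>" using j0 L by simp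
      fix \<mu> j k assume \<mu>: "recur p q \<epsilon> r \<mu>" "\<mu> j0 (L - j0) = 0" "(j + k) mod 2 = \<epsilon>"
      show "\<mu> j k = 0"
      proof (rule all_zero[OF \<mu>(1) L j0(1) \<mu>(2), folded h_def d_def, OF _ _ _ _ _ _ \<mu>(3)])
        show "of_nat k - of_nat i - d \<noteq> r" if "i < j0" "Suc (i + k) = L" for i k
          using j0(2) that wk by auto
        show "of_nat k - of_nat i - d \<noteq> - r" if "j0 \<le> i" "Suc (i + k) = L" for i k
          using j0(3) that wk by auto
        show "of_nat l + h + r \<noteq> 0" if "l mod 2 = \<epsilon>" for l using False that by blast
      qed (use c4 c56 in auto)
    qed
  qed
qed

text \<open>The nonzero solution \<open>\<nu>\<close> cannot vanish at the determining point, so a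
  multiple of it can be subtracted from \<open>\<mu>\<close> to create a zero there.\<close>

lemma recur_unique:
  assumes \<epsilon>: "\<epsilon> \<in> {0, 1}" and p: "p \<ge> 1" "q \<ge> 1" and nd: "\<not> decoupled p q \<epsilon> r"
    and \<nu>: "recur p q \<epsilon> r \<nu>" "(j1 + k1) mod 2 = \<epsilon>" "\<nu> j1 k1 \<noteq> 0"
  shows "recur p q \<epsilon> r \<mu> \<longleftrightarrow> (\<exists>c. \<forall>j k. (j + k) mod 2 = \<epsilon> \<longrightarrow> \<mu> j k = c * \<nu> j k)"
proof
  assume \<mu>: "recur p q \<epsilon> r \<mu>"
  obtain j0 k0 where jk: "(j0 + k0) mod 2 = \<epsilon>"
    "\<And>\<mu> j k. recur p q \<epsilon> r \<mu> \<Longrightarrow> \<mu> j0 k0 = 0 \<Longrightarrow> (j + k) mod 2 = \<epsilon> \<Longrightarrow> \<mu> j k = 0"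
    using determining_point[OF \<epsilon> p nd] by blast
  have "\<nu> j0 k0 \<noteq> 0" using jk(2)[OF \<nu>(1)] \<nu>(2,3) by blast
  let ?c = "\<mu> j0 k0 / \<nu> j0 k0"
  have "\<mu> j k - ?c * \<nu> j k = 0" if "(j + k) mod 2 = \<epsilon>" for j k
    using jk(2)[OF recur_diff[OF \<mu> \<nu>(1), of ?c]] that \<open>\<nu> j0 k0 \<noteq> 0\<close> by simp
  then show "\<exists>c. \<forall>j k. (j + k) mod 2 = \<epsilon> \<longrightarrow> \<mu> j k = c * \<nu> j k" by (intro exI[of _ ?c]) simp
next
  assume "\<exists>c. \<forall>j k. (j + k) mod 2 = \<epsilon> \<longrightarrow> \<mu> j k = c * \<nu> j k"
  then show "recur p q \<epsilon> r \<mu>" using recur_multiple[OF \<nu>(1)] by blast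
qed

section \<open>The spectral function\<close>

text \<open>The factors depend on \<open>j + k\<close> only, on \<open>k - j\<close> only, and on
  neither, so each recurrence concerns a single quotient of Gamma values.\<close>

lemma Z_eq:
  fixes p q \<epsilon> :: nat
  defines "h \<equiv> of_nat (p + q) / 2" and "d \<equiv> (of_nat p - of_nat q) / 2"
  shows "Z p q \<epsilon> s j k =
    Gamma ((of_nat j + of_nat k + h + s) / 2) / Gamma ((of_nat j + of_nat k + h - s) / 2) *
    (Gamma ((of_nat k - of_nat j - d + 1 + s) / 2) / Gamma ((of_nat k - of_nat j - d + 1 - s) / 2)) *
    ((Gamma ((of_nat \<epsilon> - d + 1 - s) / 2) * Gamma ((of_nat \<epsilon> + h - s) / 2)) /
     (Gamma ((of_nat \<epsilon> - d + 1 + s) / 2) * Gamma ((of_nat \<epsilon> + h + s) / 2)))"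
proof -
  have "J_of q k + J_of p j + 1 = of_nat j + of_nat k + h" "J_of q k - J_of p j + 1 = of_nat k - of_nat j - d + 1"
    "(of_nat p + of_nat q) / 2 = h"
    by (simp_all add: J_of_def h_def d_def field_simps)
  then show ?thesis unfolding Z_def Let_def d_def by (simp add: mult.assoc)
qed

text \<open>Poles in the denominator are allowed: \<open>1 / Gamma\<close> is the entire function
  \<open>rGamma\<close>, whose functional equation holds everywhere.\<close>

lemma Gamma_step: "z \<notin> \<int>\<^sub>\<le>\<^sub>0 \<Longrightarrow> Gamma (z + 1) / Gamma (w + 1) * w = Gamma z / Gamma w * (z :: complex)"
proof -
  assume z: "z \<notin> \<int>\<^sub>\<le>\<^sub>0"
  have "Gamma (z + 1) / Gamma (w + 1) * w = Gamma (z + 1) * (w * rGamma (w + 1))"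
    by (simp add: rGamma_inverse_Gamma field_simps)
  also have "\<dots> = z * Gamma z * rGamma w" using z by (simp add: Gamma_plus1 rGamma_plus1)
  finally show ?thesis by (simp add: rGamma_inverse_Gamma field_simps)
qed

lemma Z_recur1:
  assumes "(of_nat j + of_nat k + of_nat (p + q) / 2 + s) / 2 \<notin> \<int>\<^sub>\<le>\<^sub>0"
  shows "Z p q \<epsilon> s (Suc j) (Suc k) * (of_nat j + of_nat k + of_nat (p + q) / 2 - s) =
    Z p q \<epsilon> s j k * (of_nat j + of_nat k + of_nat (p + q) / 2 + s)"
proof -
  define a where "a = (of_nat j + of_nat k + of_nat (p + q) / 2 + s) / 2"
  define b where "b = (of_nat j + of_nat k + of_nat (p + q) / 2 - s) / 2"
  define c where "c = of_nat k - of_nat j - (of_nat p - of_nat q :: complex) / 2 + 1"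
  have ab: "(of_nat (Suc j) + of_nat (Suc k) + of_nat (p + q) / 2 + s) / 2 = a + 1"
    "(of_nat (Suc j) + of_nat (Suc k) + of_nat (p + q) / 2 - s) / 2 = b + 1"
    "of_nat (Suc k) - of_nat (Suc j) - (of_nat p - of_nat q :: complex) / 2 + 1 = c"
    "of_nat j + of_nat k + of_nat (p + q) / 2 + s = 2 * a" "of_nat j + of_nat k + of_nat (p + q) / 2 - s = 2 * b"
    by (simp_all add: a_def b_def c_def field_simps)
  have "a \<notin> \<int>\<^sub>\<le>\<^sub>0" using assms by (simp add: a_def)
  note st = Gamma_step[OF this, of b]
  have "x' * y * n * (2 * b) = x * y * n * (2 * a)" if "x' * b = x * a" for x' x y n :: complex
    using that by simp
  from this[OF st] show ?thesis
    unfolding Z_eq ab(1-3) unfolding a_def[symmetric] b_def[symmetric] c_def[symmetric] unfolding ab(4,5) .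
qed

lemma Z_recur2:
  assumes "(of_nat k - of_nat (Suc j) - (of_nat p - of_nat q) / 2 + 1 + s) / 2 \<notin> \<int>\<^sub>\<le>\<^sub>0"
  shows "Z p q \<epsilon> s (Suc j) k * (of_nat k - of_nat j - (of_nat p - of_nat q) / 2 + s) =
    Z p q \<epsilon> s j (Suc k) * (of_nat k - of_nat j - (of_nat p - of_nat q) / 2 - s)"
proof -
  define a where "a = (of_nat k - of_nat j - (of_nat p - of_nat q) / 2 + s) / 2"
  define b where "b = (of_nat k - of_nat j - (of_nat p - of_nat q) / 2 - s) / 2"
  define c where "c = of_nat j + of_nat k + 1 + (of_nat (p + q) :: complex) / 2"
  have ab: "(of_nat (Suc k) - of_nat j - (of_nat p - of_nat q) / 2 + 1 + s) / 2 = a + 1"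
    "(of_nat (Suc k) - of_nat j - (of_nat p - of_nat q) / 2 + 1 - s) / 2 = b + 1"
    "(of_nat k - of_nat (Suc j) - (of_nat p - of_nat q) / 2 + 1 + s) / 2 = a"
    "(of_nat k - of_nat (Suc j) - (of_nat p - of_nat q) / 2 + 1 - s) / 2 = b"
    "of_nat (Suc j) + of_nat k + (of_nat (p + q) :: complex) / 2 = c"
    "of_nat j + of_nat (Suc k) + (of_nat (p + q) :: complex) / 2 = c"
    "of_nat k - of_nat j - (of_nat p - of_nat q) / 2 + s = 2 * a"
    "of_nat k - of_nat j - (of_nat p - of_nat q) / 2 - s = 2 * b"
    by (simp_all add: a_def b_def c_def field_simps)
  have "a \<notin> \<int>\<^sub>\<le>\<^sub>0" using assms unfolding ab .
  note st = Gamma_step[OF this, of b]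
  have "y * x * n * (2 * a) = y * x' * n * (2 * b)" if "x' * b = x * a" for x' x y n :: complex
    using that by simp
  from this[OF st] show ?thesis unfolding Z_eq ab .
qed

lemma decoupled_not_Z_defined:
  assumes \<epsilon>: "\<epsilon> \<in> {0, 1}" and Z: "Z_defined p q \<epsilon> r"
  shows "\<not> decoupled p q \<epsilon> r"
proof
  assume "decoupled p q \<epsilon> r"
  then obtain z :: int where z: "(r - ((of_nat p - of_nat q) / 2 + 1 + of_nat \<epsilon>)) / 2 = of_int z"
    unfolding decoupled_def by (auto elim: Ints_cases)
  \<comment> \<open>At \<open>(2 * t, \<epsilon>)\<close> with this large \<open>t\<close> the
    argument of the second Gamma factor in the numerator is a nonpositive integer.\<close>
  define t where "t = nat (int \<epsilon> + 1 + \<bar>z\<bar>)"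
  have "(2 * t + \<epsilon>) mod 2 = \<epsilon>" using \<epsilon> by auto
  then have "(J_of q \<epsilon> - J_of p (2 * t) + 1 + r) / 2 \<notin> \<int>\<^sub>\<le>\<^sub>0"
    using Z unfolding Z_defined_def by blast
  moreover have "(J_of q \<epsilon> - J_of p (2 * t) + 1 + r) / 2 = of_int (int \<epsilon> + 1 + z - int t)"
  proof -
    define D where "D = (of_nat p - of_nat q :: complex) / 2"
    have "r - (D + 1 + of_nat \<epsilon>) = 2 * of_int z" using z unfolding D_def[symmetric] by simp
    then have r: "r = 2 * of_int z + (D + 1 + of_nat \<epsilon>)" by (simp add: algebra_simps)
    have J: "J_of q \<epsilon> - J_of p (2 * t) + 1 = of_nat \<epsilon> - 2 * of_nat t - D + 1"
      by (simp add: J_of_def D_def field_simps)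
    show ?thesis unfolding J by (simp add: r)
  qed
  moreover have "int \<epsilon> + 1 + z - int t \<le> 0" by (simp add: t_def)
  ultimately show False by (metis nonpos_Ints_of_int)
qed

lemma recur_Z:
  assumes "Z_defined p q \<epsilon> r"
  shows "recur p q \<epsilon> r (Z p q \<epsilon> r)"
  unfolding recur_def
proof (intro conjI allI impI)
  fix j k :: nat
  let ?A = "of_nat j + of_nat k + of_nat (p + q) / 2 :: complex"
  assume par: "(j + k) mod 2 = \<epsilon>"
  have "J_of q k + J_of p j + 1 = ?A"
    by (simp add: J_of_def field_simps)
  moreover have "(J_of q k + J_of p j + 1 + r) / 2 \<notin> \<int>\<^sub>\<le>\<^sub>0"
    using assms par unfolding Z_defined_def by blast
  ultimately show "Z p q \<epsilon> r (Suc j) (Suc k) * (?A - r) =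
      Z p q \<epsilon> r j k * (?A + r)"
    by (intro Z_recur1) metis
next
  fix j k :: nat
  assume "Suc (j + k) mod 2 = \<epsilon>"
  then have par: "(Suc j + k) mod 2 = \<epsilon>" by simp
  have "J_of q k - J_of p (Suc j) + 1 = of_nat k - of_nat (Suc j) - (of_nat p - of_nat q) / 2 + 1"
    by (simp add: J_of_def field_simps)
  moreover have "(J_of q k - J_of p (Suc j) + 1 + r) / 2 \<notin> \<int>\<^sub>\<le>\<^sub>0"
    using assms par unfolding Z_defined_def by blast
  ultimately show "Z p q \<epsilon> r (Suc j) k * (of_nat k - of_nat j - (of_nat p - of_nat q) / 2 + r) =
      Z p q \<epsilon> r j (Suc k) * (of_nat k - of_nat j - (of_nat p - of_nat q) / 2 - r)"
    by (intro Z_recur2) metis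
qed

text \<open>At \<open>(0, \<epsilon>)\<close> the numerator and the denominator of \<open>Z\<close> are the same product.\<close>

lemma Z_nonzero:
  assumes \<epsilon>: "\<epsilon> \<in> {0, 1}" and Z: "Z_defined p q \<epsilon> r"
  shows "Z p q \<epsilon> r 0 \<epsilon> \<noteq> 0"
proof -
  let ?h = "of_nat (p + q) / 2 :: complex" and ?d = "(of_nat p - of_nat q) / 2 :: complex"
  have "(0 + \<epsilon>) mod 2 = \<epsilon>" using \<epsilon> by auto
  then have "(J_of q \<epsilon> + J_of p 0 + 1 + r) / 2 \<notin> \<int>\<^sub>\<le>\<^sub>0" "(J_of q \<epsilon> - J_of p 0 + 1 + r) / 2 \<notin> \<int>\<^sub>\<le>\<^sub>0"
    using Z unfolding Z_defined_def by blast+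
  moreover have "J_of q \<epsilon> + J_of p 0 + 1 = of_nat \<epsilon> + ?h" "J_of q \<epsilon> - J_of p 0 + 1 = of_nat \<epsilon> - ?d + 1"
    by (simp_all add: J_of_def field_simps)
  ultimately have "(of_nat \<epsilon> + ?h + r) / 2 \<notin> \<int>\<^sub>\<le>\<^sub>0" "(of_nat \<epsilon> - ?d + 1 + r) / 2 \<notin> \<int>\<^sub>\<le>\<^sub>0" by metis+
  moreover have "(of_nat \<epsilon> + ?h - r) / 2 \<notin> \<int>\<^sub>\<le>\<^sub>0" "(of_nat \<epsilon> - ?d + 1 - r) / 2 \<notin> \<int>\<^sub>\<le>\<^sub>0"
    using Z unfolding Z_defined_def by simp_all
  ultimately show ?thesis
    unfolding Z_eq by (simp add: Gamma_eq_zero_iff)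
qed

section \<open>Pole orders of the meromorphic family and its renormalization\<close>

definition pole_order :: "complex \<Rightarrow> (complex \<Rightarrow> complex) \<Rightarrow> int \<Rightarrow> bool" where
  "pole_order r f n \<longleftrightarrow> (\<exists>c. c \<noteq> 0 \<and> ((\<lambda>s. (s - r) powi n * f s) \<longlongrightarrow> c) (at r))"

lemma eventually_diff_nz: "eventually (\<lambda>s. s - r \<noteq> (0::complex)) (at r)"
  by (simp add: eventually_at_filter)

lemma pole_order_mult:
  assumes "pole_order r f n" "pole_order r g m"
  shows "pole_order r (\<lambda>s. f s * g s) (n + m)"
proof -
  obtain c d where cd: "c \<noteq> 0" "d \<noteq> 0" "((\<lambda>s. (s - r) powi n * f s) \<longlongrightarrow> c) (at r)"
    "((\<lambda>s. (s - r) powi m * g s) \<longlongrightarrow> d) (at r)" using assms unfolding pole_order_def by blast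
  have "((\<lambda>s. ((s - r) powi n * f s) * ((s - r) powi m * g s)) \<longlongrightarrow> c * d) (at r)"
    by (intro tendsto_mult cd)
  moreover have "eventually (\<lambda>s. ((s - r) powi n * f s) * ((s - r) powi m * g s) = (s - r) powi (n + m) * (f s * g s)) (at r)"
    using eventually_diff_nz by eventually_elim (simp add: power_int_add)
  ultimately have "((\<lambda>s. (s - r) powi (n + m) * (f s * g s)) \<longlongrightarrow> c * d) (at r)"
    by (rule Lim_transform_eventually)
  then show ?thesis using cd unfolding pole_order_def by (intro exI[of _ "c * d"]) auto
qed

lemma pole_order_divide:
  assumes "pole_order r f n" "pole_order r g m"
  shows "pole_order r (\<lambda>s. f s / g s) (n - m)"
proof -
  obtain c where c: "c \<noteq> 0" "((\<lambda>s. (s - r) powi m * g s) \<longlongrightarrow> c) (at r)"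
    using assms(2) unfolding pole_order_def by blast
  have "((\<lambda>s. inverse ((s - r) powi m * g s)) \<longlongrightarrow> inverse c) (at r)"
    using c by (intro tendsto_inverse)
  then have "pole_order r (\<lambda>s. inverse (g s)) (- m)"
    unfolding pole_order_def using c by (intro exI[of _ "inverse c"]) (simp add: power_int_minus)
  from pole_order_mult[OF assms(1) this] show ?thesis by (simp add: divide_inverse)
qed

text \<open>Gamma has simple poles and no zeros, so no other orders occur.\<close>

definition gamma_pole :: "complex \<Rightarrow> int" where
  "gamma_pole z = (if z \<in> \<int>\<^sub>\<le>\<^sub>0 then 1 else 0)"

lemma pole_order_Gamma:
  assumes \<beta>: "\<beta> \<noteq> 0"
  shows "pole_order r (\<lambda>s. Gamma (\<alpha> + \<beta> * s)) (gamma_pole (\<alpha> + \<beta> * r))"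
proof (cases "\<alpha> + \<beta> * r \<in> \<int>\<^sub>\<le>\<^sub>0")
  case False
  have "((\<lambda>s. Gamma (\<alpha> + \<beta> * s)) \<longlongrightarrow> Gamma (\<alpha> + \<beta> * r)) (at r)"
    using False by (intro tendsto_Gamma) (auto intro!: tendsto_eq_intros)
  then show ?thesis
    using False unfolding pole_order_def gamma_pole_def
    by (intro exI[of _ "Gamma (\<alpha> + \<beta> * r)"]) (simp add: Gamma_eq_zero_iff)
next
  case True
  then obtain n where n: "\<alpha> + \<beta> * r = - of_nat n" by (rule nonpos_Ints_cases')
  have "filterlim (\<lambda>s. \<alpha> + \<beta> * s) (at (- of_nat n)) (at r)"
    unfolding filterlim_at
  proof
    show "((\<lambda>s. \<alpha> + \<beta> * s) \<longlongrightarrow> - of_nat n) (at r)"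
      unfolding n[symmetric] by (intro tendsto_intros)
    have "\<alpha> + \<beta> * s \<noteq> - of_nat n" if "s \<noteq> r" for s
      using that \<beta> unfolding n[symmetric] by simp
    then show "eventually (\<lambda>s. \<alpha> + \<beta> * s \<in> UNIV \<and> \<alpha> + \<beta> * s \<noteq> - of_nat n) (at r)"
      by (auto simp: eventually_at_filter)
  qed
  from filterlim_compose[OF Gamma_residues this]
  have "((\<lambda>s. Gamma (\<alpha> + \<beta> * s) * (\<alpha> + \<beta> * s + of_nat n)) \<longlongrightarrow> (- 1) ^ n / fact n) (at r)" .
  \<comment> \<open>The residue is taken in the variable \<open>\<alpha> + \<beta> * s\<close>;
    dividing by \<open>\<beta>\<close> converts its increment into \<open>s - r\<close>.\<close>
  then have "((\<lambda>s. inverse \<beta> * (Gamma (\<alpha> + \<beta> * s) * (\<alpha> + \<beta> * s + of_nat n))) \<longlongrightarrow> inverse \<beta> * ((- 1) ^ n / fact n)) (at r)"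
    by (intro tendsto_mult tendsto_const)
  moreover have "inverse \<beta> * (Gamma (\<alpha> + \<beta> * s) * (\<alpha> + \<beta> * s + of_nat n)) = (s - r) powi 1 * Gamma (\<alpha> + \<beta> * s)" for s
  proof -
    have "of_nat n = - (\<alpha> + \<beta> * r)" using n by simp
    then have "\<alpha> + \<beta> * s + of_nat n = \<beta> * (s - r)" by (simp add: algebra_simps)
    then show ?thesis using \<beta> by simp
  qed
  ultimately show ?thesis
    using True \<beta> unfolding pole_order_def gamma_pole_def
    by (intro exI[of _ "inverse \<beta> * ((- 1) ^ n / fact n)"]) simp
qed

lemma pole_order_Gamma_half:
  "pole_order r (\<lambda>s. Gamma ((a + s) / 2)) (gamma_pole ((a + r) / 2))"
  "pole_order r (\<lambda>s. Gamma ((a - s) / 2)) (gamma_pole ((a - r) / 2))"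
  using pole_order_Gamma[of "1 / 2" r "a / 2"] pole_order_Gamma[of "- 1 / 2" r "a / 2"]
  by (simp_all add: add_divide_distrib diff_divide_distrib)

text \<open>The library sets \<open>Gamma\<close> to 0 exactly at its poles. A nonzero limit of the
  rescaled function therefore keeps the argument off the poles near \<open>r\<close>.\<close>

lemma eventually_not_nonpos_Int: "eventually (\<lambda>s. (a + s) / 2 \<notin> \<int>\<^sub>\<le>\<^sub>0) (at (r :: complex))"
proof -
  obtain c where c: "c \<noteq> 0" "((\<lambda>s. (s - r) powi gamma_pole ((a + r) / 2) * Gamma ((a + s) / 2)) \<longlongrightarrow> c) (at r)"
    using pole_order_Gamma_half(1)[of r a] unfolding pole_order_def by blast
  from tendsto_imp_eventually_ne[OF c(2,1)] show ?thesis
    by eventually_elim (auto simp: Gamma_eq_zero_iff)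
qed

definition Z_order :: "nat \<Rightarrow> nat \<Rightarrow> nat \<Rightarrow> complex \<Rightarrow> nat \<Rightarrow> nat \<Rightarrow> int" where
  "Z_order p q \<epsilon> r j k = (let h = of_nat (p + q) / 2; d = (of_nat p - of_nat q) / 2 in
    gamma_pole ((of_nat j + of_nat k + h + r) / 2) - gamma_pole ((of_nat j + of_nat k + h - r) / 2) +
    (gamma_pole ((of_nat k - of_nat j - d + 1 + r) / 2) - gamma_pole ((of_nat k - of_nat j - d + 1 - r) / 2)) +
    (gamma_pole ((of_nat \<epsilon> - d + 1 - r) / 2) + gamma_pole ((of_nat \<epsilon> + h - r) / 2) -
     (gamma_pole ((of_nat \<epsilon> - d + 1 + r) / 2) + gamma_pole ((of_nat \<epsilon> + h + r) / 2))))"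

lemma pole_order_Z: "pole_order r (\<lambda>s. Z p q \<epsilon> s j k) (Z_order p q \<epsilon> r j k)"
  unfolding Z_eq Z_order_def Let_def
  by (intro pole_order_mult pole_order_divide pole_order_Gamma_half)

text \<open>There are four Gamma factors above and four below, each of order 0 or 1. The bound makes
  the pole orders over the infinitely many pairs \<open>(j, k)\<close> have a maximum.\<close>

lemma Z_order_bound: "Z_order p q \<epsilon> r j k \<in> {-4..4}"
proof -
  have "gamma_pole z \<in> {0..1}" for z by (simp add: gamma_pole_def)
  then have "0 \<le> gamma_pole z" "gamma_pole z \<le> 1" for z by auto
  then show ?thesis unfolding Z_order_def Let_def atLeastAtMost_iff by (smt (verit))
qed

text \<open>The normalizing factors cancel the others here, so the maximal order is nonnegative and
  can serve as the exponent of an ordinary power.\<close>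

lemma Z_order_0: "Z_order p q \<epsilon> r 0 \<epsilon> = 0"
  by (simp add: Z_order_def Let_def)

lemma renormalized_Z_exists:
  assumes \<epsilon>: "\<epsilon> \<in> {0, 1}"
  obtains W where "renormalized_Z p q \<epsilon> r W" "recur p q \<epsilon> r W"
proof -
  let ?O = "Z_order p q \<epsilon> r"
  define S where "S = {?O j k | j k. (j + k) mod 2 = \<epsilon>}"
  have S: "finite S" "0 \<in> S"
  proof -
    have "S \<subseteq> {-4..4}" unfolding S_def using Z_order_bound by blast
    then show "finite S" using finite_subset by blast
    have "(0 + \<epsilon>) mod 2 = \<epsilon>" using \<epsilon> by auto
    then show "0 \<in> S" unfolding S_def using Z_order_0 by (metis (mono_tags, lifting) mem_Collect_eq)
  qed
  \<comment> \<open>Multiplying by this power makes all limits finite and keeps a nonzero limit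
    wherever the maximal order is attained.\<close>
  define m where "m = nat (Max S)"
  have m0: "Max S \<ge> 0" using S by simp
  then have m: "int m = Max S" by (simp add: m_def)
  have le: "?O j k \<le> int m" if "(j + k) mod 2 = \<epsilon>" for j k
    unfolding m using S(1) that by (intro Max_ge) (auto simp: S_def)
  have "Max S \<in> S" using S by (intro Max_in) auto
  then obtain j1 k1 where jk1: "(j1 + k1) mod 2 = \<epsilon>" "?O j1 k1 = int m"
    unfolding m by (auto simp: S_def)
  have "\<exists>c. \<forall>j k. c j k \<noteq> 0 \<and> ((\<lambda>s. (s - r) powi ?O j k * Z p q \<epsilon> s j k) \<longlongrightarrow> c j k) (at r)"
    using pole_order_Z unfolding pole_order_def by metis
  then obtain c where c: "\<And>j k. c j k \<noteq> 0"
    "\<And>j k. ((\<lambda>s. (s - r) powi ?O j k * Z p q \<epsilon> s j k) \<longlongrightarrow> c j k) (at r)" by blast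
  \<comment> \<open>As \<open>0 ^ 0 = 1\<close>, the leading coefficient survives exactly where the
    pole order is maximal; elsewhere \<open>W\<close> is 0.\<close>
  define W where "W j k = 0 ^ nat (int m - ?O j k) * c j k" for j k
  have lim: "((\<lambda>s. (s - r) ^ m * Z p q \<epsilon> s j k) \<longlongrightarrow> W j k) (at r)" if "(j + k) mod 2 = \<epsilon>" for j k
  proof -
    have "((\<lambda>s. (s - r) ^ nat (int m - ?O j k) * ((s - r) powi ?O j k * Z p q \<epsilon> s j k)) \<longlongrightarrow> W j k) (at r)"
      unfolding W_def by (intro tendsto_mult c(2) tendsto_power) (auto intro!: tendsto_eq_intros)
    moreover have "eventually (\<lambda>s. (s - r) ^ nat (int m - ?O j k) * ((s - r) powi ?O j k * Z p q \<epsilon> s j k)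
        = (s - r) ^ m * Z p q \<epsilon> s j k) (at r)"
      using eventually_diff_nz
    proof eventually_elim
      case (elim s)
      have "(s - r) ^ nat (int m - ?O j k) * (s - r) powi ?O j k = (s - r) powi (int m - ?O j k) * (s - r) powi ?O j k"
        using le[OF that] by (simp add: power_int_def)
      also have "\<dots> = (s - r) powi (int m - ?O j k + ?O j k)"
        using elim by (intro power_int_add[symmetric]) auto
      also have "\<dots> = (s - r) ^ m" by simp
      finally show ?case by (simp add: mult.assoc[symmetric])
    qed
    ultimately show ?thesis by (rule Lim_transform_eventually)
  qed
  have ren: "renormalized_Z p q \<epsilon> r W"
    unfolding renormalized_Z_def
  proof (rule exI[of _ m], rule conjI)
    show "\<exists>j k. (j + k) mod 2 = \<epsilon> \<and> W j k \<noteq> 0"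
      using jk1 c(1) by (intro exI[of _ j1] exI[of _ k1]) (simp add: W_def)
  qed (use lim in blast)
  \<comment> \<open>The recurrences hold for \<open>Z\<close> at all \<open>s\<close> near but
    different from \<open>r\<close>; multiplied by \<open>(s - r) ^ m\<close> they pass to the
    limit.\<close>
  have rel: "W j k * x r = W j' k' * y r"
    if par: "(j + k) mod 2 = \<epsilon>" "(j' + k') mod 2 = \<epsilon>" and xy: "isCont x r" "isCont y r"
      and ev: "eventually (\<lambda>s. Z p q \<epsilon> s j k * x s = Z p q \<epsilon> s j' k' * y s) (at r)"
    for j k j' k' x y
  proof -
    have l: "((\<lambda>s. (s - r) ^ m * Z p q \<epsilon> s j k * x s) \<longlongrightarrow> W j k * x r) (at r)"
      "((\<lambda>s. (s - r) ^ m * Z p q \<epsilon> s j' k' * y s) \<longlongrightarrow> W j' k' * y r) (at r)"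
      using xy lim par by (auto intro!: tendsto_mult simp: isCont_def)
    have e: "eventually (\<lambda>s. (s - r) ^ m * Z p q \<epsilon> s j k * x s = (s - r) ^ m * Z p q \<epsilon> s j' k' * y s) (at r)"
      using ev by eventually_elim (simp add: mult.assoc)
    show ?thesis
      by (rule tendsto_unique[OF at_neq_bot Lim_transform_eventually[OF l(1) e] l(2)])
  qed
  have "recur p q \<epsilon> r W"
    unfolding recur_def
  proof (intro conjI allI impI)
    fix j k :: nat assume par: "(j + k) mod 2 = \<epsilon>"
    let ?A = "of_nat j + of_nat k + of_nat (p + q) / 2 :: complex"
    show "W (Suc j) (Suc k) * (?A - r) =
      W j k * (?A + r)"
    proof (rule rel[where x = "\<lambda>s. ?A - s"
          and y = "\<lambda>s. ?A + s"])
      show "(Suc j + Suc k) mod 2 = \<epsilon>" using par by simp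
      show "eventually (\<lambda>s. Z p q \<epsilon> s (Suc j) (Suc k) * (?A - s) =
        Z p q \<epsilon> s j k * (?A + s)) (at r)"
        using eventually_not_nonpos_Int by (rule eventually_mono) (rule Z_recur1)
    qed (use par in \<open>auto intro!: continuous_intros\<close>)
  next
    fix j k :: nat assume par: "Suc (j + k) mod 2 = \<epsilon>"
    let ?B = "of_nat k - of_nat j - (of_nat p - of_nat q) / 2 :: complex"
    show "W (Suc j) k * (?B + r) =
      W j (Suc k) * (?B - r)"
    proof (rule rel[where x = "\<lambda>s. ?B + s"
          and y = "\<lambda>s. ?B - s"])
      show "eventually (\<lambda>s. Z p q \<epsilon> s (Suc j) k * (?B + s) =
        Z p q \<epsilon> s j (Suc k) * (?B - s)) (at r)"
        using eventually_not_nonpos_Int by (rule eventually_mono) (rule Z_recur2)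
    qed (use par in \<open>auto intro!: continuous_intros\<close>)
  qed
  with ren show ?thesis using that by blast
qed

theorem theorem3p1:
  fixes p q \<epsilon> :: nat and r :: complex
  assumes "p \<ge> 1" and "q \<ge> 1"
    and "CARD('m::finite) = p + 1" and "CARD('n::finite) = q + 1"
    and "\<epsilon> \<in> {0, 1}"
  defines "is_spectrum \<equiv> (\<lambda>\<mu>.
     \<exists>A :: (('m, 'n) mfd \<Rightarrow> complex) \<Rightarrow> (('m, 'n) mfd \<Rightarrow> complex).
       intertwinor p q \<epsilon> r A \<and> spectral_function p q \<epsilon> A \<mu>)"
    and "multiple_of \<equiv> (\<lambda>\<mu> \<nu>. \<exists>c::complex.
       \<forall>j k. (j + k) mod 2 = \<epsilon> \<longrightarrow> \<mu> j k = c * \<nu> j k)"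
  shows "(Z_defined p q \<epsilon> r \<longrightarrow>
            (\<exists>j k. (j + k) mod 2 = \<epsilon> \<and> Z p q \<epsilon> r j k \<noteq> 0) \<and>
            (\<forall>\<mu>. is_spectrum \<mu> \<longleftrightarrow> multiple_of \<mu> (Z p q \<epsilon> r)))
       \<and> (\<exists>W. renormalized_Z p q \<epsilon> r W \<and> is_spectrum W \<and>
            (\<not> decoupled p q \<epsilon> r \<longrightarrow> (\<forall>\<mu>. is_spectrum \<mu> \<longleftrightarrow> multiple_of \<mu> W)))"
proof -
  have spec: "is_spectrum \<mu> \<longleftrightarrow> recur p q \<epsilon> r \<mu>" for \<mu>
    unfolding is_spectrum_def by (rule spectrum_iff_recur[OF assms(3,4,1,2)])
  have par: "(0 + \<epsilon>) mod 2 = \<epsilon>" using assms(5) by auto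
  note unique = recur_unique[OF assms(5,1,2)]
  obtain W where W: "renormalized_Z p q \<epsilon> r W" "recur p q \<epsilon> r W"
    using renormalized_Z_exists[OF assms(5)] .
  obtain j1 k1 where jk: "(j1 + k1) mod 2 = \<epsilon>" "W j1 k1 \<noteq> 0"
    using W(1) unfolding renormalized_Z_def by blast
  have "is_spectrum \<mu> \<longleftrightarrow> multiple_of \<mu> (Z p q \<epsilon> r)" if "Z_defined p q \<epsilon> r" for \<mu>
    unfolding spec multiple_of_def
    by (rule unique[OF decoupled_not_Z_defined[OF assms(5) that] recur_Z[OF that] par Z_nonzero[OF assms(5) that]])
  moreover have "\<exists>j k. (j + k) mod 2 = \<epsilon> \<and> Z p q \<epsilon> r j k \<noteq> 0" if "Z_defined p q \<epsilon> r"
    using par Z_nonzero[OF assms(5) that] by blast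
  moreover have "is_spectrum \<mu> \<longleftrightarrow> multiple_of \<mu> W" if "\<not> decoupled p q \<epsilon> r" for \<mu>
    unfolding spec multiple_of_def by (rule unique[OF that W(2) jk])
  ultimately show ?thesis using W spec by blast
qed

end
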